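(* In the setting below, suppose $S$ is a Polish space and consider an invariant RTP with marginal distribution $\mu$. (a) If the RTP is endogenous, then bivariate uniqueness holds for $\mu$. (b) Conversely, if bivariate uniqueness holds for $\mu$ and $T^{(2)}$ is continuous with respect to weak convergence on the set of probability measures on $S\times S$ with both marginals equal to $\mu$, then the RTP is endogenous. (c) The RTP is endogenous if and only if $(T^{(2)})^n(\mu\otimes\mu)\to\mu^{\nearrow}$ weakly as $n\to\infty$, where $(T^{(2)})^n$ is the $n$-th iterate of $T^{(2)}$.
   Context: Setting. Let $(S,\mathcal S)$ and $(\Theta,\mathcal T)$ be measurable spaces and $\Theta^*=\Theta\times\bigsqcup_{0\le m\le\infty}S^m$ (disjoint union; $S^0$ a single point, $S^\infty$ the countable product). Let $g:\Theta^*\to S$ be measurable and $\nu$ a probability measure on $\Theta\times\{0,1,2,\dots,\infty\}$. Write $i\le^* N$ to mean $i\le N$ if $N<\infty$ and $i<\infty$ if $N=\infty$. The induced map $T$ sends a probability measure $\mu$ on $S$ to the law of $g(\xi,X_i,1\le i\le^*N)$, where $(\xi,N)\sim\nu$ and $(X_i)_{i\ge1}$ are i.i.d. with law $\mu$, independent of $(\xi,N)$. A fixed point is a $\mu$ with $T(\mu)=\mu$. Let $\mathbb T$ be the set of finite words $\mathbf i=i_1\cdots i_d$ of positive integers (the empty word $\emptyset$ is the root, $\mathrm{gen}(\mathbf i)=d$, the children of $\mathbf i$ are $\mathbf ij$, $j\ge1$), and let $(\xi_{\mathbf i},N_{\mathbf i})$, $\mathbf i\in\mathbb T$, be i.i.d.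 with law $\nu$. An invariant recursive tree process (RTP) with marginal $\mu$ is a family of $S$-valued random variables $(X_{\mathbf i})_{\mathbf i\in\mathbb T}$ defined on the same probability space such that: each $X_{\mathbf i}$ has law $\mu$; $X_{\mathbf i}=g(\xi_{\mathbf i},X_{\mathbf ij},1\le j\le^*N_{\mathbf i})$ a.s. for every $\mathbf i$; and for every $d$ the variables $\{X_{\mathbf i}:\mathrm{gen}(\mathbf i)=d\}$ are i.i.d. and independent of $\{(\xi_{\mathbf i},N_{\mathbf i}):\mathrm{gen}(\mathbf i)<d\}$. The RTP is endogenous if $X_\emptyset$ is measurable with respect to $\mathcal G=\sigma((\xi_{\mathbf i},N_{\mathbf i}),\mathbf i\in\mathbb T)$. Bivariate map: $T^{(2)}$ sends a probability measure $\mu^{(2)}$ on $S\times S$ to the law of $\big(g(\xi,X_i^{(1)},1\le i\le^*N),\,g(\xi,X_i^{(2)},1\le i\le^*N)\big)$, where $(X_i^{(1)},X_i^{(2)})$, $i\ge1$, are i.i.d. with law $\mu^{(2)}$, independent of $(\xi,N)\sim\nu$ (the same $(\xi,N)$ is used in both coordinates). For $\mu$ on $S$, $\mu^{\nearrow}$ is the law of $(X,X)$ with $X\sim\mu$, and $\mu\otimes\mu$ is the product measure. For a fixed point $\mu$ of $T$, bivariate uniqueness holds if $\mu^{\nearrow}$ is the unique fixed point of $T^{(2)}$ among probability measures on $S\times S$ with both marginals equal to $\mu$.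
   Formalization: Endogenous is taken to mean that the root variable is almost surely equal to a G-measurable variable; with literal measurability, (b) and the "if" part of (c) fail, since the recursion holds only almost surely and the root variable can be altered on a null set. *)

theory Defs
  imports "HOL-Probability.Probability"
begin

text \<open>Arguments of g: for N in {0,1,...,infinity} (type enat) the index set
  {i. 1 \<le> i and i \<le>* N}; note that for enat, (enat i \<le> \<infinity>) holds for all i,
  which matches the convention i \<le>* \<infinity> iff i < \<infinity>.\<close>
definition idx :: "enat \<Rightarrow> nat set" where
  "idx N = {i. 1 \<le> i \<and> enat i \<le> N}"

definition coprod_measure :: "'i set \<Rightarrow> ('i \<Rightarrow> 'b measure) \<Rightarrow> ('i \<times> 'b) measure" where
  "coprod_measure I M =
     sigma (SIGMA i:I. space (M i))
       {A. A \<subseteq> (SIGMA i:I. space (M i)) \<and> (\<forall>i\<in>I. Pair i -` A \<in> sets (M i))}"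

text \<open>Theta* = Theta x (disjoint union over 0 \<le> m \<le> \<infinity> of S^m); S^m is the product
  of m copies of (S, Borel) indexed by idx m (S^0 is a single point).\<close>
definition Theta_star :: "'t measure \<Rightarrow> ('t \<times> enat \<times> (nat \<Rightarrow> 'a::topological_space)) measure" where
  "Theta_star Th = Th \<Otimes>\<^sub>M coprod_measure UNIV (\<lambda>N. PiM (idx N) (\<lambda>_. borel))"

definition gstar :: "('t \<times> enat \<times> (nat \<Rightarrow> 'a) \<Rightarrow> 'a) \<Rightarrow> 't \<Rightarrow> enat \<Rightarrow> (nat \<Rightarrow> 'a) \<Rightarrow> 'a" where
  "gstar g th N x = g (th, N, restrict x (idx N))"

definition T2 :: "('t \<times> enat) measure \<Rightarrow> ('t \<times> enat \<times> (nat \<Rightarrow> 'a::topological_space) \<Rightarrow> 'a)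
    \<Rightarrow> ('a \<times> 'a) measure \<Rightarrow> ('a \<times> 'a) measure" where
  "T2 nu g mu2 = distr (nu \<Otimes>\<^sub>M PiM UNIV (\<lambda>_. mu2)) borel
     (\<lambda>((th, N), x). (gstar g th N (\<lambda>i. fst (x i)), gstar g th N (\<lambda>i. snd (x i))))"

definition diag_law :: "'a::topological_space measure \<Rightarrow> ('a \<times> 'a) measure" where
  "diag_law mu = distr mu borel (\<lambda>x. (x, x))"

definition biv_set :: "'a::topological_space measure \<Rightarrow> ('a \<times> 'a) measure set" where
  "biv_set mu = {m. prob_space m \<and> sets m = sets borel \<and>
      distr m borel fst = mu \<and> distr m borel snd = mu}"

definition bivariate_uniqueness :: "('t \<times> enat) measure \<Rightarrow> ('t \<times> enat \<times> (nat \<Rightarrow> 'a::topological_space) \<Rightarrow> 'a)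
    \<Rightarrow> 'a measure \<Rightarrow> bool" where
  "bivariate_uniqueness nu g mu \<longleftrightarrow>
     (\<forall>m \<in> biv_set mu. T2 nu g m = m \<longrightarrow> m = diag_law mu)"

definition weak_conv_meas :: "(nat \<Rightarrow> 'b::topological_space measure) \<Rightarrow> 'b measure \<Rightarrow> bool" where
  "weak_conv_meas Ms M \<longleftrightarrow>
     (\<forall>f :: 'b \<Rightarrow> real. continuous_on UNIV f \<and> bounded (range f) \<longrightarrow>
        (\<lambda>n. integral\<^sup>L (Ms n) f) \<longlonglongrightarrow> integral\<^sup>L M f)"

text \<open>Continuity of T2 w.r.t. weak convergence on the set P (sequential form; the
  weak topology on probability measures on a Polish space is metrizable).\<close>
definition weakly_continuous_on :: "('b::topological_space measure) set \<Rightarrow> ('b measure \<Rightarrow> 'b measure) \<Rightarrow> bool" where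
  "weakly_continuous_on P F \<longleftrightarrow>
     (\<forall>Ms m. (\<forall>n. Ms n \<in> P) \<and> m \<in> P \<and> weak_conv_meas Ms m \<longrightarrow> weak_conv_meas (\<lambda>n. F (Ms n)) (F m))"

text \<open>The Ulam--Harris tree: finite words of positive integers; the children of w
  are w @ [j], j \<ge> 1; gen w = length w.\<close>
definition TT :: "nat list set" where
  "TT = {w. \<forall>j\<in>set w. 0 < j}"

definition innov_sigma :: "'w measure \<Rightarrow> 't measure \<Rightarrow> (nat list \<Rightarrow> 'w \<Rightarrow> 't \<times> enat)
    \<Rightarrow> nat list set \<Rightarrow> 'w set set" where
  "innov_sigma M Th xi J = sigma_sets (space M)
     (\<Union>i\<in>J. {xi i -` A \<inter> space M | A. A \<in> sets (Th \<Otimes>\<^sub>M count_space UNIV)})"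

definition invariant_RTP :: "'w measure \<Rightarrow> 't measure \<Rightarrow> ('t \<times> enat) measure
    \<Rightarrow> ('t \<times> enat \<times> (nat \<Rightarrow> 'a::topological_space) \<Rightarrow> 'a) \<Rightarrow> 'a measure
    \<Rightarrow> (nat list \<Rightarrow> 'w \<Rightarrow> 't \<times> enat) \<Rightarrow> (nat list \<Rightarrow> 'w \<Rightarrow> 'a) \<Rightarrow> bool" where
  "invariant_RTP M Th nu g mu xi X \<longleftrightarrow>
     prob_space M \<and>
     \<comment> \<open>(xi_i, N_i), i in TT, i.i.d. with law nu\<close>
     prob_space.indep_vars M (\<lambda>_. Th \<Otimes>\<^sub>M count_space UNIV) xi TT \<and>
     (\<forall>i\<in>TT. distr M (Th \<Otimes>\<^sub>M count_space UNIV) (xi i) = nu) \<and>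
     \<comment> \<open>each X_i is an S-valued random variable with law mu\<close>
     (\<forall>i\<in>TT. X i \<in> measurable M borel \<and> distr M borel (X i) = mu) \<and>
     \<comment> \<open>recursion, almost surely\<close>
     (\<forall>i\<in>TT. AE w in M.
         X i w = gstar g (fst (xi i w)) (snd (xi i w)) (\<lambda>j. X (i @ [j]) w)) \<and>
     \<comment> \<open>generation d: X's i.i.d. and independent of the innovations of generations < d\<close>
     (\<forall>d. prob_space.indep_sets M
        (\<lambda>k. case k of
               None \<Rightarrow> innov_sigma M Th xi {i\<in>TT. length i < d}
             | Some i \<Rightarrow> {X i -` A \<inter> space M | A. A \<in> sets borel})
        (insert None (Some ` {i\<in>TT. length i = d})))"

definition endogenous :: "'w measure \<Rightarrow> 't measure \<Rightarrow> (nat list \<Rightarrow> 'w \<Rightarrow> 't \<times> enat)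
    \<Rightarrow> (nat list \<Rightarrow> 'w \<Rightarrow> 'a::topological_space) \<Rightarrow> bool" where
  "endogenous M Th xi X \<longleftrightarrow>
     (\<exists>Y. Y \<in> measurable (sigma (space M) (innov_sigma M Th xi TT)) borel \<and>
          (AE w in M. X [] w = Y w))"

end

(* Evaluating the recursion n generations deep gives a function R_n of the innovations e at depth < n
   and of values at depth n. The iterate T2^n(m) is the law of (R_n(e, y_1), R_n(e, y_2)) where the
   pairs (y_1, y_2) at depth n are i.i.d. with law m, and each coordinate, jointly with e, has the
   law of the root of the RTP jointly with its innovations.

   If the root is a function of the innovations, then {X in A} is approximated by events depending
   on finitely many generations, so T2^n(m)(A x -A) tends to 0 uniformly over all couplings m of
   (mu, mu); this gives (a) and one half of (c).

   For m = mu x mu the two coordinates are conditionally i.i.d. given e: the integral of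
   a(x) b(y) under T2^n(mu x mu) is E[h_n(a) h_n(b)] with h_n(a) = E[a(X) | n generations].
   Hence E(a(X) - h_n(a))^2 is the difference of the integrals of a(x) a(y) under the diagonal law
   and under T2^n(mu x mu), which gives the other half of (c). Since E[h_n(a)^2] increases with n,
   polarization shows that T2^n(mu x mu) converges on rectangles. For couplings of two laws on
   Polish spaces, the limit on rectangles extends to a measure, the weak limit, which is a fixed
   point of T2 when T2 is continuous; this reduces (b) to (c). *)
theory Submission
  imports Defs
begin

section \<open>Weak convergence\<close>

text \<open>The values of generation \<open>n\<close> are independent only of the innovations above
  depth \<open>n\<close>, so the RTP is compared with an i.i.d. model one depth at a time:
  \<open>root_law\<close> identifies the joint law of the truncated innovations and the root, and
  conditioning on \<open>n\<close> generations becomes the explicit integral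
  \<open>cond_mean\<close> over the values at depth \<open>n\<close>. Rectangles enter because
  conditional independence controls only integrals of products a(x) b(y); other continuous functions
  are reached through step functions on countably many rectangles. The obstacle in (b) is that
  limits of the masses of Borel rectangles need not come from a countably additive set function.
  Here they do: all iterates share their marginals, and by inner regularity of \<open>mu\<close>
  compact rectangles miss little mass uniformly in n. Continuity of \<open>T2\<close> then makes the
  limit a fixed point, since the iterates and their shifts have the same limit. In (a) no limit has
  to pass through \<open>T2\<close>: a fixed point equals all of its iterates, so the bound that is
  uniform over couplings applies to it directly.\<close>

lemma tendsto_measure_disjointed:
  fixes r :: "nat \<Rightarrow> 'b set"
  assumes Q: "\<And>n. finite_measure (Ms n)" "\<And>n. sets (Ms n) = sets m" "finite_measure m"
    and \<R>: "\<R> \<subseteq> sets m" "\<And>A B. A \<in> \<R> \<Longrightarrow> B \<in> \<R> \<Longrightarrow> A \<inter> B \<in> \<R>"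
    and conv: "\<And>A. A \<in> \<R> \<Longrightarrow> (\<lambda>n. measure (Ms n) A) \<longlonglongrightarrow> measure m A"
    and r: "\<And>i. r i \<in> \<R>"
  shows "(\<lambda>n. measure (Ms n) (disjointed r k)) \<longlonglongrightarrow> measure m (disjointed r k)"
proof -
  \<comment> \<open>Inclusion-exclusion, one set \<open>r k\<close> at a time. The set
    \<open>A\<close> has to stay arbitrary because the induction hypothesis is used for
    \<open>A\<close> and for \<open>A \<inter> r k\<close>, which lies in the class by its closure
    under intersection.\<close>
  have "(\<lambda>n. measure (Ms n) (A - (\<Union>i<k. r i))) \<longlonglongrightarrow> measure m (A - (\<Union>i<k. r i))" if "A \<in> \<R>" for A k
    using that
  proof (induction k arbitrary: A)
    case 0
    then show ?case using conv by simp
  next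
    case (Suc k)
    have eq: "measure M' (A - (\<Union>i<Suc k. r i)) =
        measure M' (A - (\<Union>i<k. r i)) - measure M' ((A \<inter> r k) - (\<Union>i<k. r i))"
      if "finite_measure M'" "sets M' = sets m" for M'
    proof -
      interpret finite_measure M' by fact
      have [measurable]: "A \<in> sets M'" "\<And>i. r i \<in> sets M'"
        using Suc.prems r \<R> that by auto
      have "A - (\<Union>i<Suc k. r i) = (A - (\<Union>i<k. r i)) - ((A \<inter> r k) - (\<Union>i<k. r i))"
        by (auto simp: lessThan_Suc)
      then show ?thesis
        by (simp add: finite_measure_Diff[symmetric] Diff_mono)
    qed
    have "A \<inter> r k \<in> \<R>" using Suc.prems r \<R> by auto
    then show ?case
      unfolding eq[OF Q(1,2)] eq[OF Q(3) refl]
      by (intro tendsto_diff Suc.IH Suc.prems)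
  qed
  from this[OF r] show ?thesis
    by (simp add: disjointed_def atLeast0LessThan)
qed

text \<open>By second countability the plane is covered by countably many basis rectangles on which
  \<open>f\<close> is nearly constant. Made disjoint, finitely many of them carry almost all of the
  limit mass. Convergence of the masses of these pieces shows that they also carry almost all mass
  of \<open>Ms n\<close>, so tightness is not an extra assumption but a consequence.\<close>

lemma weak_conv_measI_rectangles:
  fixes Ms :: "nat \<Rightarrow> ('a::second_countable_topology \<times> 'b::second_countable_topology) measure"
  assumes Q: "\<And>n. prob_space (Ms n)" "\<And>n. sets (Ms n) = sets borel"
    and m: "prob_space m" "sets m = sets borel"
    and conv: "\<And>A B. A \<in> sets borel \<Longrightarrow> B \<in> sets borel \<Longrightarrow>
      (\<lambda>n. measure (Ms n) (A \<times> B)) \<longlonglongrightarrow> measure m (A \<times> B)"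
  shows "weak_conv_meas Ms m"
  unfolding weak_conv_meas_def
proof (intro allI impI, elim conjE)
  fix f :: "'a \<times> 'b \<Rightarrow> real"
  assume f: "continuous_on UNIV f" and "bounded (range f)"
  then obtain b where b: "\<And>p. \<bar>f p\<bar> \<le> b" by (auto simp: bounded_iff)
  have b0: "b \<ge> 0" using b[of undefined] by simp
  have [measurable]: "f \<in> borel_measurable borel"
    using f by (rule borel_measurable_continuous_onI)
  obtain U :: "'a set set" where U: "countable U" "topological_basis U"
    using ex_countable_basis by blast
  obtain V :: "'b set set" where V: "countable V" "topological_basis V"
    using ex_countable_basis by blast
  define \<R> :: "('a \<times> 'b) set set" where "\<R> = {A \<times> B | A B. A \<in> sets borel \<and> B \<in> sets borel}"
  interpret m: prob_space m by fact
  have Rm: "\<R> \<subseteq> sets m" unfolding \<R>_def m(2) borel_prod[symmetric] by auto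
  have RI: "A \<inter> B \<in> \<R>" if AB: "A \<in> \<R>" "B \<in> \<R>" for A B
  proof -
    obtain A1 A2 B1 B2 where "A = A1 \<times> A2" "B = B1 \<times> B2"
      "A1 \<in> sets borel" "A2 \<in> sets borel" "B1 \<in> sets borel" "B2 \<in> sets borel"
      using AB by (auto simp: \<R>_def)
    moreover have "A1 \<times> A2 \<inter> B1 \<times> B2 = (A1 \<inter> B1) \<times> (A2 \<inter> B2)" by auto
    ultimately show ?thesis unfolding \<R>_def by blast
  qed
  have "\<exists>n0. \<forall>n\<ge>n0. \<bar>integral\<^sup>L (Ms n) f - integral\<^sup>L m f\<bar> < e" if e: "e > 0" for e
  proof -
    \<comment> \<open>The errors below add up to less than \<open>3 * d + 2 * (b * d)\<close>: at
      most \<open>d + b * d\<close> from each of the two step function approximations and less than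
      \<open>d\<close> from the masses of the pieces. The rest of the denominator is slack.\<close>
    define d where "d = e / (4 + 3 * b)"
    have d: "d > 0" using e b0 by (simp add: d_def)
    define good where "good = {A \<times> B | A B. A \<in> U \<and> B \<in> V \<and> (\<forall>p\<in>A \<times> B. \<forall>q\<in>A \<times> B. \<bar>f p - f q\<bar> \<le> d)}"
    have good_cover: "\<exists>G\<in>good. p \<in> G" for p
    proof -
      have "open (f -` {f p - d / 2 <..< f p + d / 2})"
        using f by (intro open_vimage) auto
      moreover have "p \<in> f -` {f p - d / 2 <..< f p + d / 2}" using d by auto
      ultimately obtain S T where ST: "open S" "open T" "fst p \<in> S" "snd p \<in> T"
         "S \<times> T \<subseteq> f -` {f p - d / 2 <..< f p + d / 2}"
        by (metis open_prod_elim mem_Times_iff)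
      obtain A where A: "A \<in> U" "fst p \<in> A" "A \<subseteq> S"
        using U(2) ST by (metis topological_basisE)
      obtain B where B: "B \<in> V" "snd p \<in> B" "B \<subseteq> T"
        using V(2) ST by (metis topological_basisE)
      have sub: "A \<times> B \<subseteq> f -` {f p - d / 2 <..< f p + d / 2}" using A B ST by blast
      have "\<bar>f x - f y\<bar> \<le> d" if "x \<in> A \<times> B" "y \<in> A \<times> B" for x y
      proof -
        from that sub have "x \<in> f -` {f p - d / 2 <..< f p + d / 2}" "y \<in> f -` {f p - d / 2 <..< f p + d / 2}"
          by blast+
        then show ?thesis by simp linarith
      qed
      then have "A \<times> B \<in> good" using A B unfolding good_def by blast
      then show ?thesis using A B by (intro bexI[of _ "A \<times> B"]) (auto simp: mem_Times_iff)
    qed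
    have "good \<subseteq> (\<lambda>(A, B). A \<times> B) ` (U \<times> V)" by (auto simp: good_def)
    then have "countable good" using U(1) V(1) by (meson countable_SIGMA countable_image countable_subset)
    moreover have "good \<noteq> {}" using good_cover by auto
    ultimately have rng: "range (from_nat_into good) = good" by simp
    define r where "r = from_nat_into good"
    have r_good: "r i \<in> good" for i using rng r_def by auto
    have r: "r i \<in> \<R>" for i
      using r_good[of i] U(2) V(2) unfolding good_def \<R>_def
      by (auto simp: topological_basis_open) (metis topological_basis_open borel_open)
    have rU: "(\<Union>i. r i) = UNIV" using good_cover rng unfolding r_def by auto
    define D where "D = disjointed r"
    have Dm: "D i \<in> sets borel" for i
      using sets.range_disjointed_sets[of r m] r Rm unfolding m(2) D_def by blast
    have DU: "(\<Union>i. D i) = UNIV" unfolding D_def UN_disjointed_eq rU ..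
    have Dd: "disjoint_family D" unfolding D_def by (rule disjoint_family_disjointed)
    have convD: "(\<lambda>n. measure (Ms n) (D i)) \<longlonglongrightarrow> measure m (D i)" for i
      unfolding D_def
    proof (rule tendsto_measure_disjointed[where \<R>=\<R>])
      show "finite_measure (Ms n)" for n using Q(1) by (rule prob_space.finite_measure)
      show "sets (Ms n) = sets m" for n using Q m by simp
    qed (use Rm RI r conv in \<open>auto simp: \<R>_def intro: m.finite_measure\<close>)
    have "(\<lambda>i. measure m (D i)) sums measure m (\<Union>i. D i)"
      using Dm Dd m(2) by (intro m.finite_measure_UNION) auto
    then have "(\<lambda>k. \<Sum>i<k. measure m (D i)) \<longlonglongrightarrow> 1"
      unfolding DU sums_def using m.prob_space by (simp add: m(2)[THEN sets_eq_imp_space_eq])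
    from order_tendstoD(1)[OF this, of "1 - d"] d obtain k where k: "(\<Sum>i<k. measure m (D i)) > 1 - d"
      by (auto simp: eventually_sequentially)
    \<comment> \<open>If \<open>D i\<close> is empty, \<open>c i\<close> is an arbitrary value of
      \<open>f\<close>, but it is then multiplied by a vanishing indicator or measure.\<close>
    define c where "c i = f (SOME p. p \<in> D i)" for i
    \<comment> \<open>The pieces are disjoint, so the sum of the indicators is 1 on the first
      \<open>k\<close> pieces and 0 elsewhere. The last term thus charges the bound \<open>b\<close>
      exactly where the step function is 0 and approximates nothing.\<close>
    have near: "\<bar>f p - (\<Sum>i<k. c i * indicator (D i) p)\<bar> \<le> d + b * (1 - (\<Sum>i<k. indicator (D i) p))" for p
    proof (cases "\<exists>j<k. p \<in> D j")
      case True
      then obtain j where j: "j < k" "p \<in> D j" by auto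
      have ind: "indicator (D i) p = (if i = j then 1 else 0 :: real)" for i
        using Dd j by (auto simp: disjoint_family_on_def indicator_def)
      have "\<bar>f p - c j\<bar> \<le> d"
      proof -
        have "(SOME p. p \<in> D j) \<in> D j" using j by (metis someI)
        moreover have "D j \<subseteq> r j" unfolding D_def by (rule disjointed_subset)
        ultimately show ?thesis using r_good[of j] j unfolding c_def good_def by blast
      qed
      then show ?thesis using j b0 by (simp add: ind if_distrib[of "(*) _"] sum.delta cong: if_cong)
    next
      case False
      then show ?thesis using b[of p] d by (simp add: indicator_def)
    qed
    have est: "\<bar>integral\<^sup>L M' f - (\<Sum>i<k. c i * measure M' (D i))\<bar> \<le> d + b * (1 - (\<Sum>i<k. measure M' (D i)))"
      if "prob_space M'" and M'[measurable_cong]: "sets M' = sets borel" for M'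
    proof -
      interpret prob_space M' by fact
      note [measurable] = Dm
      have sp: "space M' = UNIV" using M'[THEN sets_eq_imp_space_eq] by simp
      have fi: "integrable M' f" using b by (intro integrable_const_bound[of _ b]) auto
      have Di: "integrable M' (indicator (D i) :: _ \<Rightarrow> real)" for i
        by (intro integrable_const_bound[of _ 1]) (auto simp: indicator_def)
      have sum: "(\<integral>p. f p - (\<Sum>i<k. c i * g i p) \<partial>M') = integral\<^sup>L M' f - (\<Sum>i<k. c i * integral\<^sup>L M' (g i))"
        if "\<And>i. integrable M' (g i)" for g :: "nat \<Rightarrow> _ \<Rightarrow> real"
        using fi that by simp
      have int: "(\<integral>p. f p - (\<Sum>i<k. c i * indicator (D i) p) \<partial>M')
          = integral\<^sup>L M' f - (\<Sum>i<k. c i * measure M' (D i))"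
        by (subst sum) (simp_all add: Di sp)
      have "\<bar>integral\<^sup>L M' f - (\<Sum>i<k. c i * measure M' (D i))\<bar>
          = \<bar>\<integral>p. f p - (\<Sum>i<k. c i * indicator (D i) p) \<partial>M'\<bar>"
        unfolding int ..
      also have "\<dots> \<le> (\<integral>p. \<bar>f p - (\<Sum>i<k. c i * indicator (D i) p)\<bar> \<partial>M')"
        by (rule integral_abs_bound)
      also have "\<dots> \<le> (\<integral>p. d + b * (1 - (\<Sum>i<k. indicator (D i) p)) \<partial>M')"
        using near by (intro integral_mono Bochner_Integration.integrable_abs Bochner_Integration.integrable_diff
            Bochner_Integration.integrable_add Bochner_Integration.integrable_sum integrable_mult_right fi Di)
          simp_all
      also have "\<dots> = d + b * (1 - (\<Sum>i<k. measure M' (D i)))"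
        using Di prob_space by (simp add: sp)
      finally show ?thesis .
    qed
    have "(\<lambda>n. \<Sum>i<k. c i * measure (Ms n) (D i)) \<longlonglongrightarrow> (\<Sum>i<k. c i * measure m (D i))"
      by (intro tendsto_intros convD)
    from tendstoD[OF this d]
    have e1: "\<forall>\<^sub>F n in sequentially. \<bar>(\<Sum>i<k. c i * measure (Ms n) (D i)) - (\<Sum>i<k. c i * measure m (D i))\<bar> < d"
      by (simp add: dist_real_def)
    have "(\<lambda>n. \<Sum>i<k. measure (Ms n) (D i)) \<longlonglongrightarrow> (\<Sum>i<k. measure m (D i))"
      by (intro tendsto_intros convD)
    from order_tendstoD(1)[OF this k] e1
    have "\<forall>\<^sub>F n in sequentially. \<bar>integral\<^sup>L (Ms n) f - integral\<^sup>L m f\<bar> < e"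
    proof eventually_elim
      case (elim n)
      have "b * (1 - (\<Sum>i<k. measure (Ms n) (D i))) \<le> b * d"
        using elim b0 by (intro mult_left_mono) auto
      moreover have "b * (1 - (\<Sum>i<k. measure m (D i))) \<le> b * d"
        using k b0 by (intro mult_left_mono) auto
      moreover have "e = d * (4 + 3 * b)" using b0 by (simp add: d_def)
      then have "e = 4 * d + 3 * (b * d)" by (simp add: algebra_simps)
      moreover have "b * d \<ge> 0" using b0 d by simp
      ultimately show ?case
        using est[OF Q(1,2), of n] est[OF m] elim d by linarith
    qed
    then show ?thesis by (simp add: eventually_sequentially)
  qed
  then show "(\<lambda>n. integral\<^sup>L (Ms n) f) \<longlonglongrightarrow> integral\<^sup>L m f"
    by (simp add: LIMSEQ_iff)
qed

lemma closed_indicator_approx: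
  fixes C :: "'b::metric_space set"
  assumes "closed C"
  obtains \<phi> :: "nat \<Rightarrow> 'b \<Rightarrow> real"
  where "\<And>k. continuous_on UNIV (\<phi> k)" "\<And>k x. 0 \<le> \<phi> k x" "\<And>k x. \<phi> k x \<le> 1"
    "\<And>x. (\<lambda>k. \<phi> k x) \<longlonglongrightarrow> indicator C x"
\<comment> \<open>The distance to the empty set is 0 by convention, so the formula used below would
  give the constant 1.\<close>
proof (cases "C = {}")
  case True
  then show ?thesis by (intro that[of "\<lambda>_ _. 0"]) auto
next
  case False
  define \<phi> where "\<phi> k x = max 0 (1 - real k * infdist x C)" for k x
  show ?thesis
  proof (rule that[of \<phi>])
    show "continuous_on UNIV (\<phi> k)" for k
      unfolding \<phi>_def by (intro continuous_intros)
    show "0 \<le> \<phi> k x" "\<phi> k x \<le> 1" for k x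
      by (auto simp: \<phi>_def infdist_nonneg)
    show "(\<lambda>k. \<phi> k x) \<longlonglongrightarrow> indicator C x" for x
    proof (cases "x \<in> C")
      case True
      then show ?thesis by (simp add: \<phi>_def)
    next
      case out: False
      then have pos: "infdist x C > 0"
        using in_closed_iff_infdist_zero[OF \<open>closed C\<close> False] infdist_nonneg[of x C] by force
      obtain k0 :: nat where k0: "real k0 * infdist x C > 1"
        using reals_Archimedean3[OF pos] by blast
      have "\<phi> k x = 0" if "k \<ge> k0" for k
      proof -
        have "real k * infdist x C \<ge> real k0 * infdist x C" using pos that by simp
        then show ?thesis using k0 by (simp add: \<phi>_def)
      qed
      then have "\<forall>\<^sub>F k in sequentially. \<phi> k x = indicator C x"
        using out by (auto simp: eventually_sequentially)
      then show ?thesis by (rule tendsto_eventually)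
    qed
  qed
qed

text \<open>Both limits integrate continuous functions with values in [0,1] alike, hence by
  dominated convergence they agree on closed sets, an intersection-stable generator of the Borel
  sets.\<close>

lemma weak_conv_meas_unique:
  fixes m m' :: "'b::metric_space measure"
  assumes m: "prob_space m" "sets m = sets borel" and m': "prob_space m'" "sets m' = sets borel"
    and conv: "weak_conv_meas Ms m" "weak_conv_meas Ms m'"
  shows "m = m'"
proof (rule measure_eqI_generator_eq[where \<Omega>=UNIV and E="Collect closed" and A="\<lambda>_. UNIV"])
  interpret m: prob_space m by fact
  interpret m': prob_space m' by fact
  have cont: "integral\<^sup>L m f = integral\<^sup>L m' f" if "continuous_on UNIV f" "\<And>x. 0 \<le> f x" "\<And>x. f x \<le> 1"
    for f :: "'b \<Rightarrow> real"
  proof -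
    have "bounded (range f)" using that by (auto simp: bounded_iff intro!: exI[of _ 1])
    with that conv show ?thesis unfolding weak_conv_meas_def by (metis LIMSEQ_unique)
  qed
  fix C :: "'b set" assume "C \<in> Collect closed"
  then have C: "closed C" by simp
  from closed_indicator_approx[OF C] obtain \<phi> :: "nat \<Rightarrow> 'b \<Rightarrow> real"
    where \<phi>: "\<And>k. continuous_on UNIV (\<phi> k)" "\<And>k x. 0 \<le> \<phi> k x" "\<And>k x. \<phi> k x \<le> 1"
    "\<And>x. (\<lambda>k. \<phi> k x) \<longlonglongrightarrow> indicator C x" by blast
  have "(\<lambda>k. integral\<^sup>L M' (\<phi> k)) \<longlonglongrightarrow> measure M' C" if "prob_space M'" "sets M' = sets borel" for M'
  proof -
    interpret prob_space M' by fact
    have sp: "space M' = UNIV" using that by (auto dest: sets_eq_imp_space_eq)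
    have "(\<lambda>k. integral\<^sup>L M' (\<phi> k)) \<longlonglongrightarrow> integral\<^sup>L M' (indicator C)"
    proof (rule integral_dominated_convergence[where w="\<lambda>_. 1"])
      show "\<phi> k \<in> borel_measurable M'" for k
        using borel_measurable_continuous_onI[OF \<phi>(1)] that(2) by (simp cong: measurable_cong_sets)
      show "(indicator C :: _ \<Rightarrow> real) \<in> borel_measurable M'"
        using C that(2) by (intro borel_measurable_indicator) auto
    qed (use \<phi> in auto)
    then show ?thesis by (simp add: sp)
  qed
  from this[OF m] this[OF m'] cont[OF \<phi>(1-3)] have "measure m C = measure m' C"
    by (simp add: LIMSEQ_unique)
  then show "emeasure m C = emeasure m' C"
    by (simp add: m.emeasure_eq_measure m'.emeasure_eq_measure)
next
  interpret m: prob_space m by fact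
  show "emeasure m UNIV \<noteq> \<infinity>" by simp
qed (use m m' in \<open>auto simp: Int_stable_def borel_eq_closed\<close>)

section \<open>Limits of couplings\<close>

lemma compact_inner_approx:
  fixes mu :: "'a::polish_space measure"
  assumes mu: "prob_space mu" "sets mu = sets borel" and A: "A \<in> sets borel" and e: "e > 0"
  obtains K where "compact K" "K \<subseteq> A" "measure mu (A - K) < e"
proof -
  interpret prob_space mu by fact
  have "emeasure mu A = (SUP K\<in>{K. K \<subseteq> A \<and> compact K}. emeasure mu K)"
    using mu A by (intro inner_regular) auto
  have "\<exists>K\<in>{K. K \<subseteq> A \<and> compact K}. emeasure mu A < emeasure mu K + ennreal e"
  proof (rule ccontr)
    assume "\<not> ?thesis"
    then have "\<And>K. K \<subseteq> A \<Longrightarrow> compact K \<Longrightarrow> measure mu K + e \<le> measure mu A"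
      using e by (auto simp: not_less emeasure_eq_measure simp flip: ennreal_plus)
    then have "\<And>K. K \<subseteq> A \<Longrightarrow> compact K \<Longrightarrow> emeasure mu K \<le> ennreal (measure mu A - e)"
      by (force simp: emeasure_eq_measure le_diff_eq intro!: ennreal_leI)
    then have "(SUP K\<in>{K. K \<subseteq> A \<and> compact K}. emeasure mu K) \<le> ennreal (measure mu A - e)"
      by (intro SUP_least) auto
    then have le: "ennreal (measure mu A) \<le> ennreal (measure mu A - e)"
      using \<open>emeasure mu A = _\<close> by (simp add: emeasure_eq_measure)
    \<comment> \<open>The empty set as \<open>K\<close> shows that \<open>measure mu A - e\<close>
      is nonnegative, so \<open>ennreal\<close> does not cut the difference off at 0 and the
      comparison is a contradiction.\<close>
    have "measure mu A \<ge> e" 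
      using \<open>\<And>K. K \<subseteq> A \<Longrightarrow> compact K \<Longrightarrow> measure mu K + e \<le> measure mu A\<close>[of "{}"] by simp
    with le e show False by (simp add: ennreal_le_iff)
  qed
  then obtain K where K: "K \<subseteq> A" "compact K" "emeasure mu A < emeasure mu K + ennreal e" by auto
  have Km: "K \<in> sets mu" "A \<in> sets mu" using K A mu by (auto intro: borel_compact)
  have "measure mu A < measure mu K + e"
    using K e by (simp add: emeasure_eq_measure ennreal_less_iff flip: ennreal_plus)
  then have "measure mu (A - K) < e" using finite_measure_Diff[OF Km(2,1)] K by simp
  with K that show ?thesis by auto
qed

lemma compact_finite_inter_empty:
  fixes K :: "nat \<Rightarrow> 'b::t2_space set"
  assumes "\<And>i. compact (K i)" "(\<Inter>i. K i) = {}"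
  shows "\<exists>n. (\<Inter>i\<le>n. K i) = {}"
proof (rule ccontr)
  assume "\<not> ?thesis"
  then have ne: "\<And>n. (\<Inter>i\<le>n. K i) \<noteq> {}" by auto
  have "K 0 \<inter> \<Inter>(K ` UNIV) \<noteq> {}"
  proof (rule compact_imp_fip_image)
    fix I :: "nat set"
    assume "finite I"
    then obtain n where "I \<subseteq> {..n}" using finite_nat_iff_bounded_le by blast
    then have "(\<Inter>i\<le>n. K i) \<subseteq> K 0 \<inter> \<Inter>(K ` I)" by auto
    with ne[of n] show "K 0 \<inter> \<Inter>(K ` I) \<noteq> {}" by blast
  qed (use assms(1) in \<open>auto intro: compact_imp_closed\<close>)
  with assms(2) show False by auto
qed

lemma semiring_of_sets_rectangles:
  "semiring_of_sets (space M \<times> space N) {A \<times> B | A B. A \<in> sets M \<and> B \<in> sets N}"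
proof (unfold_locales, goal_cases)
  case 1 show ?case by (auto dest: sets.sets_into_space)
next
  case 2 show ?case by blast
next
  case (3 a b)
  then obtain A B A' B' where ab: "a = A \<times> B" "b = A' \<times> B'" "A \<in> sets M" "A' \<in> sets M" "B \<in> sets N" "B' \<in> sets N"
    by blast
  have "a \<inter> b = (A \<inter> A') \<times> (B \<inter> B')" using ab by auto
  then show ?case using ab by blast
next
  case (4 a b)
  then obtain A B A' B' where ab: "a = A \<times> B" "b = A' \<times> B'" "A \<in> sets M" "A' \<in> sets M" "B \<in> sets N" "B' \<in> sets N"
    by blast
  have "a - b = \<Union>{(A - A') \<times> B, (A \<inter> A') \<times> (B - B')}" using ab by auto
  moreover have "disjoint {(A - A') \<times> B, (A \<inter> A') \<times> (B - B')}" by (auto simp: disjoint_def)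
  moreover have "(A - A') \<times> B \<in> {A \<times> B | A B. A \<in> sets M \<and> B \<in> sets N}"
    "(A \<inter> A') \<times> (B - B') \<in> {A \<times> B | A B. A \<in> sets M \<and> B \<in> sets N}" using ab by blast+
  ultimately show ?case by (intro exI[of _ "{(A - A') \<times> B, (A \<inter> A') \<times> (B - B')}"]) auto
qed

text \<open>The limiting set function is countably additive because compact rectangles approximate
  rectangles from inside uniformly over all couplings of the same pair of marginals.\<close>

lemma coupling_limit_exists:
  fixes mu :: "'a::polish_space measure" and mu' :: "'b::polish_space measure"
    and Ms :: "nat \<Rightarrow> ('a \<times> 'b) measure"
  assumes Q: "\<And>n. prob_space (Ms n)" "\<And>n. sets (Ms n) = sets borel"
    and marg: "\<And>n. distr (Ms n) borel fst = mu" "\<And>n. distr (Ms n) borel snd = mu'"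
    and conv: "\<And>A B. A \<in> sets borel \<Longrightarrow> B \<in> sets borel \<Longrightarrow> convergent (\<lambda>n. measure (Ms n) (A \<times> B))"
  obtains m where "prob_space m" "sets m = sets borel"
    "\<And>A B. A \<in> sets borel \<Longrightarrow> B \<in> sets borel \<Longrightarrow> (\<lambda>n. measure (Ms n) (A \<times> B)) \<longlonglongrightarrow> measure m (A \<times> B)"
proof -
  have [measurable_cong]: "\<And>n. sets (Ms n) = sets (borel \<Otimes>\<^sub>M borel)" unfolding borel_prod by (rule Q(2))
  define \<R> :: "('a \<times> 'b) set set" where "\<R> = {A \<times> B | A B. A \<in> sets borel \<and> B \<in> sets borel}"
  have sp: "space (Ms n) = UNIV" for n using Q(2)[of n] by (auto dest: sets_eq_imp_space_eq)
  have cyl: "fst -` A \<in> sets (Ms n)" "snd -` B \<in> sets (Ms n)" if "A \<in> sets borel" "B \<in> sets borel" for A B n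
    using measurable_sets[OF _ that(1), of fst "Ms n"] measurable_sets[OF _ that(2), of snd "Ms n"]
    by (simp_all add: sp)
  have mu: "prob_space mu" "sets mu = sets borel" and mu': "prob_space mu'" "sets mu' = sets borel"
    using marg[of 0, symmetric] by (auto intro!: prob_space.prob_space_distr Q)
  interpret R: semiring_of_sets UNIV \<R>
    using semiring_of_sets_rectangles[of "borel :: 'a measure" "borel :: 'b measure"] by (simp add: \<R>_def)
  interpret G: ring_of_sets UNIV R.generated_ring by (rule R.generating_ring)
  have R_sets: "\<R> \<subseteq> sets borel" unfolding \<R>_def borel_prod[symmetric] by auto
  have G_sets: "D \<in> sets borel" if "D \<in> R.generated_ring" for D
    using that R_sets by (auto elim!: R.generated_ringE intro!: sets.finite_Union)
  \<comment> \<open>The limit set function lives on the ring of finite disjoint unions of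
    rectangles; finite additivity carries convergence from rectangles to this ring.\<close>
  have convD: "convergent (\<lambda>n. measure (Ms n) D)" if D: "D \<in> R.generated_ring" for D
  proof -
    obtain C where C: "finite C" "disjoint C" "C \<subseteq> \<R>" "D = \<Union>C" using D by (rule R.generated_ringE)
    have "measure (Ms n) D = (\<Sum>c\<in>C. measure (Ms n) c)" for n
    proof -
      interpret prob_space "Ms n" by (rule Q)
      show ?thesis unfolding C(4)
        using C R_sets Q(2) by (intro measure_Union') (auto simp: disjoint_def disjnt_def pairwise_def fmeasurable_eq_sets)
    qed
    moreover have "convergent (\<lambda>n. \<Sum>c\<in>C. measure (Ms n) c)"
      using C conv by (intro convergent_sum) (auto simp: \<R>_def)
    ultimately show ?thesis by simp
  qed
  define c where "c D = lim (\<lambda>n. measure (Ms n) D)" for D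
  have c: "(\<lambda>n. measure (Ms n) D) \<longlonglongrightarrow> c D" if "D \<in> R.generated_ring" for D
    unfolding c_def using convD[OF that] by (simp add: convergent_LIMSEQ_iff)
  have c0: "0 \<le> c D" if "D \<in> R.generated_ring" for D
    using c[OF that] by (rule LIMSEQ_le_const) auto
  have inner: "\<exists>K. compact K \<and> K \<subseteq> D \<and> (\<forall>n. measure (Ms n) (D - K) \<le> e)"
    if D: "D \<in> R.generated_ring" and e: "e > 0" for D e
  proof -
    obtain C where C: "finite C" "disjoint C" "C \<subseteq> \<R>" "D = \<Union>C" using D by (rule R.generated_ringE)
    \<comment> \<open>Each of the \<open>card C\<close> rectangles may lose \<open>2 * d\<close>,
      one \<open>d\<close> for each coordinate; the added 1 keeps the denominator positive when
      \<open>C\<close> is empty.\<close>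
    define d where "d = e / (2 * (card C + 1))"
    have d: "d > 0" using e by (simp add: d_def)
    have "\<exists>K. compact K \<and> K \<subseteq> E \<and> (\<forall>n. measure (Ms n) (E - K) \<le> 2 * d)" if "E \<in> C" for E
    proof -
      obtain A B where E: "E = A \<times> B" and [measurable]: "A \<in> sets borel" "B \<in> sets borel"
        using \<open>E \<in> C\<close> C by (auto simp: \<R>_def)
      obtain K where K: "compact K" "K \<subseteq> A" "measure mu (A - K) < d"
        using compact_inner_approx[OF mu _ d] \<open>A \<in> _\<close> by blast
      obtain L where L: "compact L" "L \<subseteq> B" "measure mu' (B - L) < d"
        using compact_inner_approx[OF mu' _ d] \<open>B \<in> _\<close> by blast
      have [measurable]: "K \<in> sets borel" "L \<in> sets borel" using K L by (auto intro: borel_compact)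
      have "measure (Ms n) (E - K \<times> L) \<le> 2 * d" for n
      proof -
        interpret prob_space "Ms n" by (rule Q)
        \<comment> \<open>What is lost lies in two strips, and the mass of a strip is determined by
          one marginal. This makes the estimate independent of \<open>n\<close>.\<close>
        have "measure (Ms n) (E - K \<times> L) \<le> measure (Ms n) (fst -` (A - K) \<union> snd -` (B - L))"
          unfolding E by (intro finite_measure_mono sets.Un cyl) auto
        also have "\<dots> \<le> measure (Ms n) (fst -` (A - K)) + measure (Ms n) (snd -` (B - L))"
          by (intro measure_Un_le cyl) auto
        also have "\<dots> = measure mu (A - K) + measure mu' (B - L)"
          unfolding marg[of n, symmetric] by (simp add: measure_distr sp)
        finally show ?thesis using K L by simp
      qed
      then show ?thesis
        using K L E by (intro exI[of _ "K \<times> L"]) (auto intro: compact_Times)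
    qed
    then obtain F where F: "\<And>E. E \<in> C \<Longrightarrow> compact (F E) \<and> F E \<subseteq> E \<and> (\<forall>n. measure (Ms n) (E - F E) \<le> 2 * d)"
      by metis
    have "measure (Ms n) (D - \<Union>(F ` C)) \<le> e" for n
    proof -
      interpret prob_space "Ms n" by (rule Q)
      have m: "E - F E \<in> sets (Ms n)" if "E \<in> C" for E
        using F[OF that] that C R_sets Q(2) by (auto intro: borel_compact)
      have "measure (Ms n) (D - \<Union>(F ` C)) \<le> measure (Ms n) (\<Union>E\<in>C. E - F E)"
        using C m by (intro finite_measure_mono) auto
      also have "\<dots> \<le> (\<Sum>E\<in>C. measure (Ms n) (E - F E))"
        using C m by (intro finite_measure_subadditive_finite) auto
      also have "\<dots> \<le> (\<Sum>E\<in>C. 2 * d)" using F by (intro sum_mono) auto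
      also have "\<dots> \<le> e" using e by (simp add: d_def field_simps)
      finally show ?thesis .
    qed
    moreover have "compact (\<Union>(F ` C))" using C F by (intro compact_UN) auto
    moreover have "\<Union>(F ` C) \<subseteq> D" using C F by blast
    ultimately show ?thesis by blast
  qed
  \<comment> \<open>Continuity at the empty set is what turns a finite, finitely additive set
    function on a ring into a countably additive one.\<close>
  have empty_cont: "(\<lambda>i. c (A i)) \<longlonglongrightarrow> 0"
    if A: "range A \<subseteq> R.generated_ring" "decseq A" "(\<Inter>i. A i) = {}" for A
  proof -
    have Ag: "A i \<in> R.generated_ring" for i using A(1) by auto
    have mono: "c (A j) \<le> c (A i)" if "i \<le> j" for i j
    proof (rule LIMSEQ_le[OF c c, OF Ag Ag], intro exI[of _ 0] allI impI)
      fix n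
      interpret prob_space "Ms n" by (rule Q)
      show "measure (Ms n) (A j) \<le> measure (Ms n) (A i)"
        using that A(2) G_sets[OF Ag] Q(2) by (intro finite_measure_mono) (auto dest: decseqD)
    qed
    have small: "\<exists>i. c (A i) \<le> e" if e: "e > 0" for e
    proof -
      \<comment> \<open>Compact sets inside the \<open>A i\<close> have empty intersection, so
        already finitely many of them do. Then \<open>A N\<close> is covered by the sets
        \<open>A i - K i\<close> with \<open>i \<le> N\<close>, whose masses are at most e/2, e/4,
        and so on, for every \<open>n\<close> at once.\<close>
      have "\<forall>i. \<exists>K. compact K \<and> K \<subseteq> A i \<and> (\<forall>n. measure (Ms n) (A i - K) \<le> e * (1/2) ^ Suc i)"
        using e by (intro allI inner Ag) auto
      then obtain K where K: "\<And>i. compact (K i)" "\<And>i. K i \<subseteq> A i"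
          "\<And>i n. measure (Ms n) (A i - K i) \<le> e * (1/2) ^ Suc i"
        unfolding choice_iff' choice_iff by blast
      have "(\<Inter>i. K i) \<subseteq> (\<Inter>i. A i)" using K(2) by (intro INF_mono) auto
      then have "(\<Inter>i. K i) = {}" using A(3) by simp
      from compact_finite_inter_empty[OF K(1) this] obtain N where N: "(\<Inter>i\<le>N. K i) = {}" ..
      have "measure (Ms n) (A N) \<le> e" for n
      proof -
        interpret prob_space "Ms n" by (rule Q)
        have m: "A i - K i \<in> sets (Ms n)" for i
          using G_sets[OF Ag] K(1) Q(2) by (auto intro: borel_compact)
        have "A N \<subseteq> A i" if "i \<le> N" for i using A(2) that by (auto dest: decseqD)
        then have "A N \<subseteq> (\<Union>i\<le>N. A i - K i) \<union> (\<Inter>i\<le>N. K i)" by (fastforce simp del: UN_simps INT_simps)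
        then have "A N \<subseteq> (\<Union>i\<le>N. A i - K i)" unfolding N by simp
        then have "measure (Ms n) (A N) \<le> measure (Ms n) (\<Union>i\<le>N. A i - K i)"
          using m by (intro finite_measure_mono) auto
        also have "\<dots> \<le> (\<Sum>i\<le>N. measure (Ms n) (A i - K i))"
          using m by (intro finite_measure_subadditive_finite) auto
        also have "\<dots> \<le> (\<Sum>i\<le>N. e * (1/2) ^ Suc i)" by (intro sum_mono K)
        also have "\<dots> = e * (1/2) * (\<Sum>i<Suc N. (1/2) ^ i)"
          by (simp add: sum_distrib_left lessThan_Suc_atMost mult.assoc)
        also have "\<dots> = e * (1 - (1/2) ^ Suc N)" by (subst sum_gp_strict) simp
        also have "\<dots> \<le> e" using e by (simp add: mult_le_cancel_left1)
        finally show ?thesis .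
      qed
      then show ?thesis using c[OF Ag[of N]] by (intro exI[of _ N] LIMSEQ_le_const2) auto
    qed
    have "\<exists>n0. \<forall>n\<ge>n0. \<bar>c (A n)\<bar> < e" if "e > 0" for e
    proof -
      from small[OF half_gt_zero[OF that]] obtain i where "c (A i) \<le> e / 2" ..
      then have "\<bar>c (A n)\<bar> < e" if "n \<ge> i" for n
        using mono[OF that] c0[OF Ag, of n] \<open>e > 0\<close> by simp
      then show ?thesis by blast
    qed
    then show ?thesis by (simp add: LIMSEQ_iff)
  qed
  have "\<exists>\<mu>. (\<forall>s\<in>R.generated_ring. \<mu> s = ennreal (c s)) \<and>
      measure_space UNIV (sigma_sets UNIV R.generated_ring) \<mu>"
  proof (rule G.caratheodory_empty_continuous)
    show "positive R.generated_ring (\<lambda>s. ennreal (c s))"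
      by (simp add: positive_def c_def)
    show "additive R.generated_ring (\<lambda>s. ennreal (c s))"
    proof (unfold additive_def, intro ballI impI)
      fix x y assume xy: "x \<in> R.generated_ring" "y \<in> R.generated_ring" "x \<inter> y = {}"
      have "measure (Ms n) (x \<union> y) = measure (Ms n) x + measure (Ms n) y" for n
      proof -
        interpret prob_space "Ms n" by (rule Q)
        show ?thesis using xy G_sets Q(2) by (intro finite_measure_Union) auto
      qed
      with tendsto_add[OF c[OF xy(1)] c[OF xy(2)]] c[OF G.Un[OF xy(1,2)]]
      have "c (x \<union> y) = c x + c y" by (auto intro: LIMSEQ_unique)
      then show "ennreal (c (x \<union> y)) = ennreal (c x) + ennreal (c y)"
        using c0 xy by (simp add: ennreal_plus)
    qed
    show "(\<lambda>i. ennreal (c (A i))) \<longlonglongrightarrow> 0"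
      if "range A \<subseteq> R.generated_ring" "decseq A" "\<Inter>(range A) = {}" for A
      using tendsto_ennrealI[OF empty_cont[OF that]] by simp
  qed auto
  then obtain \<mu> where \<mu>: "\<And>s. s \<in> R.generated_ring \<Longrightarrow> \<mu> s = ennreal (c s)"
    and ms: "measure_space UNIV (sigma_sets UNIV R.generated_ring) \<mu>" by auto
  define m where "m = measure_of UNIV R.generated_ring \<mu>"
  have RG: "D \<in> R.generated_ring" if "D \<in> \<R>" for D using that by (rule R.generated_ringI_Basic)
  have m_gen: "sets m = sigma_sets UNIV R.generated_ring" unfolding m_def by (simp add: sets_measure_of)
  have m_sets: "sets m = sets borel"
    unfolding m_gen
  proof (rule antisym)
    show "sigma_sets UNIV R.generated_ring \<subseteq> sets borel"
      using G_sets by (intro sets.sigma_sets_subset'[where M=borel, simplified]) auto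
    have "sets (borel :: ('a \<times> 'b) measure) = sigma_sets UNIV \<R>"
      unfolding borel_prod[symmetric] sets_pair_measure by (simp add: \<R>_def)
    also have "\<dots> \<subseteq> sigma_sets UNIV R.generated_ring"
      using RG by (intro sigma_sets_mono') auto
    finally show "sets borel \<subseteq> sigma_sets UNIV R.generated_ring" .
  qed
  have m_eq: "emeasure m D = ennreal (c D)" if "D \<in> R.generated_ring" for D
    using ms that \<mu>
    by (subst emeasure_measure_of[OF m_def]) (auto simp: measure_space_def m_gen)
  have m_meas: "measure m D = c D" if "D \<in> R.generated_ring" for D
    using m_eq[OF that] c0[OF that] by (simp add: measure_def)
  have U: "UNIV \<in> R.generated_ring"
    by (rule RG) (auto simp: \<R>_def intro!: exI[of _ UNIV])
  have "c UNIV = 1"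
    unfolding c_def using Q prob_space.prob_space[OF Q(1)] by (simp add: sp)
  then have "prob_space m" 
    using m_eq[OF U] m_sets by (intro prob_spaceI) (auto dest: sets_eq_imp_space_eq)
  moreover have "(\<lambda>n. measure (Ms n) (A \<times> B)) \<longlonglongrightarrow> measure m (A \<times> B)"
    if "A \<in> sets borel" "B \<in> sets borel" for A B
  proof -
    have "A \<times> B \<in> R.generated_ring" using that by (intro RG) (auto simp: \<R>_def)
    then show ?thesis using c m_meas by simp
  qed
  ultimately show thesis using m_sets that by blast
qed

section \<open>Product measures\<close>

lemma distr_PiM_UNIV_component:
  "prob_space N \<Longrightarrow> distr (PiM UNIV (\<lambda>_. N)) N (\<lambda>\<omega>. \<omega> i) = N"
  using distr_PiM_component[of UNIV "\<lambda>_. N" i] by simp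

lemma indep_vars_PiM_UNIV:
  fixes N :: "'b measure"
  assumes "prob_space N"
  shows "prob_space.indep_vars (PiM (UNIV :: 'i set) (\<lambda>_. N)) (\<lambda>_. N) (\<lambda>i \<omega>. \<omega> i) UNIV"
proof -
  interpret P: prob_space "PiM (UNIV :: 'i set) (\<lambda>_. N)" by (intro prob_space_PiM assms)
  show ?thesis
  proof -
    have "distr (PiM (UNIV :: 'i set) (\<lambda>_. N)) (PiM UNIV (\<lambda>_. N)) (\<lambda>x. \<lambda>i\<in>UNIV. x i) = PiM UNIV (\<lambda>_. N)"
      by (simp add: distr_id restrict_UNIV)
    also have "\<dots> = PiM UNIV (\<lambda>i. distr (PiM (UNIV :: 'i set) (\<lambda>_. N)) N (\<lambda>\<omega>. \<omega> i))"
      by (simp add: distr_PiM_UNIV_component assms)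
    finally show ?thesis
      by (subst P.indep_vars_iff_distr_eq_PiM') auto
  qed
qed

lemma distr_PiM_UNIV_map:
  fixes N :: "'b measure"
  assumes "prob_space N" and [measurable]: "f \<in> measurable N N'"
  shows "distr (PiM (UNIV :: 'i set) (\<lambda>_. N)) (PiM UNIV (\<lambda>_. N')) (\<lambda>x i. f (x i)) = PiM UNIV (\<lambda>_. distr N N' f)"
proof -
  interpret P: prob_space "PiM (UNIV :: 'i set) (\<lambda>_. N)" by (intro prob_space_PiM assms)
  have "P.indep_vars (\<lambda>_. N') (\<lambda>i \<omega>. f (\<omega> i)) UNIV"
    by (rule P.indep_vars_compose2[OF indep_vars_PiM_UNIV[OF assms(1)]]) measurable
  moreover have "distr (PiM UNIV (\<lambda>_. N)) N' (\<lambda>\<omega>. f (\<omega> i)) = distr N N' f" for i :: 'i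
  proof -
    have "distr (PiM UNIV (\<lambda>_. N)) N' (\<lambda>\<omega>. f (\<omega> i)) = distr (distr (PiM UNIV (\<lambda>_. N)) N (\<lambda>\<omega>. \<omega> i)) N' f"
      by (subst distr_distr) (auto simp: comp_def)
    then show ?thesis by (simp add: distr_PiM_UNIV_component assms(1))
  qed
  ultimately show ?thesis
    by (subst (asm) P.indep_vars_iff_distr_eq_PiM') (auto simp: restrict_UNIV)
qed

text \<open>Two independent i.i.d. families, zipped, form one i.i.d. family of pairs. It is enough
  to test cylinders: for fixed \<open>x\<close> the section of a cylinder is a cylinder in
  \<open>y\<close>, whose mass is a product of functions of the independent \<open>x i\<close>. The
  rule serves to separate innovations from values, and the two coordinates of a product coupling
  from each other.\<close>

lemma distr_PiM_UNIV_zip: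
  fixes A :: "'b measure" and B :: "'c measure"
  assumes A: "prob_space A" and B: "prob_space B"
  shows "distr (PiM (UNIV :: 'i set) (\<lambda>_. A) \<Otimes>\<^sub>M PiM UNIV (\<lambda>_. B)) (PiM UNIV (\<lambda>_. A \<Otimes>\<^sub>M B)) (\<lambda>(x, y) i. (x i, y i))
    = PiM UNIV (\<lambda>_. A \<Otimes>\<^sub>M B)"
proof (rule measure_eqI_PiM_infinite[symmetric, OF refl])
  interpret A: prob_space A by fact
  interpret B: prob_space B by fact
  interpret AB: pair_prob_space A B ..
  interpret PA: prob_space "PiM (UNIV :: 'i set) (\<lambda>_. A)" by (intro prob_space_PiM A)
  interpret PB: prob_space "PiM (UNIV :: 'i set) (\<lambda>_. B)" by (intro prob_space_PiM B)
  interpret PAB: prob_space "PiM (UNIV :: 'i set) (\<lambda>_. A \<Otimes>\<^sub>M B)" by (intro prob_space_PiM AB.prob_space_axioms)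
  show "finite_measure (PiM (UNIV :: 'i set) (\<lambda>_. A \<Otimes>\<^sub>M B))" by unfold_locales
  fix F :: "'i \<Rightarrow> ('b \<times> 'c) set" and J :: "'i set"
  assume J: "finite J" "J \<subseteq> UNIV" and F: "\<And>i. i \<in> J \<Longrightarrow> F i \<in> sets (A \<Otimes>\<^sub>M B)"
  let ?X = "prod_emb UNIV (\<lambda>_. A \<Otimes>\<^sub>M B) J (Pi\<^sub>E J F)"
  let ?z = "\<lambda>(x, y) i. (x i, y i)"
  let ?P = "PiM (UNIV :: 'i set) (\<lambda>_. A) \<Otimes>\<^sub>M PiM (UNIV :: 'i set) (\<lambda>_. B)"
  have z[measurable]: "?z \<in> measurable ?P (PiM UNIV (\<lambda>_. A \<Otimes>\<^sub>M B))"
    by (rule measurable_PiM_single') (auto simp: split_beta' space_pair_measure space_PiM)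
  have X: "?X \<in> sets (PiM UNIV (\<lambda>_. A \<Otimes>\<^sub>M B))" using J F by (intro sets_PiM_I) auto
  have "emeasure (distr ?P (PiM UNIV (\<lambda>_. A \<Otimes>\<^sub>M B)) ?z) ?X = emeasure ?P (?z -` ?X \<inter> space ?P)"
    using X by (simp add: emeasure_distr)
  also have "\<dots> = (\<integral>\<^sup>+x. emeasure (PiM UNIV (\<lambda>_. B)) (Pair x -` (?z -` ?X \<inter> space ?P)) \<partial>PiM UNIV (\<lambda>_. A))"
    using measurable_sets[OF z X] by (rule PB.emeasure_pair_measure_alt)
  also have "\<dots> = (\<integral>\<^sup>+x. (\<Prod>i\<in>J. emeasure B (Pair (x i) -` F i)) \<partial>PiM UNIV (\<lambda>_. A))"
  proof (rule nn_integral_cong)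
    fix x assume x: "x \<in> space (PiM (UNIV :: 'i set) (\<lambda>_. A))"
    have "Pair x -` (?z -` ?X \<inter> space ?P) = prod_emb UNIV (\<lambda>_. B) J (Pi\<^sub>E J (\<lambda>i. Pair (x i) -` F i))"
      using x F[THEN sets.sets_into_space]
      by (fastforce simp: prod_emb_def space_pair_measure space_PiM PiE_iff)
    then show "emeasure (PiM UNIV (\<lambda>_. B)) (Pair x -` (?z -` ?X \<inter> space ?P)) = (\<Prod>i\<in>J. emeasure B (Pair (x i) -` F i))"
      using J F B by (simp add: emeasure_PiM_emb sets_Pair1)
  qed
  also have "\<dots> = (\<Prod>i\<in>J. (\<integral>\<^sup>+x. emeasure B (Pair (x i) -` F i) \<partial>PiM UNIV (\<lambda>_. A)))"
  proof (rule PA.indep_vars_nn_integral)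
    have "PA.indep_vars (\<lambda>_. A) (\<lambda>i \<omega>. \<omega> i) J"
      using PA.indep_vars_subset[OF indep_vars_PiM_UNIV[OF A]] by auto
    then show "PA.indep_vars (\<lambda>_. borel) (\<lambda>i x. emeasure B (Pair (x i) -` F i)) J"
      by (rule PA.indep_vars_compose2[where Y="\<lambda>i a. emeasure B (Pair a -` F i)"])
        (use F B.measurable_emeasure_Pair in auto)
  qed (use J in auto)
  also have "\<dots> = (\<Prod>i\<in>J. emeasure (A \<Otimes>\<^sub>M B) (F i))"
  proof (rule prod.cong[OF refl])
    fix i assume i: "i \<in> J"
    have [measurable]: "(\<lambda>x. emeasure B (Pair x -` F i)) \<in> borel_measurable A"
      using F[OF i] by (rule B.measurable_emeasure_Pair)
    have "emeasure (A \<Otimes>\<^sub>M B) (F i) = (\<integral>\<^sup>+x. emeasure B (Pair x -` F i) \<partial>A)"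
      using F[OF i] by (rule B.emeasure_pair_measure_alt)
    also have "\<dots> = (\<integral>\<^sup>+x. emeasure B (Pair x -` F i) \<partial>distr (PiM UNIV (\<lambda>_. A)) A (\<lambda>\<omega>. \<omega> i))"
      by (simp add: distr_PiM_UNIV_component A)
    also have "\<dots> = (\<integral>\<^sup>+x. emeasure B (Pair (x i) -` F i) \<partial>PiM UNIV (\<lambda>_. A))"
      by (subst nn_integral_distr) auto
    finally show "(\<integral>\<^sup>+x. emeasure B (Pair (x i) -` F i) \<partial>PiM UNIV (\<lambda>_. A)) = emeasure (A \<Otimes>\<^sub>M B) (F i)" ..
  qed
  also have "\<dots> = emeasure (PiM UNIV (\<lambda>_. A \<Otimes>\<^sub>M B)) ?X"
    using J F AB.prob_space_axioms by (intro emeasure_PiM_emb[symmetric]) auto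
  finally show "emeasure (PiM UNIV (\<lambda>_. A \<Otimes>\<^sub>M B)) ?X = emeasure (distr ?P (PiM UNIV (\<lambda>_. A \<Otimes>\<^sub>M B)) ?z) ?X" ..
qed simp

text \<open>The self-similarity of the tree: the root label is independent of the other labels, and
  these fall into disjoint blocks by the first letter, each a copy of the whole family. All
  inductions on the depth of the tree at the level of laws rest on this.\<close>

lemma distr_PiM_list_split:
  fixes N :: "'b measure"
  assumes N: "prob_space N"
  defines "Q \<equiv> PiM (UNIV :: 'i list set) (\<lambda>_. N)"
  shows "distr Q (N \<Otimes>\<^sub>M PiM (UNIV :: 'i set) (\<lambda>_. Q)) (\<lambda>\<omega>. (\<omega> [], \<lambda>j w. \<omega> (j # w))) = N \<Otimes>\<^sub>M PiM UNIV (\<lambda>_. Q)"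
proof -
  interpret Q: prob_space Q unfolding Q_def by (intro prob_space_PiM N)
  have ind: "Q.indep_vars (\<lambda>_. N) (\<lambda>i \<omega>. \<omega> i) UNIV"
    unfolding Q_def by (rule indep_vars_PiM_UNIV[OF N])
  let ?f = "\<lambda>\<omega> j w. \<omega> (j # w)"
  let ?B = "- {[]} :: 'i list set"
  have "Q.indep_var (PiM {[]} (\<lambda>_. N)) (\<lambda>\<omega>. \<lambda>i\<in>{[]}. \<omega> i) (PiM ?B (\<lambda>_. N)) (\<lambda>\<omega>. \<lambda>i\<in>?B. \<omega> i)"
    by (rule Q.indep_var_restrict[OF ind]) auto
  then have ind2: "distr Q (PiM {[]} (\<lambda>_. N)) (\<lambda>\<omega>. \<lambda>i\<in>{[]}. \<omega> i) \<Otimes>\<^sub>M distr Q (PiM ?B (\<lambda>_. N)) (\<lambda>\<omega>. \<lambda>i\<in>?B. \<omega> i)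
      = distr Q (PiM {[]} (\<lambda>_. N) \<Otimes>\<^sub>M PiM ?B (\<lambda>_. N)) (\<lambda>\<omega>. (\<lambda>i\<in>{[]}. \<omega> i, \<lambda>i\<in>?B. \<omega> i))"
    and [measurable]: "(\<lambda>\<omega>. \<lambda>i\<in>{[]}. \<omega> i) \<in> measurable Q (PiM {[]} (\<lambda>_. N))"
      "(\<lambda>\<omega>. \<lambda>i\<in>?B. \<omega> i) \<in> measurable Q (PiM ?B (\<lambda>_. N))"
    unfolding Q.indep_var_distribution_eq by auto
  have r[measurable]: "(\<lambda>\<omega>. \<omega> []) \<in> measurable (PiM {[] :: 'i list} (\<lambda>_. N)) N" by measurable
  have f[measurable]: "?f \<in> measurable (PiM ?B (\<lambda>_. N)) (PiM (UNIV :: 'i set) (\<lambda>_. Q))"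
    unfolding Q_def
    by (intro measurable_PiM_single' measurable_component_singleton) (auto simp: space_PiM PiE_iff)
  have "distr Q (N \<Otimes>\<^sub>M PiM UNIV (\<lambda>_. Q)) (\<lambda>\<omega>. (\<omega> [], ?f \<omega>)) =
      distr (distr Q (PiM {[]} (\<lambda>_. N) \<Otimes>\<^sub>M PiM ?B (\<lambda>_. N)) (\<lambda>\<omega>. (\<lambda>i\<in>{[]}. \<omega> i, \<lambda>i\<in>?B. \<omega> i)))
        (N \<Otimes>\<^sub>M PiM UNIV (\<lambda>_. Q)) (\<lambda>(x, y). (x [], ?f y))"
    by (subst distr_distr) (auto simp: comp_def)
  also have "\<dots> = distr (distr Q (PiM {[]} (\<lambda>_. N)) (\<lambda>\<omega>. \<lambda>i\<in>{[]}. \<omega> i)) N (\<lambda>\<omega>. \<omega> [])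
      \<Otimes>\<^sub>M distr (distr Q (PiM ?B (\<lambda>_. N)) (\<lambda>\<omega>. \<lambda>i\<in>?B. \<omega> i)) (PiM UNIV (\<lambda>_. Q)) ?f"
    unfolding ind2[symmetric]
    by (intro pair_measure_distr[symmetric])
       (auto intro!: prob_space_imp_sigma_finite prob_space.prob_space_distr Q.prob_space_axioms)
  also have "\<dots> = distr Q N (\<lambda>\<omega>. \<omega> []) \<Otimes>\<^sub>M distr Q (PiM UNIV (\<lambda>_. Q)) ?f"
    by (simp add: distr_distr comp_def)
  finally have "distr Q (N \<Otimes>\<^sub>M PiM UNIV (\<lambda>_. Q)) (\<lambda>\<omega>. (\<omega> [], ?f \<omega>)) =
      distr Q N (\<lambda>\<omega>. \<omega> []) \<Otimes>\<^sub>M distr Q (PiM (UNIV :: 'i set) (\<lambda>_. Q)) ?f" .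
  moreover have "distr Q N (\<lambda>\<omega>. \<omega> []) = N" unfolding Q_def by (simp add: distr_PiM_UNIV_component N)
  moreover have "distr Q (PiM (UNIV :: 'i set) (\<lambda>_. Q)) ?f = PiM UNIV (\<lambda>_. Q)"
  proof -
    \<comment> \<open>The words that start with \<open>j\<close>, that is, the subtree above child
      \<open>j\<close>; these blocks are disjoint.\<close>
    let ?K = "\<lambda>j. range ((#) j) :: 'i list set"
    have K: "Q.indep_vars (\<lambda>j. PiM (?K j) (\<lambda>_. N)) (\<lambda>j \<omega>. \<lambda>i\<in>?K j. \<omega> i) UNIV"
      by (rule Q.indep_vars_restrict[OF ind]) (auto simp: disjoint_family_on_def)
    have "(\<lambda>\<omega> w. \<omega> (j # w)) \<in> measurable (PiM (?K j) (\<lambda>_. N)) Q" for j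
      unfolding Q_def
      by (intro measurable_PiM_single' measurable_component_singleton) (auto simp: space_PiM PiE_iff)
    from Q.indep_vars_compose2[where Y="\<lambda>j \<omega> w. \<omega> (j # w)", OF K this]
    have "Q.indep_vars (\<lambda>_. Q) (\<lambda>j \<omega> w. \<omega> (j # w)) (UNIV :: 'i set)" by simp
    moreover have rv: "(\<lambda>\<omega> w. \<omega> (j # w)) \<in> measurable Q Q" for j
      unfolding Q_def
      by (intro measurable_PiM_single' measurable_component_singleton) (auto simp: space_PiM PiE_iff)
    moreover have "distr Q Q (\<lambda>\<omega> w. \<omega> (j # w)) = Q" for j
      using distr_PiM_reindex[of UNIV "\<lambda>_. N" "(#) j" UNIV] N by (simp add: Q_def restrict_UNIV)
    ultimately show ?thesis
      by (subst (asm) Q.indep_vars_iff_distr_eq_PiM') (auto simp: restrict_UNIV)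
  qed
  ultimately show ?thesis by simp
qed

section \<open>Recursive evaluation on trees\<close>

lemma distr_pair_fst:
  assumes "prob_space M" "prob_space N"
  shows "distr (M \<Otimes>\<^sub>M N) M fst = M"
  using assms by (intro prob_space.distr_pair_fst) 

lemma distr_pair_snd:
  assumes "prob_space M" "prob_space N"
  shows "distr (M \<Otimes>\<^sub>M N) N snd = N"
proof -
  interpret M: prob_space M by fact
  interpret N: prob_space N by fact
  show ?thesis
  proof (rule measure_eqI)
    fix A assume "A \<in> sets (distr (M \<Otimes>\<^sub>M N) N snd)"
    then have A: "A \<in> sets N" by simp
    then have "snd -` A \<inter> space (M \<Otimes>\<^sub>M N) = space M \<times> A"
      using sets.sets_into_space[OF A] by (auto simp: space_pair_measure)
    then show "emeasure (distr (M \<Otimes>\<^sub>M N) N snd) A = emeasure N A"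
      using A by (simp add: emeasure_distr N.emeasure_pair_measure_Times M.emeasure_space_1)
  qed simp
qed

lemma measurable_PiM_UNIV_map:
  assumes f: "f \<in> measurable M N"
  shows "(\<lambda>x i. f (x i)) \<in> measurable (PiM (UNIV :: 'i set) (\<lambda>_. M)) (PiM UNIV (\<lambda>_. N))"
proof (rule measurable_PiM_single')
  show "(\<lambda>x. f (x i)) \<in> measurable (PiM (UNIV :: 'i set) (\<lambda>_. M)) N" for i
    using measurable_component_singleton[of i UNIV "\<lambda>_. M"] f by (auto intro: measurable_compose)
qed (use f in \<open>auto simp: space_PiM PiE_iff measurable_def\<close>)

text \<open>The recursion strips the first letter, so that a subtree is again a labelling of the
  full tree of words over all naturals. Only \<open>e\<close> at depths below \<open>n\<close> and
  \<open>x\<close> at depth exactly \<open>n\<close> are read, as \<open>tree_value_cong\<close>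
  records.\<close>

primrec tree_value :: "('e \<Rightarrow> (nat \<Rightarrow> 'a) \<Rightarrow> 'a) \<Rightarrow> nat \<Rightarrow> (nat list \<Rightarrow> 'e) \<Rightarrow> (nat list \<Rightarrow> 'a) \<Rightarrow> 'a" where
  "tree_value G 0 e x = x []"
| "tree_value G (Suc n) e x = G (e []) (\<lambda>j. tree_value G n (\<lambda>w. e (j # w)) (\<lambda>w. x (j # w)))"

lemma tree_value_cong:
  assumes "\<And>w. length w < n \<Longrightarrow> e w = e' w" "\<And>w. length w = n \<Longrightarrow> x w = x' w"
  shows "tree_value G n e x = tree_value G n e' x'"
  using assms
proof (induction n arbitrary: e e' x x')
  case (Suc n)
  have "tree_value G n (\<lambda>w. e (j # w)) (\<lambda>w. x (j # w)) = tree_value G n (\<lambda>w. e' (j # w)) (\<lambda>w. x' (j # w))" for j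
    using Suc.prems by (intro Suc.IH) auto
  then show ?case using Suc.prems by simp
qed simp

text \<open>The counterpart of \<open>T2\<close> for a map that reads a full sequence of children
  numbered from 0; \<open>T2_eq_pair_map\<close> makes the connection.\<close>

definition pair_map :: "'e measure \<Rightarrow> ('e \<Rightarrow> (nat \<Rightarrow> 'a::topological_space) \<Rightarrow> 'a) \<Rightarrow> ('a \<times> 'a) measure \<Rightarrow> ('a \<times> 'a) measure" where
  "pair_map N G m = distr (N \<Otimes>\<^sub>M PiM UNIV (\<lambda>_. m)) borel (\<lambda>(e, y). (G e (\<lambda>i. fst (y i)), G e (\<lambda>i. snd (y i))))"

locale recursive_map =
  fixes N :: "'e measure" and G :: "'e \<Rightarrow> (nat \<Rightarrow> 'a::polish_space) \<Rightarrow> 'a"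
  assumes prob_N: "prob_space N"
    and G_measurable: "(\<lambda>(e, x). G e x) \<in> measurable (N \<Otimes>\<^sub>M PiM UNIV (\<lambda>_. borel)) borel"
begin

abbreviation "R \<equiv> tree_value G"
abbreviation "PN \<equiv> PiM (UNIV :: nat list set) (\<lambda>_. N)"
abbreviation "PB \<equiv> PiM (UNIV :: nat list set) (\<lambda>_. borel :: 'a measure)"

lemma measurable_G[measurable (raw)]:
  assumes "f \<in> measurable K N" "\<And>j. (\<lambda>\<omega>. h \<omega> j) \<in> measurable K borel"
  shows "(\<lambda>\<omega>. G (f \<omega>) (h \<omega>)) \<in> measurable K borel"
proof -
  have "(\<lambda>\<omega>. (f \<omega>, h \<omega>)) \<in> measurable K (N \<Otimes>\<^sub>M PiM UNIV (\<lambda>_. borel))"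
    using assms by (intro measurable_Pair measurable_PiM_single') auto
  from measurable_compose[OF this G_measurable] show ?thesis by simp
qed

lemma measurable_R[measurable (raw)]:
  assumes "\<And>w. (\<lambda>\<omega>. f \<omega> w) \<in> measurable K N" "\<And>w. (\<lambda>\<omega>. h \<omega> w) \<in> measurable K borel"
  shows "(\<lambda>\<omega>. R n (f \<omega>) (h \<omega>)) \<in> measurable K borel"
  using assms
proof (induction n arbitrary: f h)
  case (Suc n)
  have "(\<lambda>\<omega>. R n (\<lambda>w. f \<omega> (j # w)) (\<lambda>w. h \<omega> (j # w))) \<in> measurable K borel" for j
    by (rule Suc.IH) (use Suc.prems in auto)
  then show ?case
    using Suc.prems(1)[of "[]"] by (simp add: measurable_G)
qed simp

lemma sets_pair_map[simp]: "sets (pair_map N G m) = sets borel"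
  by (simp add: pair_map_def)

context
  fixes m :: "('a \<times> 'a) measure"
  assumes m: "prob_space m" and sets_m: "sets m = sets borel"
begin

lemma sets_m'[measurable_cong]: "sets m = sets (borel \<Otimes>\<^sub>M borel)"
  unfolding borel_prod by (rule sets_m)

text \<open>Every word carries an innovation together with a pair of values, although values matter
  only at depth \<open>n\<close> and innovations only above it. With equal labels everywhere the
  tree is self-similar, so one more application of \<open>pair_map\<close> is a fresh root label on
  top of independent copies of the tree for \<open>n\<close>.\<close>

lemma pair_map_iterate_nodewise:
  "(pair_map N G ^^ n) m = distr (PiM (UNIV :: nat list set) (\<lambda>_. N \<Otimes>\<^sub>M m)) borel
     (\<lambda>\<omega>. (R n (\<lambda>w. fst (\<omega> w)) (\<lambda>w. fst (snd (\<omega> w))), R n (\<lambda>w. fst (\<omega> w)) (\<lambda>w. snd (snd (\<omega> w)))))"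
proof (induction n)
  case 0
  interpret N: prob_space N by (rule prob_N)
  interpret m: prob_space m by (rule m)
  interpret Nm: pair_prob_space N m ..
  have "distr (PiM (UNIV :: nat list set) (\<lambda>_. N \<Otimes>\<^sub>M m)) borel (\<lambda>\<omega>. snd (\<omega> []))
      = distr (distr (PiM (UNIV :: nat list set) (\<lambda>_. N \<Otimes>\<^sub>M m)) (N \<Otimes>\<^sub>M m) (\<lambda>\<omega>. \<omega> [])) m snd"
    by (subst distr_distr) (auto simp: comp_def sets_m intro!: distr_cong)
  also have "\<dots> = m"
    by (simp add: distr_PiM_UNIV_component Nm.prob_space_axioms distr_pair_snd prob_N m)
  finally show ?case by simp
next
  case (Suc n)
  interpret N: prob_space N by (rule prob_N)
  interpret m: prob_space m by (rule m)
  interpret Nm: pair_prob_space N m ..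
  let ?Q = "PiM (UNIV :: nat list set) (\<lambda>_. N \<Otimes>\<^sub>M m)"
  define L where "L = (\<lambda>n \<omega>. (R n (\<lambda>w. fst (\<omega> w)) (\<lambda>w. fst (snd (\<omega> w))), R n (\<lambda>w. fst (\<omega> w)) (\<lambda>w. snd (snd (\<omega> w)))))"
  let ?\<Phi> = "\<lambda>(e, y). (G e (\<lambda>i. fst (y i)), G e (\<lambda>i. snd (y i)))"
  have Q: "prob_space ?Q" by (intro prob_space_PiM Nm.prob_space_axioms)
  have PQ: "prob_space (PiM (UNIV :: nat set) (\<lambda>_. ?Q))" by (intro prob_space_PiM Q)
  have L[measurable]: "L n \<in> measurable ?Q (borel \<Otimes>\<^sub>M borel)" unfolding L_def by measurable
  have L': "L n \<in> measurable ?Q borel" using L by (simp add: borel_prod)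
  have map[measurable]: "(\<lambda>f j. L n (f j)) \<in> measurable (PiM UNIV (\<lambda>_. ?Q)) (PiM (UNIV :: nat set) (\<lambda>_. borel \<Otimes>\<^sub>M borel))"
    by (rule measurable_PiM_UNIV_map[OF L])
  have \<Phi>: "?\<Phi> \<in> measurable (N \<Otimes>\<^sub>M PiM (UNIV :: nat set) (\<lambda>_. borel \<Otimes>\<^sub>M borel)) (borel \<Otimes>\<^sub>M borel)"
    unfolding split_beta' by measurable
  have B: "borel \<Otimes>\<^sub>M borel = (borel :: ('a \<times> 'a) measure)" by (rule borel_prod)
  note \<Phi>' = \<Phi>[unfolded B] and map' = map[unfolded B]
  have "(pair_map N G ^^ Suc n) m = distr (N \<Otimes>\<^sub>M PiM UNIV (\<lambda>_. distr ?Q borel (L n))) borel ?\<Phi>"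
    by (simp add: Suc.IH pair_map_def L_def)
  also have "PiM UNIV (\<lambda>_::nat. distr ?Q borel (L n)) = distr (PiM UNIV (\<lambda>_. ?Q)) (PiM UNIV (\<lambda>_. borel)) (\<lambda>f j. L n (f j))"
    by (rule distr_PiM_UNIV_map[OF Q L', symmetric])
  also have "N \<Otimes>\<^sub>M \<dots> = distr N N (\<lambda>e. e) \<Otimes>\<^sub>M \<dots>" by simp
  also have "\<dots> = distr (N \<Otimes>\<^sub>M PiM UNIV (\<lambda>_. ?Q)) (N \<Otimes>\<^sub>M PiM UNIV (\<lambda>_. borel)) (\<lambda>(e, f). (e, \<lambda>j. L n (f j)))"
    by (intro pair_measure_distr map' prob_space_imp_sigma_finite prob_space.prob_space_distr[OF PQ]) auto
  \<comment> \<open>The innovation at the root is written as the first component of a full label,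
    the form in which \<open>distr_PiM_list_split\<close> yields it.\<close>
  also have "N \<Otimes>\<^sub>M PiM UNIV (\<lambda>_. ?Q) = distr ((N \<Otimes>\<^sub>M m) \<Otimes>\<^sub>M PiM UNIV (\<lambda>_. ?Q)) (N \<Otimes>\<^sub>M PiM (UNIV :: nat set) (\<lambda>_. ?Q)) (\<lambda>(a, f). (fst a, f))"
  proof -
    have "distr (N \<Otimes>\<^sub>M m) N fst \<Otimes>\<^sub>M distr (PiM (UNIV :: nat set) (\<lambda>_. ?Q)) (PiM UNIV (\<lambda>_. ?Q)) (\<lambda>f. f)
      = distr ((N \<Otimes>\<^sub>M m) \<Otimes>\<^sub>M PiM UNIV (\<lambda>_. ?Q)) (N \<Otimes>\<^sub>M PiM UNIV (\<lambda>_. ?Q)) (\<lambda>(a, f). (fst a, f))"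
      by (intro pair_measure_distr prob_space_imp_sigma_finite prob_space.prob_space_distr[OF PQ]) auto
    then show ?thesis by (simp add: distr_pair_fst prob_N m)
  qed
  also have "(N \<Otimes>\<^sub>M m) \<Otimes>\<^sub>M PiM (UNIV :: nat set) (\<lambda>_. ?Q) = distr ?Q ((N \<Otimes>\<^sub>M m) \<Otimes>\<^sub>M PiM UNIV (\<lambda>_. ?Q)) (\<lambda>\<omega>. (\<omega> [], \<lambda>j w. \<omega> (j # w)))"
    by (rule distr_PiM_list_split[OF Nm.prob_space_axioms, symmetric])
  finally have eq: "(pair_map N G ^^ Suc n) m = distr (distr (distr (distr ?Q ((N \<Otimes>\<^sub>M m) \<Otimes>\<^sub>M PiM (UNIV :: nat set) (\<lambda>_. ?Q)) (\<lambda>\<omega>. (\<omega> [], \<lambda>j w. \<omega> (j # w))))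
      (N \<Otimes>\<^sub>M PiM UNIV (\<lambda>_. ?Q)) (\<lambda>(a, f). (fst a, f)))
      (N \<Otimes>\<^sub>M PiM UNIV (\<lambda>_. borel)) (\<lambda>(e, f). (e, \<lambda>j. L n (f j)))) borel ?\<Phi>" .
  have s[measurable]: "(\<lambda>\<omega>. (\<omega> [], \<lambda>j w. \<omega> (j # w))) \<in> measurable ?Q ((N \<Otimes>\<^sub>M m) \<Otimes>\<^sub>M PiM (UNIV :: nat set) (\<lambda>_. ?Q))"
    by (intro measurable_Pair measurable_PiM_single' measurable_component_singleton) (auto simp: space_PiM PiE_iff)
  have p: "(\<lambda>(e, f). (e, \<lambda>j. L n (f j))) \<in> measurable (N \<Otimes>\<^sub>M PiM UNIV (\<lambda>_. ?Q)) (N \<Otimes>\<^sub>M PiM (UNIV :: nat set) (\<lambda>_. borel))"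
    using map' unfolding split_beta' by (intro measurable_Pair measurable_fst measurable_compose[OF measurable_snd]) auto
  have q: "(\<lambda>(a, f). (fst a, f)) \<in> measurable ((N \<Otimes>\<^sub>M m) \<Otimes>\<^sub>M PiM (UNIV :: nat set) (\<lambda>_. ?Q)) (N \<Otimes>\<^sub>M PiM UNIV (\<lambda>_. ?Q))"
    by measurable
  note sq = measurable_compose[OF s q, unfolded prod.case]
  note sp = measurable_compose[OF sq p, unfolded prod.case]
  have "(pair_map N G ^^ Suc n) m = distr ?Q borel (\<lambda>\<omega>. (G (fst (\<omega> [])) (\<lambda>i. fst (L n (\<lambda>w. \<omega> (i # w)))),
      G (fst (\<omega> [])) (\<lambda>i. snd (L n (\<lambda>w. \<omega> (i # w))))))"
    unfolding eq distr_distr[OF q s, unfolded comp_def prod.case] distr_distr[OF p sq, unfolded comp_def prod.case]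
      distr_distr[OF \<Phi>' sp, unfolded comp_def prod.case] ..
  then show ?case by (simp add: L_def)
qed

text \<open>Unzipping the labels puts the innovations into a factor of their own, so that Fubini's
  theorem can be used to condition on them.\<close>

lemma pair_map_iterate:
  "(pair_map N G ^^ n) m = distr (PN \<Otimes>\<^sub>M PiM UNIV (\<lambda>_. m)) borel
     (\<lambda>(e, y). (R n e (\<lambda>w. fst (y w)), R n e (\<lambda>w. snd (y w))))"
proof -
  let ?L = "\<lambda>\<omega>. (R n (\<lambda>w. fst (\<omega> w)) (\<lambda>w. fst (snd (\<omega> w))), R n (\<lambda>w. fst (\<omega> w)) (\<lambda>w. snd (snd (\<omega> w))))"
  have "?L \<in> measurable (PiM (UNIV :: nat list set) (\<lambda>_. N \<Otimes>\<^sub>M m)) (borel \<Otimes>\<^sub>M borel)" by measurable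
  then have L: "?L \<in> measurable (PiM (UNIV :: nat list set) (\<lambda>_. N \<Otimes>\<^sub>M m)) borel" by (simp add: borel_prod)
  have z: "(\<lambda>(x, y) i. (x i, y i)) \<in> measurable (PN \<Otimes>\<^sub>M PiM UNIV (\<lambda>_. m)) (PiM (UNIV :: nat list set) (\<lambda>_. N \<Otimes>\<^sub>M m))"
    by (rule measurable_PiM_single') (auto simp: split_beta' space_pair_measure space_PiM)
  have "(pair_map N G ^^ n) m = distr (distr (PN \<Otimes>\<^sub>M PiM UNIV (\<lambda>_. m)) (PiM UNIV (\<lambda>_. N \<Otimes>\<^sub>M m)) (\<lambda>(x, y) i. (x i, y i))) borel ?L"
    by (simp only: distr_PiM_UNIV_zip[OF prob_N m] pair_map_iterate_nodewise)
  then show ?thesis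
    unfolding distr_distr[OF L z] by (simp add: comp_def split_beta')
qed

lemma prob_space_pair_map_iterate: "prob_space ((pair_map N G ^^ n) m)"
proof -
  have "prob_space (N \<Otimes>\<^sub>M m)"
    by (intro prob_space_pair prob_N m)
  moreover have "(\<lambda>\<omega>. (R n (\<lambda>w. fst (\<omega> w)) (\<lambda>w. fst (snd (\<omega> w))), R n (\<lambda>w. fst (\<omega> w)) (\<lambda>w. snd (snd (\<omega> w)))))
      \<in> measurable (PiM (UNIV :: nat list set) (\<lambda>_. N \<Otimes>\<^sub>M m)) (borel \<Otimes>\<^sub>M borel)" by measurable
  ultimately show ?thesis
    unfolding pair_map_iterate_nodewise
    by (intro prob_space.prob_space_distr prob_space_PiM) (auto simp: borel_prod)
qed

lemma sets_pair_map_iterate: "sets ((pair_map N G ^^ n) m) = sets borel"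
  by (cases n) (auto simp: sets_m)

end

lemma measurable_R_pair_map:
  assumes "sets m = sets borel"
  shows "(\<lambda>(e, y). (R n e (\<lambda>w. fst (y w)), R n e (\<lambda>w. snd (y w))))
    \<in> measurable (PN \<Otimes>\<^sub>M PiM (UNIV :: nat list set) (\<lambda>_. m)) borel"
proof -
  have m: "sets m = sets (borel \<Otimes>\<^sub>M borel)"
    unfolding borel_prod by (rule assms)
  let ?K = "PN \<Otimes>\<^sub>M PiM (UNIV :: nat list set) (\<lambda>_. m)"
  have e: "(\<lambda>p. fst p w) \<in> measurable ?K N" for w by measurable
  have y: "(\<lambda>p. snd p w) \<in> measurable ?K m" for w by measurable
  have "fst \<in> measurable m borel" "snd \<in> measurable m borel"
    by (simp_all add: measurable_cong_sets[OF m refl])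
  note y12 = this[THEN measurable_compose[OF y]]
  show ?thesis
    unfolding borel_prod[symmetric] split_beta'
    by (intro measurable_Pair measurable_R e y12)
qed

text \<open>Integrating out the values at depth \<open>n\<close> while the innovations stay fixed.
  Along the RTP this is a version of the conditional expectation of \<open>a\<close> at the root
  given the first \<open>n\<close> generations; \<open>expectation_root\<close> gives the
  characteristic property.\<close>

definition cond_mean :: "'a measure \<Rightarrow> nat \<Rightarrow> ('a \<Rightarrow> real) \<Rightarrow> (nat list \<Rightarrow> 'e) \<Rightarrow> real" where
  "cond_mean mu n a e = (\<integral>x. a (R n e x) \<partial>PiM UNIV (\<lambda>_. mu))"

lemma prob_space_PN: "prob_space PN"
  by (intro prob_space_PiM prob_N)

context
  fixes mu :: "'a measure"
  assumes mu: "prob_space mu" and sets_mu[measurable_cong]: "sets mu = sets borel"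
begin

abbreviation (input) "PX \<equiv> PiM (UNIV :: nat list set) (\<lambda>_. mu)"

lemma prob_space_PX: "prob_space PX"
  by (intro prob_space_PiM mu)

lemma measurable_R_pair: "(\<lambda>(e, x). R n e x) \<in> measurable (PN \<Otimes>\<^sub>M PX) borel"
  unfolding split_beta' by measurable

lemma measurable_R_snd: "e \<in> space PN \<Longrightarrow> (\<lambda>x. R n e x) \<in> measurable PX borel"
  using measurable_compose[OF measurable_Pair1' measurable_R_pair] by auto

lemma cond_mean_measurable[measurable]:
  assumes [measurable]: "a \<in> borel_measurable borel"
  shows "cond_mean mu n a \<in> borel_measurable PN"
proof -
  interpret PX: prob_space PX by (rule prob_space_PX)
  have "(\<lambda>(e, x). a (R n e x)) \<in> borel_measurable (PN \<Otimes>\<^sub>M PX)"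
    unfolding split_beta' by measurable
  then show ?thesis unfolding cond_mean_def by (rule PX.borel_measurable_lebesgue_integral)
qed

lemma cond_mean_bounded:
  assumes "a \<in> borel_measurable borel" "\<And>x. \<bar>a x\<bar> \<le> K"
  shows "\<bar>cond_mean mu n a e\<bar> \<le> K"
proof -
  interpret PX: prob_space PX by (rule prob_space_PX)
  have K: "0 \<le> K" using assms(2)[of undefined] by linarith
  have "\<bar>cond_mean mu n a e\<bar> \<le> (\<integral>x. \<bar>a (R n e x)\<bar> \<partial>PX)"
    unfolding cond_mean_def by (rule integral_abs_bound)
  also have "\<dots> \<le> K"
  \<comment> \<open>The bound is stated for every \<open>e\<close>, also outside
    \<open>space PN\<close>, where the integrand may fail to be measurable; a non-integrable
    function has integral 0 by convention.\<close>
  proof (cases "integrable PX (\<lambda>x. \<bar>a (R n e x)\<bar>)")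
    case True
    then have "(\<integral>x. \<bar>a (R n e x)\<bar> \<partial>PX) \<le> (\<integral>x. K \<partial>PX)"
      by (intro integral_mono assms) auto
    then show ?thesis by (simp add: PX.prob_space)
  qed (simp add: not_integrable_integral_eq K)
  finally show ?thesis .
qed

lemma integral_times_R:
  assumes [measurable]: "f \<in> borel_measurable PN" "b \<in> borel_measurable borel"
    and f: "\<And>e. \<bar>f e\<bar> \<le> K" and b: "\<And>x. \<bar>b x\<bar> \<le> L"
  shows "(\<integral>p. f (fst p) * b (R n (fst p) (snd p)) \<partial>(PN \<Otimes>\<^sub>M PX)) = (\<integral>e. f e * cond_mean mu n b e \<partial>PN)"
proof -
  interpret PN: prob_space PN by (rule prob_space_PN)
  interpret PX: prob_space PX by (rule prob_space_PX)
  interpret P: pair_prob_space PN PX ..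
  have "integrable (PN \<Otimes>\<^sub>M PX) (\<lambda>p. f (fst p) * b (R n (fst p) (snd p)))"
  proof (rule P.integrable_const_bound[where B="K * L"])
    show "AE p in PN \<Otimes>\<^sub>M PX. norm (f (fst p) * b (R n (fst p) (snd p))) \<le> K * L"
      using f b by (auto simp: abs_mult intro!: mult_mono order_trans[OF abs_ge_zero f])
  qed measurable
  from P.integral_fst'[OF this] show ?thesis
    by (simp add: cond_mean_def)
qed

lemma integral_pair_map_iterate:
  assumes [measurable]: "a \<in> borel_measurable borel" "b \<in> borel_measurable borel"
    and a: "\<And>x. \<bar>a x\<bar> \<le> K" and b: "\<And>x. \<bar>b x\<bar> \<le> L"
  shows "(\<integral>p. a (fst p) * b (snd p) \<partial>((pair_map N G ^^ n) (mu \<Otimes>\<^sub>M mu)))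
    = (\<integral>e. cond_mean mu n a e * cond_mean mu n b e \<partial>PN)"
proof -
  interpret PN: prob_space PN by (rule prob_space_PN)
  interpret PX: prob_space PX by (rule prob_space_PX)
  interpret XX: pair_prob_space PX PX ..
  interpret P: pair_prob_space PN "PX \<Otimes>\<^sub>M PX" ..
  have mm: "prob_space (mu \<Otimes>\<^sub>M mu)" by (intro prob_space_pair mu)
  have smm: "sets (mu \<Otimes>\<^sub>M mu) = sets borel"
    unfolding borel_prod[symmetric] by (intro sets_pair_measure_cong sets_mu)
  have smm'[measurable_cong]: "sets (mu \<Otimes>\<^sub>M mu) = sets (borel \<Otimes>\<^sub>M borel)"
    unfolding borel_prod by (rule smm)
  let ?z = "\<lambda>(x, y) i. (x i, y i)"
  have z[measurable]: "?z \<in> measurable (PX \<Otimes>\<^sub>M PX) (PiM UNIV (\<lambda>_. mu \<Otimes>\<^sub>M mu))"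
    by (rule measurable_PiM_single') (auto simp: split_beta' space_pair_measure space_PiM)
  note L' = measurable_R_pair_map[OF smm]
  from L' have [measurable]: "(\<lambda>p. R n (fst p) (\<lambda>w. fst (snd p w))) \<in> borel_measurable (PN \<Otimes>\<^sub>M PiM UNIV (\<lambda>_. mu \<Otimes>\<^sub>M mu))"
    "(\<lambda>p. R n (fst p) (\<lambda>w. snd (snd p w))) \<in> borel_measurable (PN \<Otimes>\<^sub>M PiM UNIV (\<lambda>_. mu \<Otimes>\<^sub>M mu))"
    unfolding borel_prod[symmetric] measurable_pair_iff by (simp_all add: comp_def split_beta')
  have m_ab: "(\<lambda>p. a (fst p) * b (snd p)) \<in> borel_measurable borel"
    unfolding borel_prod[symmetric] by measurable
  \<comment> \<open>An i.i.d. family of pairs with product law is a pair of independent families.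
    Hence for fixed innovations the two coordinates are independent and the inner integral
    factors.\<close>
  have "PN \<Otimes>\<^sub>M PiM UNIV (\<lambda>_. mu \<Otimes>\<^sub>M mu) = distr PN PN (\<lambda>e. e) \<Otimes>\<^sub>M distr (PX \<Otimes>\<^sub>M PX) (PiM UNIV (\<lambda>_. mu \<Otimes>\<^sub>M mu)) ?z"
    by (simp add: distr_PiM_UNIV_zip[OF mu mu])
  also have "\<dots> = distr (PN \<Otimes>\<^sub>M (PX \<Otimes>\<^sub>M PX)) (PN \<Otimes>\<^sub>M PiM UNIV (\<lambda>_. mu \<Otimes>\<^sub>M mu)) (\<lambda>(e, q). (e, ?z q))"
    by (intro pair_measure_distr z prob_space_imp_sigma_finite XX.prob_space_distr) auto
  finally have zip: "PN \<Otimes>\<^sub>M PiM UNIV (\<lambda>_. mu \<Otimes>\<^sub>M mu) =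
    distr (PN \<Otimes>\<^sub>M (PX \<Otimes>\<^sub>M PX)) (PN \<Otimes>\<^sub>M PiM UNIV (\<lambda>_. mu \<Otimes>\<^sub>M mu)) (\<lambda>(e, q). (e, ?z q))" .
  have zm: "(\<lambda>(e, q). (e, ?z q)) \<in> measurable (PN \<Otimes>\<^sub>M (PX \<Otimes>\<^sub>M PX)) (PN \<Otimes>\<^sub>M PiM UNIV (\<lambda>_. mu \<Otimes>\<^sub>M mu))"
    by measurable
  have "(\<integral>p. a (fst p) * b (snd p) \<partial>((pair_map N G ^^ n) (mu \<Otimes>\<^sub>M mu)))
    = (\<integral>p. a (R n (fst p) (\<lambda>w. fst (snd p w))) * b (R n (fst p) (\<lambda>w. snd (snd p w))) \<partial>(PN \<Otimes>\<^sub>M PiM UNIV (\<lambda>_. mu \<Otimes>\<^sub>M mu)))"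
    unfolding pair_map_iterate[OF mm smm] integral_distr[OF L' m_ab] by (simp add: split_beta')
  also have "\<dots> = (\<integral>p. a (R n (fst p) (fst (snd p))) * b (R n (fst p) (snd (snd p))) \<partial>(PN \<Otimes>\<^sub>M (PX \<Otimes>\<^sub>M PX)))"
    by (subst zip, subst integral_distr[OF zm]) (measurable, simp add: split_beta')
  also have "\<dots> = (\<integral>e. (\<integral>q. a (R n e (fst q)) * b (R n e (snd q)) \<partial>(PX \<Otimes>\<^sub>M PX)) \<partial>PN)"
  proof (subst P.integral_fst'[symmetric])
    show "integrable (PN \<Otimes>\<^sub>M (PX \<Otimes>\<^sub>M PX)) (\<lambda>p. a (R n (fst p) (fst (snd p))) * b (R n (fst p) (snd (snd p))))"
    proof (rule P.integrable_const_bound[where B="K * L"])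
      show "AE p in PN \<Otimes>\<^sub>M (PX \<Otimes>\<^sub>M PX). norm (a (R n (fst p) (fst (snd p))) * b (R n (fst p) (snd (snd p)))) \<le> K * L"
        using a b by (auto simp: abs_mult intro!: mult_mono order_trans[OF abs_ge_zero a])
    qed measurable
  qed simp
  also have "\<dots> = (\<integral>e. cond_mean mu n a e * cond_mean mu n b e \<partial>PN)"
  proof (rule Bochner_Integration.integral_cong[OF refl])
    fix e assume e: "e \<in> space PN"
    note [measurable] = measurable_R_snd[OF e]
    have "integrable (PX \<Otimes>\<^sub>M PX) (\<lambda>q. a (R n e (fst q)) * b (R n e (snd q)))"
    proof (rule XX.integrable_const_bound[where B="K * L"])
      show "AE q in PX \<Otimes>\<^sub>M PX. norm (a (R n e (fst q)) * b (R n e (snd q))) \<le> K * L"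
        using a b by (auto simp: abs_mult intro!: mult_mono order_trans[OF abs_ge_zero a])
    qed measurable
    from XX.integral_fst'[OF this]
    show "(\<integral>q. a (R n e (fst q)) * b (R n e (snd q)) \<partial>(PX \<Otimes>\<^sub>M PX)) = cond_mean mu n a e * cond_mean mu n b e"
      by (simp add: cond_mean_def)
  qed
  finally show ?thesis .
qed

lemma biv_set_prob: "m \<in> biv_set mu \<Longrightarrow> prob_space m" "m \<in> biv_set mu \<Longrightarrow> sets m = sets borel"
  by (auto simp: biv_set_def)

text \<open>A single coordinate, even together with the innovations, does not see how it is coupled
  to the other one. This is the source of all estimates that are uniform over the couplings
  \<open>m\<close>.\<close>

lemma coordinate_law:
  assumes m: "m \<in> biv_set mu" and \<pi>: "\<pi> = fst \<or> \<pi> = snd"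
  shows "distr (PN \<Otimes>\<^sub>M PiM (UNIV :: nat list set) (\<lambda>_. m)) (PN \<Otimes>\<^sub>M PX) (\<lambda>(e, y). (e, \<lambda>w. \<pi> (y w))) = PN \<Otimes>\<^sub>M PX"
proof -
  note pm = biv_set_prob[OF m]
  have \<pi>m: "\<pi> \<in> measurable m mu"
  proof -
    have "\<pi> \<in> measurable (borel \<Otimes>\<^sub>M borel) borel" using \<pi> by auto
    then show ?thesis unfolding borel_prod measurable_cong_sets[OF pm(2) sets_mu] .
  qed
  have d: "distr m mu \<pi> = mu"
    using m \<pi> distr_cong[OF refl sets_mu, of m \<pi> \<pi>] by (auto simp: biv_set_def)
  have Pm: "prob_space (PiM (UNIV :: nat list set) (\<lambda>_. m))" by (intro prob_space_PiM pm)
  have "PN \<Otimes>\<^sub>M PX = distr PN PN (\<lambda>e. e) \<Otimes>\<^sub>M distr (PiM (UNIV :: nat list set) (\<lambda>_. m)) PX (\<lambda>y w. \<pi> (y w))"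
    by (simp add: distr_PiM_UNIV_map[OF pm(1) \<pi>m] d)
  also have "\<dots> = distr (PN \<Otimes>\<^sub>M PiM (UNIV :: nat list set) (\<lambda>_. m)) (PN \<Otimes>\<^sub>M PX) (\<lambda>(e, y). (e, \<lambda>w. \<pi> (y w)))"
    using measurable_PiM_UNIV_map[OF \<pi>m]
    by (intro pair_measure_distr prob_space_imp_sigma_finite prob_space.prob_space_distr[OF Pm]) auto
  finally show ?thesis ..
qed

end

end

section \<open>Truncation at finite depth, and the tree process\<close>

definition truncate_words :: "'e \<Rightarrow> nat \<Rightarrow> (nat list \<Rightarrow> 'e) \<Rightarrow> nat list \<Rightarrow> 'e" where
  "truncate_words c n e = (\<lambda>w. if length w < n then e w else c)"

lemma truncate_words_truncate_words: "n \<le> k \<Longrightarrow> truncate_words c n (truncate_words c k e) = truncate_words c n e"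
  by (auto simp: truncate_words_def)

lemma tree_value_truncate_words: "tree_value G n (truncate_words c k e) x = tree_value G n e x" if "n \<le> k"
  using that by (intro tree_value_cong) (auto simp: truncate_words_def)

text \<open>Overwriting the labels from depth \<open>n\<close> on with a fixed point
  \<open>c\<close> of the space keeps the family inside the product space. Being a function of the
  first \<open>n\<close> generations then means being invariant under this map.\<close>

lemma measurable_truncate_words:
  assumes "c \<in> space N"
  shows "truncate_words c n \<in> measurable (PiM UNIV (\<lambda>_. N)) (PiM UNIV (\<lambda>_. N))"
  unfolding truncate_words_def
proof (rule measurable_PiM_single')
  show "(\<lambda>e. if length w < n then e w else c) \<in> measurable (PiM UNIV (\<lambda>_. N)) N" for w
    using assms by (cases "length w < n") auto
qed (use assms in \<open>auto simp: space_PiM PiE_iff\<close>)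

text \<open>The form of an invariant RTP that the argument uses: words over all naturals, and in
  \<open>joint_law\<close> the independence of the values at depth \<open>n\<close> from one another
  and from the innovations above, expressed as one product law. The point \<open>c\<close> serves
  only as the filler of truncations.\<close>

locale tree_process = recursive_map N G + M: prob_space M
  for N :: "'e measure" and G :: "'e \<Rightarrow> (nat \<Rightarrow> 'a::polish_space) \<Rightarrow> 'a" and M :: "'w measure" +
  fixes mu :: "'a measure" and E :: "nat list \<Rightarrow> 'w \<Rightarrow> 'e" and X :: "nat list \<Rightarrow> 'w \<Rightarrow> 'a" and c :: 'e
  assumes prob_mu: "prob_space mu" and sets_mu[measurable_cong]: "sets mu = sets borel"
    and E_measurable[measurable]: "\<And>w. E w \<in> measurable M N"
    and X_measurable[measurable]: "\<And>w. X w \<in> measurable M borel"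
    and X_root_law: "distr M borel (X []) = mu"
    and X_recursion: "\<And>w. AE \<omega> in M. X w \<omega> = G (E w \<omega>) (\<lambda>j. X (w @ [j]) \<omega>)"
    and c: "c \<in> space N"
    and joint_law: "\<And>n. distr M (PN \<Otimes>\<^sub>M PiM {w. length w = n} (\<lambda>_. borel))
        (\<lambda>\<omega>. (truncate_words c n (\<lambda>w. E w \<omega>), \<lambda>w\<in>{w. length w = n}. X w \<omega>))
      = distr PN PN (truncate_words c n) \<Otimes>\<^sub>M PiM {w. length w = n} (\<lambda>_. mu)"
begin

abbreviation "PY \<equiv> PiM (UNIV :: nat list set) (\<lambda>_. mu)"
abbreviation "h \<equiv> cond_mean mu"
abbreviation "tr \<equiv> truncate_words c"
abbreviation "EE \<equiv> \<lambda>\<omega> w. E w \<omega>"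
abbreviation "mn \<equiv> \<lambda>n. (pair_map N G ^^ n) (mu \<Otimes>\<^sub>M mu)"

lemma EE_measurable[measurable]: "EE \<in> measurable M PN"
  by (rule measurable_PiM_single') (use E_measurable in \<open>auto simp: measurable_def\<close>)

lemma tr_measurable[measurable]: "tr n \<in> measurable PN PN"
  by (rule measurable_truncate_words[OF c])

text \<open>The recursion of the process appends a last letter and \<open>tree_value\<close> strips
  a first one, so the induction has to run over all starting nodes \<open>w\<close>. Each step
  unites countably many null sets, one for each child.\<close>

lemma X_eq_R: "AE \<omega> in M. X w \<omega> = R n (\<lambda>v. E (w @ v) \<omega>) (\<lambda>v. X (w @ v) \<omega>)"
proof (induction n arbitrary: w)
  case (Suc n)
  have "AE \<omega> in M. \<forall>j. X (w @ [j]) \<omega> = R n (\<lambda>v. E ((w @ [j]) @ v) \<omega>) (\<lambda>v. X ((w @ [j]) @ v) \<omega>)"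
    unfolding AE_all_countable using Suc.IH by blast
  with X_recursion[of w] show ?case
    by eventually_elim simp
qed simp

text \<open>The bridge between the process and the i.i.d. model. The root is almost surely a
  function of the truncated innovations and the values at depth \<open>n\<close>, and
  \<open>joint_law\<close> prescribes the law of these.\<close>

lemma root_law:
  "distr M (PN \<Otimes>\<^sub>M borel) (\<lambda>\<omega>. (tr n (EE \<omega>), X [] \<omega>)) = distr (PN \<Otimes>\<^sub>M PY) (PN \<Otimes>\<^sub>M borel) (\<lambda>(e, x). (tr n e, R n e x))"
proof -
  interpret PN: prob_space PN by (rule prob_space_PN)
  interpret PY: prob_space PY by (rule prob_space_PX[OF prob_mu sets_mu])
  let ?K = "{w :: nat list. length w = n}"
  \<comment> \<open>Extends a family over depth \<open>n\<close> to all words. The filler is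
    harmless, since \<open>tree_value\<close> reads values at depth \<open>n\<close> only.\<close>
  let ?fill = "\<lambda>x w. if w \<in> ?K then x w else undefined"
  let ?\<Phi> = "\<lambda>(e, x). (e, R n e (?fill x))"
  have fill: "(\<lambda>x. ?fill x w) \<in> borel_measurable (PiM ?K (\<lambda>_. borel :: 'a measure))" for w
    by (cases "w \<in> ?K") auto
  have "(\<lambda>p. (fst p, R n (fst p) (?fill (snd p)))) \<in> measurable (PN \<Otimes>\<^sub>M PiM ?K (\<lambda>_. borel)) (PN \<Otimes>\<^sub>M borel)"
    by (intro measurable_Pair measurable_R measurable_fst measurable_compose[OF measurable_snd fill] measurable_compose[OF measurable_fst])
       auto
  then have \<Phi>[measurable]: "?\<Phi> \<in> measurable (PN \<Otimes>\<^sub>M PiM ?K (\<lambda>_. borel)) (PN \<Otimes>\<^sub>M borel)"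
    by (simp add: split_beta')
  have R_fill: "R n (tr n e) (?fill (restrict x ?K)) = R n e x" for e x
    by (intro tree_value_cong) (auto simp: truncate_words_def)
  have J: "(\<lambda>\<omega>. (tr n (EE \<omega>), \<lambda>w\<in>?K. X w \<omega>)) \<in> measurable M (PN \<Otimes>\<^sub>M PiM ?K (\<lambda>_. borel))"
    by measurable
  have J': "(\<lambda>(e, x). (tr n e, restrict x ?K)) \<in> measurable (PN \<Otimes>\<^sub>M PY) (PN \<Otimes>\<^sub>M PiM ?K (\<lambda>_. mu))"
    unfolding split_beta' by measurable
  have sK: "sets (PiM ?K (\<lambda>_. mu)) = sets (PiM ?K (\<lambda>_. borel))"
    by (intro sets_PiM_cong sets_mu refl)
  have \<Phi>': "?\<Phi> \<in> measurable (PN \<Otimes>\<^sub>M PiM ?K (\<lambda>_. mu)) (PN \<Otimes>\<^sub>M borel)"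
    unfolding measurable_cong_sets[OF sets_pair_measure_cong[OF refl sK] refl] by (rule \<Phi>)
  have "distr M (PN \<Otimes>\<^sub>M borel) (\<lambda>\<omega>. (tr n (EE \<omega>), X [] \<omega>)) = distr M (PN \<Otimes>\<^sub>M borel) (\<lambda>\<omega>. ?\<Phi> (tr n (EE \<omega>), \<lambda>w\<in>?K. X w \<omega>))"
  proof (rule distr_cong_AE[OF refl refl])
    show "AE \<omega> in M. (tr n (EE \<omega>), X [] \<omega>) = ?\<Phi> (tr n (EE \<omega>), \<lambda>w\<in>?K. X w \<omega>)"
      using X_eq_R[of "[]" n] by eventually_elim (simp only: prod.case R_fill append_Nil)
    show "(\<lambda>\<omega>. ?\<Phi> (tr n (EE \<omega>), \<lambda>w\<in>?K. X w \<omega>)) \<in> measurable M (PN \<Otimes>\<^sub>M borel)"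
      by (rule measurable_compose[OF J \<Phi>])
  qed measurable
  also have "\<dots> = distr (distr M (PN \<Otimes>\<^sub>M PiM ?K (\<lambda>_. borel)) (\<lambda>\<omega>. (tr n (EE \<omega>), \<lambda>w\<in>?K. X w \<omega>))) (PN \<Otimes>\<^sub>M borel) ?\<Phi>"
    unfolding distr_distr[OF \<Phi> J] by (simp only: comp_def)
  also have "\<dots> = distr (distr PN PN (tr n) \<Otimes>\<^sub>M PiM ?K (\<lambda>_. mu)) (PN \<Otimes>\<^sub>M borel) ?\<Phi>"
    unfolding joint_law ..
  also have "PiM ?K (\<lambda>_. mu) = distr PY (PiM ?K (\<lambda>_. mu)) (\<lambda>x. restrict x ?K)"
    using distr_PiM_reindex[of UNIV "\<lambda>_. mu" "\<lambda>w. w" ?K] prob_mu by simp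
  also have "distr PN PN (tr n) \<Otimes>\<^sub>M \<dots> = distr (PN \<Otimes>\<^sub>M PY) (PN \<Otimes>\<^sub>M PiM ?K (\<lambda>_. mu)) (\<lambda>(e, x). (tr n e, restrict x ?K))"
    by (intro pair_measure_distr tr_measurable prob_space_imp_sigma_finite PY.prob_space_distr measurable_restrict_subset) auto
  also have "distr \<dots> (PN \<Otimes>\<^sub>M borel) ?\<Phi> = distr (PN \<Otimes>\<^sub>M PY) (PN \<Otimes>\<^sub>M borel) (?\<Phi> \<circ> (\<lambda>(e, x). (tr n e, restrict x ?K)))"
    by (rule distr_distr[OF \<Phi>' J'])
  also have "?\<Phi> \<circ> (\<lambda>(e, x). (tr n e, restrict x ?K)) = (\<lambda>(e, x). (tr n e, R n e x))"
    by (rule ext) (simp only: comp_def split_beta' R_fill prod.case fst_conv snd_conv)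
  finally show ?thesis .
qed

end

text \<open>The sets that finitely many generations approximate arbitrarily well form a
  sigma-algebra containing the one-coordinate events, which generate the product
  sigma-algebra.\<close>

lemma approx_truncate_words:
  fixes P :: "(nat list \<Rightarrow> 'e) measure"
  assumes P: "finite_measure P" "sets P = sets (PiM UNIV (\<lambda>_. N))" and c: "c \<in> space N"
    and B: "B \<in> sets P" and "\<epsilon> > 0"
  shows "\<exists>n. \<exists>B'\<in>sets P. measure P {e \<in> space P. (e \<in> B) \<noteq> (truncate_words c n e \<in> B')} < \<epsilon>"
proof -
  interpret finite_measure P by fact
  have tr[measurable]: "truncate_words c n \<in> measurable P P" for n
    using measurable_truncate_words[OF c, of n] measurable_cong_sets[OF P(2) P(2)] by blast
  have tr_sp: "truncate_words c n e \<in> space P" if "e \<in> space P" for n e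
    using measurable_space[OF tr that] .
  have gen: "sets P = sigma_sets (space P) {{f \<in> space P. f i \<in> A} | i A. A \<in> sets N}"
    unfolding P(2) sets_PiM_single sets_eq_imp_space_eq[OF P(2)] space_PiM by simp
  have "B \<in> sigma_sets (space P) {{f \<in> space P. f i \<in> A} | i A. A \<in> sets N}" using B gen by simp
  then show ?thesis using \<open>\<epsilon> > 0\<close>
  proof (induction arbitrary: \<epsilon>)
    case (Basic a)
    then obtain i A where a: "a = {f \<in> space P. f i \<in> A}" "A \<in> sets N" by blast
    have aP: "a \<in> sets P" unfolding gen by (rule sigma_sets.Basic) (use a in blast)
    \<comment> \<open>Truncation at \<open>n\<close> keeps words of length below \<open>n\<close>,
      so the coordinate \<open>i\<close> survives truncation at \<open>Suc (length i)\<close> and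
      the event is reproduced exactly.\<close>
    have eq: "{e \<in> space P. (e \<in> a) \<noteq> (truncate_words c (Suc (length i)) e \<in> a)} = {}"
      using tr_sp by (auto simp: a) (simp_all add: truncate_words_def)
    show ?case
      by (rule exI, rule bexI[OF _ aP], subst eq) (use Basic.prems in simp)
  next
    case Empty
    then show ?case by (intro exI[of _ 0] bexI[of _ "{}"]) auto
  next
    case (Compl a)
    from Compl.IH[OF Compl.prems] obtain n B' where
      B': "B' \<in> sets P" "measure P {e \<in> space P. (e \<in> a) \<noteq> (truncate_words c n e \<in> B')} < \<epsilon>" by blast
    have "{e \<in> space P. (e \<in> space P - a) \<noteq> (truncate_words c n e \<in> space P - B')}
        = {e \<in> space P. (e \<in> a) \<noteq> (truncate_words c n e \<in> B')}"
      using tr_sp by auto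
    then show ?case using B' by (intro exI[of _ n] bexI[of _ "space P - B'"]) auto
  next
    case (Union a)
    have a[measurable]: "a i \<in> sets P" for i unfolding gen using Union.hyps by auto
    have "(\<lambda>k. measure P ((\<Union>i. a i) - (\<Union>i<k. a i))) \<longlonglongrightarrow> measure P (\<Inter>k. (\<Union>i. a i) - (\<Union>i<k. a i))"
      by (intro finite_Lim_measure_decseq) (auto simp: decseq_def)
    moreover have "(\<Inter>k. (\<Union>i. a i) - (\<Union>i<k. a i)) = {}" by auto
    ultimately have "(\<lambda>k. measure P ((\<Union>i. a i) - (\<Union>i<k. a i))) \<longlonglongrightarrow> 0" by (simp only: measure_empty)
    from order_tendstoD(2)[OF this, of "\<epsilon> / 2"] Union.prems
    obtain k where k: "measure P ((\<Union>i. a i) - (\<Union>i<k. a i)) < \<epsilon> / 2"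
      by (auto simp: eventually_sequentially)
    \<comment> \<open>The tail of the union takes \<open>\<epsilon> / 2\<close>; the
      \<open>k\<close> remaining sets with error \<open>\<delta>\<close> each take at most the other
      half. The added 1 covers \<open>k = 0\<close>.\<close>
    define \<delta> where "\<delta> = \<epsilon> / (2 * (real k + 1))"
    have \<delta>: "\<delta> > 0" using Union.prems by (simp add: \<delta>_def)
    have "\<forall>i. \<exists>n. \<exists>B'\<in>sets P. measure P {e \<in> space P. (e \<in> a i) \<noteq> (truncate_words c n e \<in> B')} < \<delta>"
      using Union.IH[OF \<delta>] by blast
    from choice[OF this] obtain n where
      "\<forall>i. \<exists>B'\<in>sets P. measure P {e \<in> space P. (e \<in> a i) \<noteq> (truncate_words c (n i) e \<in> B')} < \<delta>" ..
    from choice[OF this[unfolded Bex_def]] obtain B' where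
      "\<forall>i. B' i \<in> sets P \<and> measure P {e \<in> space P. (e \<in> a i) \<noteq> (truncate_words c (n i) e \<in> B' i)} < \<delta>" ..
    then have B'[measurable]: "\<And>i. B' i \<in> sets P"
      and small: "\<And>i. measure P {e \<in> space P. (e \<in> a i) \<noteq> (truncate_words c (n i) e \<in> B' i)} < \<delta>"
      by auto
    \<comment> \<open>The sum is just a convenient common bound for the finitely many depths
      \<open>n i\<close>; truncating at \<open>m\<close> first does not affect the later truncations
      at \<open>n i\<close>.\<close>
    define m where "m = (\<Sum>i<k. n i)"
    have m: "n i \<le> m" if "i < k" for i
      unfolding m_def using that by (intro member_le_sum) auto
    define B where "B = (\<Union>i<k. truncate_words c (n i) -` B' i \<inter> space P)"
    have B: "B \<in> sets P" unfolding B_def by measurable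
    have B_iff: "truncate_words c m e \<in> B \<longleftrightarrow> (\<exists>i<k. truncate_words c (n i) e \<in> B' i)" if "e \<in> space P" for e
      using tr_sp[OF that] m by (auto simp: B_def truncate_words_truncate_words)
    let ?D = "\<lambda>i. {e \<in> space P. (e \<in> a i) \<noteq> (truncate_words c (n i) e \<in> B' i)}"
    have D[measurable]: "?D i \<in> sets P" for i by measurable
    have "measure P {e \<in> space P. (e \<in> (\<Union>i. a i)) \<noteq> (truncate_words c m e \<in> B)}
        \<le> measure P (((\<Union>i. a i) - (\<Union>i<k. a i)) \<union> (\<Union>i<k. ?D i))"
    proof (rule finite_measure_mono)
      show "{e \<in> space P. (e \<in> (\<Union>i. a i)) \<noteq> (truncate_words c m e \<in> B)}
          \<subseteq> ((\<Union>i. a i) - (\<Union>i<k. a i)) \<union> (\<Union>i<k. ?D i)"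
      proof
        fix e assume "e \<in> {e \<in> space P. (e \<in> (\<Union>i. a i)) \<noteq> (truncate_words c m e \<in> B)}"
        then have e: "e \<in> space P" "(\<exists>i. e \<in> a i) \<noteq> (\<exists>i<k. truncate_words c (n i) e \<in> B' i)"
          using B_iff by auto
        then show "e \<in> ((\<Union>i. a i) - (\<Union>i<k. a i)) \<union> (\<Union>i<k. ?D i)" by auto
      qed
    qed measurable
    also have "\<dots> \<le> measure P ((\<Union>i. a i) - (\<Union>i<k. a i)) + measure P (\<Union>i<k. ?D i)"
      by (intro measure_Un_le) measurable
    also have "measure P (\<Union>i<k. ?D i) \<le> (\<Sum>i<k. measure P (?D i))"
      by (intro finite_measure_subadditive_finite) auto
    also have "\<dots> \<le> (\<Sum>i<k. \<delta>)" using small by (intro sum_mono) (auto intro: less_imp_le)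
    also have "\<dots> \<le> \<epsilon> / 2" using Union.prems by (simp add: \<delta>_def field_simps)
    finally have "measure P {e \<in> space P. (e \<in> (\<Union>i. a i)) \<noteq> (truncate_words c m e \<in> B)} < \<epsilon>"
      using k by simp
    then show ?case using B by blast
  qed
qed

section \<open>The diagonal law and convergence to it\<close>

lemma sets_diag_law[simp]: "sets (diag_law mu) = sets borel"
  by (simp add: diag_law_def)

lemma diagonal_measurable:
  fixes mu :: "'a::second_countable_topology measure"
  assumes "sets mu = sets borel"
  shows "(\<lambda>x. (x, x)) \<in> measurable mu borel"
  unfolding borel_prod[symmetric] using assms by (intro measurable_Pair) (auto simp: measurable_cong_sets[OF assms refl])

lemma measure_diag_law_Times:
  fixes mu :: "'a::second_countable_topology measure"
  assumes mu: "sets mu = sets borel" and "A \<in> sets borel" "B \<in> sets borel"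
  shows "measure (diag_law mu) (A \<times> B) = measure mu (A \<inter> B)"
proof -
  have "A \<times> B \<in> sets borel" unfolding borel_prod[symmetric] using assms by auto
  moreover have "(\<lambda>x. (x, x)) -` (A \<times> B) \<inter> space mu = A \<inter> B"
    using sets_eq_imp_space_eq[OF mu] by auto
  ultimately show ?thesis
    unfolding diag_law_def by (simp add: measure_distr diagonal_measurable mu)
qed

lemma diag_law_biv_set:
  fixes mu :: "'a::second_countable_topology measure"
  assumes mu: "prob_space mu" "sets mu = sets borel"
  shows "diag_law mu \<in> biv_set mu"
proof -
  interpret prob_space mu by fact
  have "distr (diag_law mu) borel \<pi> = mu" if "\<pi> = fst \<or> \<pi> = snd" for \<pi> :: "'a \<times> 'a \<Rightarrow> 'a"
  proof -
    have "\<pi> \<in> measurable (borel \<Otimes>\<^sub>M borel) borel" using that by auto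
    then have "distr (diag_law mu) borel \<pi> = distr mu borel (\<lambda>x. \<pi> (x, x))"
      unfolding diag_law_def borel_prod by (subst distr_distr) (auto simp: diagonal_measurable mu comp_def)
    also have "\<dots> = mu" using that mu(2) by (auto simp: distr_id2)
    finally show ?thesis .
  qed
  moreover have "prob_space (diag_law mu)"
    unfolding diag_law_def by (intro prob_space_distr diagonal_measurable mu)
  ultimately show ?thesis by (auto simp: biv_set_def)
qed

lemma biv_set_cylinder:
  fixes mu :: "'a::second_countable_topology measure"
  assumes m: "m \<in> biv_set mu" and A: "A \<in> sets borel"
  shows "measure m (A \<times> UNIV) = measure mu A" "measure m (UNIV \<times> A) = measure mu A"
proof -
  have s: "sets m = sets (borel \<Otimes>\<^sub>M borel)" and d: "distr m borel fst = mu" "distr m borel snd = mu"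
    unfolding borel_prod using m by (auto simp: biv_set_def)
  have sp: "space m = UNIV" using m by (auto simp: biv_set_def dest: sets_eq_imp_space_eq)
  have "measure mu A = measure m (fst -` A \<inter> space m)"
    unfolding d(1)[symmetric] using A by (intro measure_distr) (auto simp: measurable_cong_sets[OF s refl])
  then show "measure m (A \<times> UNIV) = measure mu A" by (simp add: sp fst_vimage_eq_Times)
  have "measure mu A = measure m (snd -` A \<inter> space m)"
    unfolding d(2)[symmetric] using A by (intro measure_distr) (auto simp: measurable_cong_sets[OF s refl])
  then show "measure m (UNIV \<times> A) = measure mu A" by (simp add: sp snd_vimage_eq_Times)
qed

text \<open>Every coupling gives the cylinder over \<open>A \<inter> B\<close> the mass
  \<open>measure mu (A \<inter> B)\<close>, which is also the diagonal mass of
  \<open>A \<times> B\<close>. The rectangle and the cylinder differ only inside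
  \<open>B \<times> - B\<close> and \<open>(- B) \<times> B\<close>, both off the diagonal.\<close>

lemma tendsto_diag_law_rectangle:
  fixes mu :: "'a::second_countable_topology measure"
  assumes mu: "prob_space mu" "sets mu = sets borel" and ms: "\<And>n. ms n \<in> biv_set mu"
    and off: "\<And>A. A \<in> sets borel \<Longrightarrow> (\<lambda>n. measure (ms n) (A \<times> - A)) \<longlonglongrightarrow> 0"
    and A: "A \<in> sets borel" and B: "B \<in> sets borel"
  shows "(\<lambda>n. measure (ms n) (A \<times> B)) \<longlonglongrightarrow> measure (diag_law mu) (A \<times> B)"
proof (rule tendsto_sandwich)
  have rect: "U \<times> V \<in> sets (ms n)" if "U \<in> sets borel" "V \<in> sets borel" for U V n
    using ms[of n] that unfolding biv_set_def borel_prod[symmetric] by auto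
  have "measure mu (A \<inter> B) \<le> measure (ms n) (A \<times> B) + measure (ms n) (B \<times> - B)" for n
  proof -
    interpret prob_space "ms n" using ms by (simp add: biv_set_def)
    have "measure mu (A \<inter> B) = measure (ms n) ((A \<inter> B) \<times> UNIV)"
      using A B by (intro biv_set_cylinder(1)[OF ms, symmetric]) auto
    also have "\<dots> \<le> measure (ms n) (A \<times> B \<union> B \<times> - B)"
      using A B by (intro finite_measure_mono sets.Un rect) auto
    also have "\<dots> \<le> measure (ms n) (A \<times> B) + measure (ms n) (B \<times> - B)"
      using A B by (intro measure_Un_le rect) auto
    finally show ?thesis .
  qed
  then show "\<forall>\<^sub>F n in sequentially. measure mu (A \<inter> B) - measure (ms n) (B \<times> - B) \<le> measure (ms n) (A \<times> B)"
    by (simp add: algebra_simps)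
  \<comment> \<open>The double complement gives the error set the shape that \<open>off\<close> asks
    for, with \<open>- B\<close> as the set.\<close>
  have "measure (ms n) (A \<times> B) \<le> measure mu (A \<inter> B) + measure (ms n) ((- B) \<times> (- (- B)))" for n
  proof -
    interpret prob_space "ms n" using ms by (simp add: biv_set_def)
    have "measure (ms n) (A \<times> B) \<le> measure (ms n) ((A \<inter> B) \<times> UNIV \<union> (- B) \<times> (- (- B)))"
      using A B by (intro finite_measure_mono sets.Un rect) auto
    also have "\<dots> \<le> measure (ms n) ((A \<inter> B) \<times> UNIV) + measure (ms n) ((- B) \<times> (- (- B)))"
      using A B by (intro measure_Un_le rect) auto
    also have "measure (ms n) ((A \<inter> B) \<times> UNIV) = measure mu (A \<inter> B)"
      using A B by (intro biv_set_cylinder(1)[OF ms]) auto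
    finally show ?thesis .
  qed
  then show "\<forall>\<^sub>F n in sequentially. measure (ms n) (A \<times> B) \<le> measure mu (A \<inter> B) + measure (ms n) ((- B) \<times> (- (- B)))"
    by simp
  show "(\<lambda>n. measure mu (A \<inter> B) - measure (ms n) (B \<times> - B)) \<longlonglongrightarrow> measure (diag_law mu) (A \<times> B)"
    using tendsto_diff[OF tendsto_const off[OF B]] by (simp add: measure_diag_law_Times mu A B)
  have "- B \<in> sets borel" using B by auto
  from tendsto_add[OF tendsto_const off[OF this]]
  show "(\<lambda>n. measure mu (A \<inter> B) + measure (ms n) ((- B) \<times> (- (- B)))) \<longlonglongrightarrow> measure (diag_law mu) (A \<times> B)"
    by (simp add: measure_diag_law_Times mu A B)
qed

section \<open>Iterates as couplings, and expectations at the root\<close>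

context tree_process
begin

text \<open>Invariance of \<open>mu\<close> under the recursion is read off from the existence of
  the process: the right-hand side is the law of its root.\<close>

lemma R_law: "distr (PN \<Otimes>\<^sub>M PY) borel (\<lambda>(e, x). R n e x) = mu"
proof -
  note [measurable] = measurable_R_pair[OF prob_mu sets_mu, unfolded split_beta', of n]
  have "distr (distr M (PN \<Otimes>\<^sub>M borel) (\<lambda>\<omega>. (tr n (EE \<omega>), X [] \<omega>))) borel snd = mu"
    by (subst distr_distr) (auto simp: comp_def X_root_law)
  then show ?thesis
    unfolding root_law by (subst (asm) distr_distr) (auto simp: comp_def split_beta')
qed

lemma pair_map_iterate_biv:
  assumes m: "m \<in> biv_set mu"
  shows "(pair_map N G ^^ n) m \<in> biv_set mu"
proof -
  note pm = biv_set_prob[OF prob_mu sets_mu m]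
  have "distr ((pair_map N G ^^ n) m) borel \<pi> = mu" if \<pi>: "\<pi> = fst \<or> \<pi> = snd" for \<pi> :: "'a \<times> 'a \<Rightarrow> 'a"
  proof -
    let ?K = "PN \<Otimes>\<^sub>M PiM (UNIV :: nat list set) (\<lambda>_. m)"
    have "\<pi> \<in> measurable (borel \<Otimes>\<^sub>M borel) borel" using \<pi> by auto
    then have \<pi>m: "\<pi> \<in> measurable borel borel" unfolding borel_prod .
    have \<pi>m': "\<pi> \<in> measurable m mu" using \<pi>m unfolding measurable_cong_sets[OF pm(2) sets_mu] .
    have "distr ((pair_map N G ^^ n) m) borel \<pi> = distr ?K borel (\<lambda>(e, y). R n e (\<lambda>w. \<pi> (y w)))"
      unfolding pair_map_iterate[OF pm] distr_distr[OF \<pi>m measurable_R_pair_map[OF pm(2)]]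
      using \<pi> by (auto simp: comp_def split_beta')
    also have "\<dots> = distr (distr ?K (PN \<Otimes>\<^sub>M PY) (\<lambda>(e, y). (e, \<lambda>w. \<pi> (y w)))) borel (\<lambda>(e, x). R n e x)"
    proof (subst distr_distr[OF measurable_R_pair[OF prob_mu sets_mu]])
      show "(\<lambda>(e, y). (e, \<lambda>w. \<pi> (y w))) \<in> measurable ?K (PN \<Otimes>\<^sub>M PY)"
        unfolding split_beta'
        by (intro measurable_Pair measurable_fst measurable_compose[OF measurable_snd measurable_PiM_UNIV_map] \<pi>m')
    qed (simp add: comp_def split_beta')
    also have "\<dots> = mu" unfolding coordinate_law[OF prob_mu sets_mu m \<pi>] R_law ..
    finally show ?thesis .
  qed
  then show ?thesis
    using prob_space_pair_map_iterate[OF pm] sets_pair_map_iterate[OF pm] by (auto simp: biv_set_def)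
qed

lemma product_biv_set: "mu \<Otimes>\<^sub>M mu \<in> biv_set mu"
proof -
  have "distr (mu \<Otimes>\<^sub>M mu) borel fst = distr (mu \<Otimes>\<^sub>M mu) mu fst" "distr (mu \<Otimes>\<^sub>M mu) borel snd = distr (mu \<Otimes>\<^sub>M mu) mu snd"
    by (auto intro!: distr_cong simp: sets_mu)
  moreover have "sets (mu \<Otimes>\<^sub>M mu) = sets borel"
    unfolding borel_prod[symmetric] by (intro sets_pair_measure_cong sets_mu)
  ultimately show ?thesis
    using distr_pair_fst[OF prob_mu prob_mu] distr_pair_snd[OF prob_mu prob_mu] prob_space_pair[OF prob_mu prob_mu]
    by (simp add: biv_set_def)
qed

lemma mn_biv_set: "mn n \<in> biv_set mu"
  by (intro pair_map_iterate_biv product_biv_set)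

lemma cond_mean_tr: "n \<le> k \<Longrightarrow> h n a (tr k e) = h n a e"
  by (simp add: cond_mean_def tree_value_truncate_words)

text \<open>Since \<open>f\<close> depends on the first \<open>k\<close> generations only,
  \<open>root_law\<close> at depth \<open>k\<close> moves the expectation into the model, where the
  values at depth \<open>k\<close> can be integrated out.\<close>

lemma expectation_root:
  assumes f: "f \<in> borel_measurable PN" and b: "b \<in> borel_measurable borel"
    and fK: "\<And>e. \<bar>f e\<bar> \<le> K" and bL: "\<And>x. \<bar>b x\<bar> \<le> L" and ftr: "\<And>e. f (tr k e) = f e"
  shows "(\<integral>\<omega>. f (EE \<omega>) * b (X [] \<omega>) \<partial>M) = (\<integral>e. f e * h k b e \<partial>PN)"
proof -
  note [measurable] = f b measurable_R_pair[OF prob_mu sets_mu, unfolded split_beta', of k]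
  have fb: "(\<lambda>p. f (fst p) * b (snd p)) \<in> borel_measurable (PN \<Otimes>\<^sub>M borel)" by measurable
  have "(\<integral>\<omega>. f (EE \<omega>) * b (X [] \<omega>) \<partial>M) = (\<integral>p. f (fst p) * b (snd p) \<partial>distr M (PN \<Otimes>\<^sub>M borel) (\<lambda>\<omega>. (tr k (EE \<omega>), X [] \<omega>)))"
    by (subst integral_distr[OF _ fb]) (measurable, simp add: ftr)
  also have "\<dots> = (\<integral>p. f (fst p) * b (R k (fst p) (snd p)) \<partial>(PN \<Otimes>\<^sub>M PY))"
    unfolding root_law by (subst integral_distr[OF _ fb]) (measurable, simp add: ftr split_beta')
  also have "\<dots> = (\<integral>e. f e * h k b e \<partial>PN)"
    by (rule integral_times_R[OF prob_mu sets_mu f b fK bL])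
  finally show ?thesis .
qed

text \<open>The left side does not mention \<open>k\<close>, so the right side is the same for all
  \<open>k \<ge> n\<close>. This is the tower property in the form in which
  \<open>overlap_convergent_same\<close> needs it.\<close>

lemma expectation_root_cond_mean:
  assumes a: "a \<in> borel_measurable borel" "\<And>x. \<bar>a x\<bar> \<le> K" and b: "b \<in> borel_measurable borel" "\<And>x. \<bar>b x\<bar> \<le> L"
    and "n \<le> k"
  shows "(\<integral>\<omega>. h n a (EE \<omega>) * b (X [] \<omega>) \<partial>M) = (\<integral>e. h n a e * h k b e \<partial>PN)"
proof (rule expectation_root)
  show "\<bar>h n a e\<bar> \<le> K" for e by (rule cond_mean_bounded[OF prob_mu sets_mu a])
qed (use assms in \<open>auto simp: cond_mean_tr intro: cond_mean_measurable[OF prob_mu sets_mu]\<close>)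

lemma expectation_cond_mean_square:
  assumes a: "a \<in> borel_measurable borel" "\<And>x. \<bar>a x\<bar> \<le> K"
  shows "(\<integral>\<omega>. (h n a (EE \<omega>))\<^sup>2 \<partial>M) = (\<integral>e. (h n a e)\<^sup>2 \<partial>PN)"
proof -
  interpret PY: prob_space PY by (rule prob_space_PX[OF prob_mu sets_mu])
  note [measurable] = cond_mean_measurable[OF prob_mu sets_mu a(1)]
  have K: "\<bar>(h n a e)\<^sup>2\<bar> \<le> K\<^sup>2" for e
    using cond_mean_bounded[OF prob_mu sets_mu a, of n e] by (simp add: abs_le_square_iff[symmetric])
  \<comment> \<open>The factor 1 plays the part of \<open>b\<close>; its conditional mean is again
    1.\<close>
  have "(\<integral>\<omega>. (h n a (EE \<omega>))\<^sup>2 * 1 \<partial>M) = (\<integral>e. (h n a e)\<^sup>2 * h n (\<lambda>_. 1 :: real) e \<partial>PN)"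
    by (rule expectation_root[where L=1, OF _ _ K]) (auto simp: cond_mean_tr)
  then show ?thesis by (simp add: cond_mean_def PY.prob_space)
qed

end

section \<open>Measurability of the root with respect to the innovations\<close>

context tree_process
begin

abbreviation "\<G> \<equiv> vimage_algebra (space M) EE PN"

text \<open>Endogeny, with the sigma-algebra taken to be the one generated by the whole innovation
  family as a single map.\<close>

definition "root_determined \<longleftrightarrow> (\<exists>Y. Y \<in> measurable \<G> borel \<and> (AE \<omega> in M. X [] \<omega> = Y \<omega>))"

lemma EE_space: "EE \<in> space M \<rightarrow> space PN"
  using measurable_space[OF EE_measurable] by auto

lemma EE_measurable_G: "EE \<in> measurable \<G> PN"
  by (rule measurable_vimage_algebra1[OF EE_space])

text \<open>The event that the root lies in \<open>A\<close> differs by less than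
  \<open>\<epsilon> / 2\<close> from an event of the first \<open>k\<close> generations. Both
  coordinates of an iterate share their innovations; if one lies in \<open>A\<close> and the other
  does not, at least one disagrees with that common event. By \<open>coordinate_law\<close> the
  probability of disagreement is the same for every coupling \<open>m\<close> and both
  coordinates.\<close>

lemma off_diagonal_small:
  assumes "root_determined" and A: "A \<in> sets borel" and \<epsilon>: "\<epsilon> > 0"
  shows "\<exists>n0. \<forall>n\<ge>n0. \<forall>m\<in>biv_set mu. measure ((pair_map N G ^^ n) m) (A \<times> - A) < \<epsilon>"
proof -
  obtain Y where Y: "Y \<in> measurable \<G> borel" "AE \<omega> in M. X [] \<omega> = Y \<omega>"
    using assms(1) by (auto simp: root_determined_def)
  have "Y -` A \<inter> space \<G> \<in> sets \<G>" using Y(1) A by (rule measurable_sets)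
  then obtain B where B: "B \<in> sets PN" "Y -` A \<inter> space M = EE -` B \<inter> space M"
    unfolding sets_vimage_algebra2[OF EE_space] by auto
  let ?P = "distr M PN EE"
  have "finite_measure ?P" by (intro M.finite_measure_distr) measurable
  from approx_truncate_words[OF this _ c, of B "\<epsilon> / 2"] B \<epsilon>
  obtain k B' where B'[measurable]: "B' \<in> sets PN" and
    small: "measure ?P {e \<in> space PN. (e \<in> B) \<noteq> (tr k e \<in> B')} < \<epsilon> / 2" by auto
  have mB: "{e \<in> space PN. (e \<in> B) \<noteq> (tr k e \<in> B')} \<in> sets PN" using B(1) by measurable
  note [measurable] = A B(1)
  have "measure ((pair_map N G ^^ n) m) (A \<times> - A) < \<epsilon>" if n: "k \<le> n" and m: "m \<in> biv_set mu" for n m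
  proof -
    note pm = biv_set_prob[OF prob_mu sets_mu m]
    let ?K = "PN \<Otimes>\<^sub>M PiM (UNIV :: nat list set) (\<lambda>_. m)"
    interpret K: prob_space ?K by (intro prob_space_pair prob_space_PN prob_space_PiM pm)
    let ?S = "{p \<in> space (PN \<Otimes>\<^sub>M borel). (snd p \<in> A) \<noteq> (tr k (fst p) \<in> B')}"
    have S: "?S \<in> sets (PN \<Otimes>\<^sub>M borel)" by measurable
    note Rm = measurable_R_pair[OF prob_mu sets_mu, of n]
    note [measurable] = Rm[unfolded split_beta']
    let ?S' = "{p \<in> space (PN \<Otimes>\<^sub>M PY). (R n (fst p) (snd p) \<in> A) \<noteq> (tr k (fst p) \<in> B')}"
    have S': "?S' \<in> sets (PN \<Otimes>\<^sub>M PY)" by measurable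
    have J: "(\<lambda>\<omega>. (tr n (EE \<omega>), X [] \<omega>)) \<in> measurable M (PN \<Otimes>\<^sub>M borel)" by measurable
    have J': "(\<lambda>(e, x). (tr n e, R n e x)) \<in> measurable (PN \<Otimes>\<^sub>M PY) (PN \<Otimes>\<^sub>M borel)"
      unfolding split_beta' by measurable
    \<comment> \<open>The probability of disagreement in the model is moved to the process by
      \<open>root_law\<close>, where determination of the root replaces the event that it lies in
      \<open>A\<close> by \<open>EE \<omega> \<in> B\<close>.\<close>
    have "measure (PN \<Otimes>\<^sub>M PY) ?S' = measure (distr (PN \<Otimes>\<^sub>M PY) (PN \<Otimes>\<^sub>M borel) (\<lambda>(e, x). (tr n e, R n e x))) ?S"
    proof -
      have "p \<in> ?S' \<longleftrightarrow> p \<in> (\<lambda>(e, x). (tr n e, R n e x)) -` ?S \<inter> space (PN \<Otimes>\<^sub>M PY)" for p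
      proof (cases "p \<in> space (PN \<Otimes>\<^sub>M PY)")
        case True
        from measurable_space[OF J' True] True show ?thesis
          by (simp add: split_beta' truncate_words_truncate_words[OF n])
      qed simp
      then show ?thesis unfolding measure_distr[OF J' S] by (intro arg_cong[where f="measure _"] set_eqI)
    qed
    also have "\<dots> = measure M ((\<lambda>\<omega>. (tr n (EE \<omega>), X [] \<omega>)) -` ?S \<inter> space M)"
      unfolding root_law[symmetric] by (rule measure_distr[OF J S])
    also have "\<dots> = measure M (EE -` {e \<in> space PN. (e \<in> B) \<noteq> (tr k e \<in> B')} \<inter> space M)"
    proof (rule M.finite_measure_eq_AE)
      show "AE \<omega> in M. (\<omega> \<in> (\<lambda>\<omega>. (tr n (EE \<omega>), X [] \<omega>)) -` ?S \<inter> space M) \<longleftrightarrow>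
          (\<omega> \<in> EE -` {e \<in> space PN. (e \<in> B) \<noteq> (tr k e \<in> B')} \<inter> space M)"
        using Y(2) AE_space
      proof eventually_elim
        case (elim \<omega>)
        have "\<omega> \<in> Y -` A \<inter> space M \<longleftrightarrow> \<omega> \<in> EE -` B \<inter> space M" by (simp only: B(2))
        then have "(X [] \<omega> \<in> A) = (EE \<omega> \<in> B)" using elim by simp
        then show ?case
          using elim(2) measurable_space[OF J elim(2)] measurable_space[OF EE_measurable elim(2)]
          by (simp add: truncate_words_truncate_words[OF n])
      qed
      show "(\<lambda>\<omega>. (tr n (EE \<omega>), X [] \<omega>)) -` ?S \<inter> space M \<in> sets M" by (rule measurable_sets[OF J S])
      show "EE -` {e \<in> space PN. (e \<in> B) \<noteq> (tr k e \<in> B')} \<inter> space M \<in> sets M"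
        by (rule measurable_sets[OF EE_measurable mB])
    qed
    also have "\<dots> < \<epsilon> / 2" using small unfolding measure_distr[OF EE_measurable mB] .
    finally have S'_small: "measure (PN \<Otimes>\<^sub>M PY) ?S' < \<epsilon> / 2" .
    have coord: "(\<lambda>(e, y). (e, \<lambda>w. \<pi> (y w))) \<in> measurable ?K (PN \<Otimes>\<^sub>M PY)"
      "measure ?K ((\<lambda>(e, y). (e, \<lambda>w. \<pi> (y w))) -` ?S' \<inter> space ?K) < \<epsilon> / 2"
      if \<pi>: "\<pi> = fst \<or> \<pi> = snd" for \<pi> :: "'a \<times> 'a \<Rightarrow> 'a"
    proof -
      have "\<pi> \<in> measurable (borel \<Otimes>\<^sub>M borel) borel" using \<pi> by auto
      then have "\<pi> \<in> measurable m mu" unfolding borel_prod measurable_cong_sets[OF pm(2) sets_mu] .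
      then show C: "(\<lambda>(e, y). (e, \<lambda>w. \<pi> (y w))) \<in> measurable ?K (PN \<Otimes>\<^sub>M PY)"
        unfolding split_beta'
        by (intro measurable_Pair measurable_fst measurable_compose[OF measurable_snd measurable_PiM_UNIV_map])
      have eq: "measure (PN \<Otimes>\<^sub>M PY) ?S' = measure ?K ((\<lambda>(e, y). (e, \<lambda>w. \<pi> (y w))) -` ?S' \<inter> space ?K)"
        using measure_distr[OF C S'] unfolding coordinate_law[OF prob_mu sets_mu m \<pi>] .
      show "measure ?K ((\<lambda>(e, y). (e, \<lambda>w. \<pi> (y w))) -` ?S' \<inter> space ?K) < \<epsilon> / 2" by (rule S'_small[unfolded eq])
    qed
    let ?L = "\<lambda>(e, y). (R n e (\<lambda>w. fst (y w)), R n e (\<lambda>w. snd (y w)))"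
    let ?D = "\<lambda>\<pi>. (\<lambda>(e, y). (e, \<lambda>w. \<pi> (y w))) -` ?S' \<inter> space ?K"
    have AA: "A \<times> - A \<in> sets borel" unfolding borel_prod[symmetric] using A by auto
    have D: "?D \<pi> \<in> sets ?K" if "\<pi> = fst \<or> \<pi> = snd" for \<pi> :: "'a \<times> 'a \<Rightarrow> 'a"
      using coord(1)[OF that] S' by (rule measurable_sets)
    have "measure ((pair_map N G ^^ n) m) (A \<times> - A) = measure ?K (?L -` (A \<times> - A) \<inter> space ?K)"
      unfolding pair_map_iterate[OF pm] by (rule measure_distr[OF measurable_R_pair_map[OF pm(2)] AA])
    also have "\<dots> \<le> measure ?K (?D fst \<union> ?D snd)"
    proof (rule K.finite_measure_mono)
      show "?L -` (A \<times> - A) \<inter> space ?K \<subseteq> ?D fst \<union> ?D snd"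
      proof
        fix p assume p: "p \<in> ?L -` (A \<times> - A) \<inter> space ?K"
        then have "p \<in> space ?K" by simp
        from measurable_space[OF coord(1)[OF disjI1[OF refl]] this] measurable_space[OF coord(1)[OF disjI2[OF refl]] this] p
        show "p \<in> ?D fst \<union> ?D snd" by (cases p) auto
      qed
    qed (intro sets.Un D, auto)
    also have "\<dots> \<le> measure ?K (?D fst) + measure ?K (?D snd)"
      by (intro measure_Un_le D) auto
    also have "\<dots> < \<epsilon> / 2 + \<epsilon> / 2"
      by (intro add_strict_mono coord(2)) auto
    also have "\<epsilon> / 2 + \<epsilon> / 2 = \<epsilon>" by simp
    finally show ?thesis .
  qed
  then show ?thesis by blast
qed

lemma prob_diag: "prob_space (diag_law mu)"
  using diag_law_biv_set[OF prob_mu sets_mu] by (simp add: biv_set_def)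

text \<open>A fixed point is its own iterate, so the uniform bound leaves no mass on any
  \<open>A \<times> - A\<close>. The constant sequence \<open>m\<close> then converges weakly to
  \<open>m\<close> and to the diagonal law, and limits are unique.\<close>

lemma root_determined_imp_unique:
  assumes "root_determined" and m: "m \<in> biv_set mu" and fixp: "pair_map N G m = m"
  shows "m = diag_law mu"
proof -
  note pm = biv_set_prob[OF prob_mu sets_mu m]
  have iter: "(pair_map N G ^^ n) m = m" for n by (induction n) (auto simp: fixp)
  have "measure m (A \<times> - A) = 0" if "A \<in> sets borel" for A
  proof (rule ccontr)
    assume "measure m (A \<times> - A) \<noteq> 0"
    then have "measure m (A \<times> - A) > 0" by (simp add: zero_less_measure_iff)
    from off_diagonal_small[OF assms(1) that this]
    obtain n0 where "measure ((pair_map N G ^^ n0) m) (A \<times> - A) < measure m (A \<times> - A)" using m by blast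
    then show False by (simp only: iter less_irrefl)
  qed
  then have "weak_conv_meas (\<lambda>_. m) (diag_law mu)"
    by (intro weak_conv_measI_rectangles tendsto_diag_law_rectangle prob_mu sets_mu m pm prob_diag) auto
  moreover have "weak_conv_meas (\<lambda>_. m) m" by (simp add: weak_conv_meas_def)
  ultimately show ?thesis
    by (intro weak_conv_meas_unique[where Ms="\<lambda>_. m"] pm prob_diag) auto
qed

lemma root_determined_imp_weak_conv:
  assumes "root_determined"
  shows "weak_conv_meas mn (diag_law mu)"
proof (rule weak_conv_measI_rectangles)
  note pm = biv_set_prob[OF prob_mu sets_mu mn_biv_set]
  show "prob_space (mn n)" "sets (mn n) = sets borel" for n by (rule pm)+
  have off: "(\<lambda>n. measure (mn n) (A \<times> - A)) \<longlonglongrightarrow> 0" if "A \<in> sets borel" for A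
  proof (rule LIMSEQ_I)
    fix r :: real assume "0 < r"
    from off_diagonal_small[OF assms that this]
    obtain n0 where "\<forall>n\<ge>n0. measure (mn n) (A \<times> - A) < r" using product_biv_set by blast
    then show "\<exists>no. \<forall>n\<ge>no. norm (measure (mn n) (A \<times> - A) - 0) < r" by auto
  qed
  show "(\<lambda>n. measure (mn n) (A \<times> B)) \<longlonglongrightarrow> measure (diag_law mu) (A \<times> B)"
    if "A \<in> sets borel" "B \<in> sets borel" for A B
    by (rule tendsto_diag_law_rectangle[OF prob_mu sets_mu mn_biv_set off that])
qed (use prob_diag in auto)

section \<open>The mean square residual and recovery of the root\<close>

lemma expectation_residual:
  assumes a[measurable]: "a \<in> borel_measurable borel" and aK: "\<And>x. \<bar>a x\<bar> \<le> K"
  shows "(\<integral>\<omega>. (a (X [] \<omega>) - h n a (EE \<omega>))\<^sup>2 \<partial>M) = (\<integral>x. (a x)\<^sup>2 \<partial>mu) - (\<integral>p. a (fst p) * a (snd p) \<partial>mn n)"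
proof -
  note [measurable] = cond_mean_measurable[OF prob_mu sets_mu a]
  note hK = cond_mean_bounded[OF prob_mu sets_mu a aK]
  have prodK: "\<bar>u * v\<bar> \<le> K * K" if "\<bar>u\<bar> \<le> K" "\<bar>v\<bar> \<le> K" for u v :: real
    unfolding abs_mult using that by (intro mult_mono) auto
  have i1: "integrable M (\<lambda>\<omega>. (a (X [] \<omega>))\<^sup>2)"
    unfolding power2_eq_square
    by (rule M.integrable_const_bound[of _ "K * K"], rule AE_I2, unfold real_norm_def, rule prodK[OF aK aK]) measurable
  have i2: "integrable M (\<lambda>\<omega>. h n a (EE \<omega>) * a (X [] \<omega>))"
    by (rule M.integrable_const_bound[of _ "K * K"], rule AE_I2, unfold real_norm_def, rule prodK[OF hK aK]) measurable
  have i3: "integrable M (\<lambda>\<omega>. (h n a (EE \<omega>))\<^sup>2)"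
    unfolding power2_eq_square
    by (rule M.integrable_const_bound[of _ "K * K"], rule AE_I2, unfold real_norm_def, rule prodK[OF hK hK]) measurable
  have "(\<integral>\<omega>. (a (X [] \<omega>) - h n a (EE \<omega>))\<^sup>2 \<partial>M)
      = (\<integral>\<omega>. (a (X [] \<omega>))\<^sup>2 - 2 * (h n a (EE \<omega>) * a (X [] \<omega>)) + (h n a (EE \<omega>))\<^sup>2 \<partial>M)"
    by (intro Bochner_Integration.integral_cong) (auto simp: power2_eq_square algebra_simps)
  also have "\<dots> = (\<integral>\<omega>. (a (X [] \<omega>))\<^sup>2 \<partial>M) - 2 * (\<integral>\<omega>. h n a (EE \<omega>) * a (X [] \<omega>) \<partial>M) + (\<integral>\<omega>. (h n a (EE \<omega>))\<^sup>2 \<partial>M)"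
    using i1 i2 i3 by simp
  \<comment> \<open>The cross term and the square of \<open>h n a\<close> have the same integral, as
    for an orthogonal projection, so only one copy survives with a minus sign.\<close>
  also have "(\<integral>\<omega>. h n a (EE \<omega>) * a (X [] \<omega>) \<partial>M) = (\<integral>e. h n a e * h n a e \<partial>PN)"
    by (rule expectation_root_cond_mean[OF a aK a aK order_refl])
  also have "(\<integral>\<omega>. (h n a (EE \<omega>))\<^sup>2 \<partial>M) = (\<integral>e. h n a e * h n a e \<partial>PN)"
    using expectation_cond_mean_square[OF a aK, of n] by (simp add: power2_eq_square)
  also have "(\<integral>\<omega>. (a (X [] \<omega>))\<^sup>2 \<partial>M) = (\<integral>x. (a x)\<^sup>2 \<partial>mu)"
    unfolding X_root_law[symmetric] by (subst integral_distr) auto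
  finally show ?thesis
    using integral_pair_map_iterate[OF prob_mu sets_mu a a aK aK, of n] by simp
qed

text \<open>Testing the weak convergence with a(x) a(y) makes the residual vanish, so
  \<open>h n a\<close> along the innovations tends to \<open>a\<close> at the root in mean square.
  Along a subsequence it converges almost surely, and the limit is a function of the
  innovations.\<close>

lemma continuous_function_determined:
  assumes conv: "weak_conv_meas mn (diag_law mu)"
    and a: "continuous_on UNIV a" "\<And>x. 0 \<le> a x" "\<And>x. a x \<le> (1 :: real)"
  shows "\<exists>v\<in>borel_measurable \<G>. AE \<omega> in M. a (X [] \<omega>) = v \<omega>"
proof -
  have am[measurable]: "a \<in> borel_measurable borel" using a(1) by (rule borel_measurable_continuous_onI)
  have aK: "\<bar>a x\<bar> \<le> 1" for x using a(2,3)[of x] by simp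
  note hm[measurable] = cond_mean_measurable[OF prob_mu sets_mu am]
  note hK = cond_mean_bounded[OF prob_mu sets_mu am aK]
  have "continuous_on UNIV (\<lambda>p. a (fst p) * a (snd p))"
    by (intro continuous_intros continuous_on_compose2[OF a(1)]) auto
  moreover have "bounded (range (\<lambda>p. a (fst p) * a (snd p)))"
    using aK by (auto simp: bounded_iff abs_mult intro!: exI[of _ 1] mult_le_one)
  ultimately have "(\<lambda>n. \<integral>p. a (fst p) * a (snd p) \<partial>mn n) \<longlonglongrightarrow> (\<integral>p. a (fst p) * a (snd p) \<partial>diag_law mu)"
    using conv unfolding weak_conv_meas_def by blast
  also have "(\<integral>p. a (fst p) * a (snd p) \<partial>diag_law mu) = (\<integral>x. (a x)\<^sup>2 \<partial>mu)"
  proof -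
    have "(\<lambda>p. a (fst p) * a (snd p)) \<in> borel_measurable borel"
      unfolding borel_prod[symmetric] by measurable
    then show ?thesis
      unfolding diag_law_def using diagonal_measurable[OF sets_mu]
      by (subst integral_distr) (auto simp: power2_eq_square)
  qed
  finally have "(\<lambda>n. (\<integral>x. (a x)\<^sup>2 \<partial>mu) - (\<integral>p. a (fst p) * a (snd p) \<partial>mn n)) \<longlonglongrightarrow> (\<integral>x. (a x)\<^sup>2 \<partial>mu) - (\<integral>x. (a x)\<^sup>2 \<partial>mu)"
    by (intro tendsto_intros)
  then have L2: "(\<lambda>n. \<integral>\<omega>. (a (X [] \<omega>) - h n a (EE \<omega>))\<^sup>2 \<partial>M) \<longlonglongrightarrow> 0"
    unfolding expectation_residual[OF am aK] by simp
  have "\<exists>r. strict_mono r \<and> (AE \<omega> in M. (\<lambda>n. (a (X [] \<omega>) - h (r n) a (EE \<omega>))\<^sup>2) \<longlonglongrightarrow> 0)"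
  proof (rule tendsto_L1_AE_subseq)
    show "(\<lambda>n. \<integral>\<omega>. norm ((a (X [] \<omega>) - h n a (EE \<omega>))\<^sup>2) \<partial>M) \<longlonglongrightarrow> 0" using L2 by simp
    fix n
    have "(a (X [] \<omega>) - h n a (EE \<omega>))\<^sup>2 \<le> 2\<^sup>2" for \<omega>
      using aK[of "X [] \<omega>"] hK[of n "EE \<omega>"] by (subst abs_le_square_iff[symmetric]) simp
    then show "integrable M (\<lambda>\<omega>. (a (X [] \<omega>) - h n a (EE \<omega>))\<^sup>2)"
      by (intro M.integrable_const_bound[of _ "2\<^sup>2"]) auto
  qed
  then obtain r where r: "AE \<omega> in M. (\<lambda>n. (a (X [] \<omega>) - h (r n) a (EE \<omega>))\<^sup>2) \<longlonglongrightarrow> 0" by blast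
  show ?thesis
  proof (rule bexI)
    show "(\<lambda>\<omega>. lim (\<lambda>n. h (r n) a (EE \<omega>))) \<in> borel_measurable \<G>"
      using measurable_compose[OF EE_measurable_G hm] by (intro borel_measurable_lim_metric)
    show "AE \<omega> in M. a (X [] \<omega>) = lim (\<lambda>n. h (r n) a (EE \<omega>))"
      using r
    proof eventually_elim
      case (elim \<omega>)
      from tendsto_real_sqrt[OF elim] have "(\<lambda>n. \<bar>a (X [] \<omega>) - h (r n) a (EE \<omega>)\<bar>) \<longlonglongrightarrow> 0" by simp
      then have "(\<lambda>n. a (X [] \<omega>) - h (r n) a (EE \<omega>)) \<longlonglongrightarrow> 0" by (rule tendsto_rabs_zero_cancel)
      from tendsto_diff[OF tendsto_const[of "a (X [] \<omega>)"] this]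
      have "(\<lambda>n. h (r n) a (EE \<omega>)) \<longlonglongrightarrow> a (X [] \<omega>)" by simp
      then show ?case by (simp add: limI)
    qed
  qed
qed

end

text \<open>Continuous functions give closed events, hence all Borel events up to null sets, hence
  functions of finite range; the identity is a pointwise limit of simple functions. Only countably
  many null sets are united on the way.\<close>

lemma AE_eq_measurable_of_continuous:
  fixes X :: "'w \<Rightarrow> 'a::polish_space"
  assumes sp: "space F = space M"
    and cont: "\<And>a :: 'a \<Rightarrow> real. continuous_on UNIV a \<Longrightarrow> (\<And>x. 0 \<le> a x) \<Longrightarrow> (\<And>x. a x \<le> 1) \<Longrightarrow>
      \<exists>v\<in>borel_measurable F. AE \<omega> in M. a (X \<omega>) = v \<omega>"
  shows "\<exists>Y\<in>measurable F borel. AE \<omega> in M. X \<omega> = Y \<omega>"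
proof -
  have event: "\<exists>B\<in>sets F. AE \<omega> in M. X \<omega> \<in> A \<longleftrightarrow> \<omega> \<in> B" if "A \<in> sets borel" for A
  proof -
    have "A \<in> sigma_sets UNIV (Collect closed)" using that by (simp add: borel_eq_closed)
    then show ?thesis
    proof induction
      case (Basic C)
      then obtain \<phi> :: "nat \<Rightarrow> 'a \<Rightarrow> real"
        where \<phi>: "\<And>k. continuous_on UNIV (\<phi> k)" "\<And>k x. 0 \<le> \<phi> k x" "\<And>k x. \<phi> k x \<le> 1"
        "\<And>x. (\<lambda>k. \<phi> k x) \<longlonglongrightarrow> indicator C x"
        using closed_indicator_approx[of C] by blast
      have "\<forall>k. \<exists>v. v \<in> borel_measurable F \<and> (AE \<omega> in M. \<phi> k (X \<omega>) = v \<omega>)"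
        using cont[OF \<phi>(1-3)] by blast
      from choice[OF this] obtain v
        where v: "\<forall>k. v k \<in> borel_measurable F \<and> (AE \<omega> in M. \<phi> k (X \<omega>) = v k \<omega>)" ..
      then have [measurable]: "\<And>k. v k \<in> borel_measurable F" by blast
      have "AE \<omega> in M. \<forall>k. \<phi> k (X \<omega>) = v k \<omega>" using v by (simp add: AE_all_countable)
      then have "AE \<omega> in M. X \<omega> \<in> C \<longleftrightarrow> \<omega> \<in> {\<omega> \<in> space F. lim (\<lambda>k. v k \<omega>) = 1}"
        using AE_space
      proof eventually_elim
        case (elim \<omega>)
        then have "(\<lambda>k. \<phi> k (X \<omega>)) = (\<lambda>k. v k \<omega>)" by auto
        with \<phi>(4)[of "X \<omega>"] have "lim (\<lambda>k. v k \<omega>) = indicator C (X \<omega>)" by (simp add: limI)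
        then show ?case using elim by (simp add: sp indicator_def)
      qed
      moreover have "{\<omega> \<in> space F. lim (\<lambda>k. v k \<omega>) = 1} \<in> sets F" by measurable
      ultimately show ?case by blast
    next
      case Empty
      show ?case by (intro bexI[of _ "{}"]) auto
    next
      case (Compl A)
      then obtain B where B: "B \<in> sets F" "AE \<omega> in M. X \<omega> \<in> A \<longleftrightarrow> \<omega> \<in> B" by blast
      from B(2) AE_space have "AE \<omega> in M. X \<omega> \<in> UNIV - A \<longleftrightarrow> \<omega> \<in> space F - B"
        by eventually_elim (auto simp: sp)
      then show ?case using B(1) by blast
    next
      case (Union A)
      then have "\<forall>i. \<exists>B. B \<in> sets F \<and> (AE \<omega> in M. X \<omega> \<in> A i \<longleftrightarrow> \<omega> \<in> B)" by blast
      from choice[OF this] obtain B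
        where B: "\<forall>i. B i \<in> sets F \<and> (AE \<omega> in M. X \<omega> \<in> A i \<longleftrightarrow> \<omega> \<in> B i)" ..
      then have "AE \<omega> in M. \<forall>i. X \<omega> \<in> A i \<longleftrightarrow> \<omega> \<in> B i" by (simp add: AE_all_countable)
      then have "AE \<omega> in M. X \<omega> \<in> (\<Union>i. A i) \<longleftrightarrow> \<omega> \<in> (\<Union>i. B i)" by eventually_elim auto
      moreover have "(\<Union>i. B i) \<in> sets F" using B by auto
      ultimately show ?case by blast
    qed
  qed
  have simple: "\<exists>Y\<in>measurable F borel. AE \<omega> in M. f (X \<omega>) = Y \<omega>"
    if "finite V" "f \<in> borel_measurable borel" "range f \<subseteq> insert d V" for V d and f :: "'a \<Rightarrow> 'a"
    using that
  proof (induction V arbitrary: f rule: finite_induct)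
    case empty
    then have "f x = d" for x by auto
    then show ?case by (intro bexI[of _ "\<lambda>_. d"]) auto
  next
    case (insert v V)
    note [measurable] = insert.prems(1)
    have "(\<lambda>x. if f x = v then d else f x) \<in> borel_measurable borel" by measurable
    then obtain Y where Y: "Y \<in> measurable F borel" "AE \<omega> in M. (if f (X \<omega>) = v then d else f (X \<omega>)) = Y \<omega>"
      using insert.IH[of "\<lambda>x. if f x = v then d else f x"] insert.prems by auto
    have "f -` {v} \<inter> space borel \<in> sets borel" by measurable
    from event[OF this] obtain B where B: "B \<in> sets F" "AE \<omega> in M. X \<omega> \<in> f -` {v} \<inter> space borel \<longleftrightarrow> \<omega> \<in> B" by blast
    have "(\<lambda>\<omega>. if \<omega> \<in> B then v else Y \<omega>) \<in> measurable F borel" using B(1) Y(1) by measurable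
    moreover have "AE \<omega> in M. f (X \<omega>) = (if \<omega> \<in> B then v else Y \<omega>)"
      using Y(2) B(2) by eventually_elim (auto split: if_splits)
    ultimately show ?case by (intro bexI[of _ "\<lambda>\<omega>. if \<omega> \<in> B then v else Y \<omega>"])
  qed
  obtain S where S: "\<And>i. simple_function borel (S i)" "\<And>x :: 'a. (\<lambda>i. S i x) \<longlonglongrightarrow> x"
    using borel_measurable_implies_sequence_metric[of "\<lambda>x. x" borel undefined] by auto
  have "\<forall>i. \<exists>Y. Y \<in> measurable F borel \<and> (AE \<omega> in M. S i (X \<omega>) = Y \<omega>)"
  proof
    fix i
    have "finite (range (S i))" using simple_functionD(1)[OF S(1)[of i]] by simp
    moreover have "range (S i) \<subseteq> insert undefined (range (S i))" by auto
    ultimately have "\<exists>Y\<in>measurable F borel. AE \<omega> in M. S i (X \<omega>) = Y \<omega>"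
      by (intro simple borel_measurable_simple_function[OF S(1)])
    then show "\<exists>Y. Y \<in> measurable F borel \<and> (AE \<omega> in M. S i (X \<omega>) = Y \<omega>)"
      unfolding Bex_def .
  qed
  from choice[OF this] obtain Y where Y: "\<forall>i. Y i \<in> measurable F borel \<and> (AE \<omega> in M. S i (X \<omega>) = Y i \<omega>)" ..
  then have [measurable]: "\<And>i. Y i \<in> measurable F borel" by blast
  \<comment> \<open>Where the versions \<open>Y i\<close> do not form a Cauchy sequence they are
    replaced by a constant one. By completeness the limit then exists everywhere, which makes it
    measurable, and almost everywhere nothing changes.\<close>
  define u where "u i \<omega> = (if Cauchy (\<lambda>i. Y i \<omega>) then Y i \<omega> else undefined)" for i \<omega>
  have [measurable]: "u i \<in> measurable F borel" for i unfolding u_def by measurable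
  have lim: "(\<lambda>i. u i \<omega>) \<longlonglongrightarrow> lim (\<lambda>i. u i \<omega>)" for \<omega>
  proof -
    have "Cauchy (\<lambda>i. u i \<omega>)"
      by (cases "Cauchy (\<lambda>i. Y i \<omega>)") (simp_all add: u_def convergent_Cauchy convergent_const)
    then show ?thesis by (simp only: Cauchy_convergent_iff convergent_LIMSEQ_iff)
  qed
  have "(\<lambda>\<omega>. lim (\<lambda>i. u i \<omega>)) \<in> measurable F borel"
    by (rule borel_measurable_LIMSEQ_metric[OF _ lim]) measurable
  moreover have "AE \<omega> in M. \<forall>i. S i (X \<omega>) = Y i \<omega>" using Y by (simp add: AE_all_countable)
  then have "AE \<omega> in M. X \<omega> = lim (\<lambda>i. u i \<omega>)"
  proof eventually_elim
    case (elim \<omega>)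
    then have "(\<lambda>i. Y i \<omega>) = (\<lambda>i. S i (X \<omega>))" by simp
    with S(2)[of "X \<omega>"] have Ylim: "(\<lambda>i. Y i \<omega>) \<longlonglongrightarrow> X \<omega>" by simp
    then have "(\<lambda>i. u i \<omega>) = (\<lambda>i. Y i \<omega>)" using LIMSEQ_imp_Cauchy[OF Ylim] by (simp add: u_def)
    with Ylim show ?case by (simp add: limI)
  qed
  ultimately show ?thesis by (intro bexI[of _ "\<lambda>\<omega>. lim (\<lambda>i. u i \<omega>)"])
qed

section \<open>Convergence of the iterates and the converse under continuity\<close>

context tree_process
begin

lemma weak_conv_imp_root_determined:
  assumes "weak_conv_meas mn (diag_law mu)"
  shows "root_determined"
proof -
  have "\<exists>Y\<in>measurable \<G> borel. AE \<omega> in M. X [] \<omega> = Y \<omega>"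
  proof (rule AE_eq_measurable_of_continuous)
    fix a :: "'a \<Rightarrow> real" assume "continuous_on UNIV a" "\<And>x. 0 \<le> a x" "\<And>x. a x \<le> 1"
    then show "\<exists>v\<in>borel_measurable \<G>. AE \<omega> in M. a (X [] \<omega>) = v \<omega>"
      by (rule continuous_function_determined[OF assms])
  qed simp
  then show ?thesis unfolding root_determined_def Bex_def .
qed

definition "overlap n a b = (\<integral>e. h n a e * h n b e \<partial>PN)"

lemma overlap_convergent_same:
  assumes a: "a \<in> borel_measurable borel" and aK: "\<And>x. \<bar>a x\<bar> \<le> K"
  shows "convergent (\<lambda>n. overlap n a a)"
proof -
  interpret PN: prob_space PN by (rule prob_space_PN)
  note [measurable] = cond_mean_measurable[OF prob_mu sets_mu a]
  note hK = cond_mean_bounded[OF prob_mu sets_mu a aK]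
  have prodK: "\<bar>u * v\<bar> \<le> K * K" if "\<bar>u\<bar> \<le> K" "\<bar>v\<bar> \<le> K" for u v :: real
    unfolding abs_mult using that by (intro mult_mono) auto
  have int: "integrable PN (\<lambda>e. h n a e * h k a e)" for n k
    by (rule PN.integrable_const_bound[of _ "K * K"], rule AE_I2, unfold real_norm_def, rule prodK[OF hK hK]) measurable
  have "overlap n a a \<le> overlap k a a" if "n \<le> k" for n k
  proof -
    \<comment> \<open>By the tower property replacing \<open>h k a\<close> by \<open>h n a\<close>
      does not change the integral against \<open>h n a\<close>. The increments are therefore
      orthogonal, and the difference of two overlaps is a mean square.\<close>
    have cross: "(\<integral>e. h n a e * h k a e \<partial>PN) = overlap n a a"
      unfolding overlap_def
      by (rule trans[OF expectation_root_cond_mean[OF a aK a aK that, symmetric]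
            expectation_root_cond_mean[OF a aK a aK order_refl]])
    have "0 \<le> (\<integral>e. (h k a e - h n a e)\<^sup>2 \<partial>PN)" by simp
    also have "\<dots> = (\<integral>e. h k a e * h k a e - 2 * (h n a e * h k a e) + h n a e * h n a e \<partial>PN)"
      by (intro Bochner_Integration.integral_cong) (auto simp: power2_eq_square algebra_simps)
    also have "\<dots> = overlap k a a - 2 * overlap n a a + overlap n a a"
      using int cross by (simp add: overlap_def)
    finally show ?thesis by simp
  qed
  then have inc: "incseq (\<lambda>n. overlap n a a)" by (simp add: incseq_def)
  have bd: "\<forall>n. overlap n a a \<le> K * K"
  proof
    fix n
    have "overlap n a a \<le> (\<integral>e. K * K \<partial>PN)"
      unfolding overlap_def using prodK[OF hK hK] by (intro integral_mono int) (auto simp: abs_le_iff)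
    then show "overlap n a a \<le> K * K" by (simp add: PN.prob_space)
  qed
  obtain L where "(\<lambda>n. overlap n a a) \<longlonglongrightarrow> L" using incseq_convergent[OF inc bd] .
  then show ?thesis by (rule convergentI)
qed

lemma cond_mean_add:
  assumes a: "a \<in> borel_measurable borel" "\<And>x. \<bar>a x\<bar> \<le> K" and b: "b \<in> borel_measurable borel" "\<And>x. \<bar>b x\<bar> \<le> L"
    and e: "e \<in> space PN"
  shows "h n (\<lambda>x. a x + b x) e = h n a e + h n b e"
proof -
  interpret PY: prob_space PY by (rule prob_space_PX[OF prob_mu sets_mu])
  note R = measurable_R_snd[OF prob_mu sets_mu e]
  have "integrable PY (\<lambda>x. a (R n e x))"
    using a measurable_compose[OF R a(1)] by (intro PY.integrable_const_bound[where B=K]) auto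
  moreover have "integrable PY (\<lambda>x. b (R n e x))"
    using b measurable_compose[OF R b(1)] by (intro PY.integrable_const_bound[where B=L]) auto
  ultimately show ?thesis by (simp add: cond_mean_def)
qed

lemma overlap_convergent:
  assumes a: "a \<in> borel_measurable borel" "\<And>x. \<bar>a x\<bar> \<le> K" and b: "b \<in> borel_measurable borel" "\<And>x. \<bar>b x\<bar> \<le> L"
  shows "convergent (\<lambda>n. overlap n a b)"
proof -
  interpret PN: prob_space PN by (rule prob_space_PN)
  note [measurable] = cond_mean_measurable[OF prob_mu sets_mu a(1)] cond_mean_measurable[OF prob_mu sets_mu b(1)]
  note hK = cond_mean_bounded[OF prob_mu sets_mu a] and hL = cond_mean_bounded[OF prob_mu sets_mu b]
  have prod_le: "\<bar>u * v\<bar> \<le> C * D" if "\<bar>u\<bar> \<le> C" "\<bar>v\<bar> \<le> D" for u v C D :: real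
    unfolding abs_mult using that by (intro mult_mono) auto
  have i: "integrable PN (\<lambda>e. h n a e * h n a e)" "integrable PN (\<lambda>e. h n a e * h n b e)"
    "integrable PN (\<lambda>e. h n b e * h n b e)" for n
    by (rule PN.integrable_const_bound[of _ "K * K"], rule AE_I2, unfold real_norm_def, rule prod_le[OF hK hK], measurable)
      (rule PN.integrable_const_bound[of _ "K * L"], rule AE_I2, unfold real_norm_def, rule prod_le[OF hK hL], measurable,
       rule PN.integrable_const_bound[of _ "L * L"], rule AE_I2, unfold real_norm_def, rule prod_le[OF hL hL], measurable)
  have polar: "overlap n a b = 1 / 2 * (overlap n (\<lambda>x. a x + b x) (\<lambda>x. a x + b x) - overlap n a a - overlap n b b)" for n
  proof -
    have "overlap n (\<lambda>x. a x + b x) (\<lambda>x. a x + b x)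
        = (\<integral>e. h n a e * h n a e + 2 * (h n a e * h n b e) + h n b e * h n b e \<partial>PN)"
      unfolding overlap_def
      by (intro Bochner_Integration.integral_cong) (auto simp: cond_mean_add[OF a b] algebra_simps)
    also have "\<dots> = overlap n a a + 2 * overlap n a b + overlap n b b"
      using i by (simp add: overlap_def)
    finally show ?thesis by simp
  qed
  have "\<bar>a x + b x\<bar> \<le> K + L" for x using a(2)[of x] b(2)[of x] by linarith
  then have "convergent (\<lambda>n. overlap n (\<lambda>x. a x + b x) (\<lambda>x. a x + b x))"
    using a(1) b(1) by (intro overlap_convergent_same) auto
  moreover have "convergent (\<lambda>n. overlap n a a)" "convergent (\<lambda>n. overlap n b b)"
    using overlap_convergent_same a b by blast+
  ultimately show ?thesis
    unfolding polar by (intro convergent_mult convergent_diff convergent_const) auto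
qed

lemma rectangle_convergent:
  assumes A: "A \<in> sets borel" and B: "B \<in> sets borel"
  shows "convergent (\<lambda>n. measure (mn n) (A \<times> B))"
proof -
  have "measure (mn n) (A \<times> B) = overlap n (indicator A) (indicator B)" for n
  proof -
    note pm = biv_set_prob[OF prob_mu sets_mu mn_biv_set[of n]]
    interpret prob_space "mn n" by (rule pm)
    have sp: "space (mn n) = UNIV" using pm(2) by (auto dest: sets_eq_imp_space_eq)
    have "A \<times> B \<in> sets (mn n)" unfolding pm(2) borel_prod[symmetric] using A B by auto
    then have "measure (mn n) (A \<times> B) = (\<integral>p. indicator (A \<times> B) p \<partial>mn n)" by (simp add: sp)
    also have "\<dots> = (\<integral>p. indicator A (fst p) * indicator B (snd p) \<partial>mn n)"
      by (intro Bochner_Integration.integral_cong) (auto simp: indicator_def)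
    also have "\<dots> = overlap n (indicator A) (indicator B)"
      unfolding overlap_def using A B
      by (intro integral_pair_map_iterate[OF prob_mu sets_mu, where K=1 and L=1]) (auto simp: indicator_def)
    finally show ?thesis .
  qed
  moreover have "convergent (\<lambda>n. overlap n (indicator A) (indicator B))"
    by (rule overlap_convergent[where K=1 and L=1]) (use A B in \<open>auto simp: indicator_def\<close>)
  ultimately show ?thesis by simp
qed

lemma unique_imp_root_determined:
  assumes unique: "\<And>m. m \<in> biv_set mu \<Longrightarrow> pair_map N G m = m \<Longrightarrow> m = diag_law mu"
    and cont: "weakly_continuous_on (biv_set mu) (pair_map N G)"
  shows "root_determined"
proof (rule weak_conv_imp_root_determined)
  note pm = biv_set_prob[OF prob_mu sets_mu mn_biv_set]
  obtain m where m: "prob_space m" "sets m = sets borel"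
    and rect: "\<And>A B. A \<in> sets borel \<Longrightarrow> B \<in> sets borel \<Longrightarrow> (\<lambda>n. measure (mn n) (A \<times> B)) \<longlonglongrightarrow> measure m (A \<times> B)"
    by (rule coupling_limit_exists[of mn mu mu])
       (use pm mn_biv_set rectangle_convergent in \<open>auto simp: biv_set_def\<close>)
  interpret m: prob_space m by (rule m)
  have sm: "sets m = sets (borel \<Otimes>\<^sub>M borel)" unfolding borel_prod by (rule m)
  have spm: "space m = UNIV" using m(2) by (auto dest: sets_eq_imp_space_eq)
  interpret mu: prob_space mu by (rule prob_mu)
  have "m \<in> biv_set mu"
  proof -
    have "distr m borel fst = mu" "distr m borel snd = mu"
    proof -
      have f: "fst \<in> measurable m borel" "snd \<in> measurable m borel" by (simp_all add: measurable_cong_sets[OF sm refl])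
      interpret d1: prob_space "distr m borel fst" by (rule m.prob_space_distr[OF f(1)])
      interpret d2: prob_space "distr m borel snd" by (rule m.prob_space_distr[OF f(2)])
      \<comment> \<open>Marginals survive the limit because cylinders are rectangles whose mass is
        constant along the sequence.\<close>
      have "measure m (A \<times> UNIV) = measure mu A" "measure m (UNIV \<times> A) = measure mu A" if "A \<in> sets borel" for A
        using rect[OF that, of UNIV] rect[of UNIV, OF _ that] biv_set_cylinder[OF mn_biv_set that]
        by (simp_all add: LIMSEQ_const_iff)
      then have "measure (distr m borel fst) A = measure mu A" "measure (distr m borel snd) A = measure mu A"
        if "A \<in> sets borel" for A
        using that by (simp_all add: measure_distr[OF f(1) that] measure_distr[OF f(2) that] spm fst_vimage_eq_Times snd_vimage_eq_Times)
      then show "distr m borel fst = mu" "distr m borel snd = mu"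
        by (auto intro!: measure_eqI simp: sets_mu d1.emeasure_eq_measure d2.emeasure_eq_measure mu.emeasure_eq_measure)
    qed
    then show ?thesis using m by (simp add: biv_set_def)
  qed
  have wc: "weak_conv_meas mn m" by (rule weak_conv_measI_rectangles[OF pm m rect])
  have "weak_conv_meas (\<lambda>n. pair_map N G (mn n)) (pair_map N G m)"
    using wc mn_biv_set \<open>m \<in> biv_set mu\<close>
    by (intro cont[unfolded weakly_continuous_on_def, rule_format, of mn m]) auto
  \<comment> \<open>Applying the map to the iterates only shifts the sequence by one, so the old
    limit \<open>m\<close> and the limit supplied by continuity coincide.\<close>
  moreover have "weak_conv_meas (\<lambda>n. pair_map N G (mn n)) m"
    unfolding weak_conv_meas_def
  proof (intro allI impI)
    fix f :: "'a \<times> 'a \<Rightarrow> real" assume "continuous_on UNIV f \<and> bounded (range f)"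
    with wc have "(\<lambda>n. integral\<^sup>L (mn n) f) \<longlonglongrightarrow> integral\<^sup>L m f" unfolding weak_conv_meas_def by blast
    from LIMSEQ_Suc[OF this] show "(\<lambda>n. integral\<^sup>L (pair_map N G (mn n)) f) \<longlonglongrightarrow> integral\<^sup>L m f" by simp
  qed
  moreover have "pair_map N G m \<in> biv_set mu" using pair_map_iterate_biv[OF \<open>m \<in> biv_set mu\<close>, of 1] by simp
  ultimately have "pair_map N G m = m"
    by (intro weak_conv_meas_unique[where Ms="\<lambda>n. pair_map N G (mn n)"] m) (auto simp: biv_set_def)
  then have "m = diag_law mu" by (rule unique[OF \<open>m \<in> biv_set mu\<close>])
  then show "weak_conv_meas mn (diag_law mu)" using wc by simp
qed

end

section \<open>Invariant recursive tree processes\<close>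

text \<open>Measurability into the disjoint union is checked slice by slice: \<open>enat\<close> is
  countable, and on the slice of a fixed \<open>N\<close> the map is a restriction of
  coordinates.\<close>

lemma gstar_measurable:
  assumes g: "g \<in> measurable (Theta_star Th) (borel :: 'a::topological_space measure)"
  shows "(\<lambda>(e, x). gstar g (fst e) (snd e) x) \<in> measurable ((Th \<Otimes>\<^sub>M count_space UNIV) \<Otimes>\<^sub>M PiM UNIV (\<lambda>_. borel)) borel"
proof -
  let ?PB = "PiM (UNIV :: nat set) (\<lambda>_. borel :: 'a measure)"
  let ?C = "coprod_measure UNIV (\<lambda>N. PiM (idx N) (\<lambda>_. borel :: 'a measure))"
  let ?r = "\<lambda>(N, x). (N, restrict x (idx N))"
  have r: "?r \<in> measurable (count_space UNIV \<Otimes>\<^sub>M ?PB) ?C"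
    unfolding coprod_measure_def
  proof (rule measurable_measure_of)
    show "?r \<in> space (count_space UNIV \<Otimes>\<^sub>M ?PB) \<rightarrow> (SIGMA N:UNIV. space (PiM (idx N) (\<lambda>_. borel :: 'a measure)))"
      by (auto simp: space_PiM)
    fix y assume "y \<in> {A. A \<subseteq> (SIGMA N:UNIV. space (PiM (idx N) (\<lambda>_. borel :: 'a measure))) \<and>
        (\<forall>N\<in>UNIV. Pair N -` A \<in> sets (PiM (idx N) (\<lambda>_. borel)))}"
    then have y: "\<And>N. Pair N -` y \<in> sets (PiM (idx N) (\<lambda>_. borel :: 'a measure))" by auto
    have "?r -` y \<inter> space (count_space UNIV \<Otimes>\<^sub>M ?PB)
        = (\<Union>N. {N} \<times> ((\<lambda>x. restrict x (idx N)) -` (Pair N -` y) \<inter> space ?PB))"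
      by (auto simp: space_pair_measure)
    also have "\<dots> \<in> sets (count_space UNIV \<Otimes>\<^sub>M ?PB)"
    proof (rule sets.countable_UN''[OF countableI_type], rule pair_measureI)
      show "(\<lambda>x. restrict x (idx N)) -` (Pair N -` y) \<inter> space ?PB \<in> sets ?PB" for N
        by (rule measurable_sets[OF measurable_restrict_subset y]) simp
    qed simp
    finally show "?r -` y \<inter> space (count_space UNIV \<Otimes>\<^sub>M ?PB) \<in> sets (count_space UNIV \<Otimes>\<^sub>M ?PB)" .
  qed auto
  have "(\<lambda>p. (snd (fst p), snd p)) \<in> measurable ((Th \<Otimes>\<^sub>M count_space UNIV) \<Otimes>\<^sub>M ?PB) (count_space UNIV \<Otimes>\<^sub>M ?PB)"
    by measurable
  from measurable_compose[OF this r]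
  have "(\<lambda>p. (fst (fst p), snd (fst p), restrict (snd p) (idx (snd (fst p)))))
      \<in> measurable ((Th \<Otimes>\<^sub>M count_space UNIV) \<Otimes>\<^sub>M ?PB) (Theta_star Th)"
    unfolding Theta_star_def by (intro measurable_Pair) (auto simp: split_beta')
  from measurable_compose[OF this g] show ?thesis
    by (simp add: gstar_def split_beta')
qed

text \<open>Renumbering the children of a node from 0 turns the tree of words over the positive
  integers into the set of all words, and an index family over idx N into a sequence.\<close>

definition child_map :: "('t \<times> enat \<times> (nat \<Rightarrow> 'a) \<Rightarrow> 'a) \<Rightarrow> 't \<times> enat \<Rightarrow> (nat \<Rightarrow> 'a) \<Rightarrow> 'a" where
  "child_map g e x = gstar g (fst e) (snd e) (\<lambda>j. x (j - 1))"

lemma child_map_shift: "child_map g e (\<lambda>j. x (Suc j)) = gstar g (fst e) (snd e) x"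
proof -
  \<comment> \<open>Natural subtraction would misplace the index 0 only, and \<open>idx\<close>
    starts at 1.\<close>
  have "restrict (\<lambda>j. x (Suc (j - 1))) (idx (snd e)) = restrict x (idx (snd e))"
    by (auto simp: restrict_def idx_def)
  then show ?thesis by (simp add: child_map_def gstar_def)
qed

lemma recursive_map_child_map:
  fixes g :: "'t \<times> enat \<times> (nat \<Rightarrow> 'a::polish_space) \<Rightarrow> 'a"
  assumes g: "g \<in> measurable (Theta_star Th) borel"
    and nu: "prob_space nu" "sets nu = sets (Th \<Otimes>\<^sub>M count_space UNIV)"
  shows "recursive_map nu (child_map g)"
proof (rule recursive_map.intro)
  have "(\<lambda>p. (fst p, \<lambda>j. snd p (j - 1))) \<in> measurable ((Th \<Otimes>\<^sub>M count_space UNIV) \<Otimes>\<^sub>M PiM UNIV (\<lambda>_. borel :: 'a measure))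
      ((Th \<Otimes>\<^sub>M count_space UNIV) \<Otimes>\<^sub>M PiM UNIV (\<lambda>_. borel))"
    by (intro measurable_Pair measurable_PiM_single') auto
  from measurable_compose[OF this gstar_measurable[OF g]]
  show "(\<lambda>(e, x). child_map g e x) \<in> measurable (nu \<Otimes>\<^sub>M PiM UNIV (\<lambda>_. borel)) borel"
    unfolding measurable_cong_sets[OF sets_pair_measure_cong[OF nu(2) refl] refl]
    by (simp add: child_map_def split_beta')
qed (rule nu)

text \<open>Dropping the coordinate with index 0 from an i.i.d. sequence leaves its law unchanged,
  and after this shift \<open>child_map\<close> reads exactly the coordinates that
  \<open>gstar\<close> reads.\<close>

lemma T2_eq_pair_map:
  fixes g :: "'t \<times> enat \<times> (nat \<Rightarrow> 'a::polish_space) \<Rightarrow> 'a"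
  assumes R: "recursive_map nu (child_map g)" and m: "prob_space m" "sets m = sets borel"
  shows "T2 nu g m = pair_map nu (child_map g) m"
proof -
  interpret recursive_map nu "child_map g" by (rule R)
  let ?P = "PiM (UNIV :: nat set) (\<lambda>_. m)"
  let ?s = "\<lambda>x j. x (Suc j)"
  let ?\<Phi> = "\<lambda>(e, y). (child_map g e (\<lambda>i. fst (y i)), child_map g e (\<lambda>i. snd (y i)))"
  interpret P: prob_space ?P by (intro prob_space_PiM m)
  have s[measurable]: "?s \<in> measurable ?P ?P"
    by (intro measurable_PiM_single' measurable_component_singleton) (auto simp: space_PiM PiE_iff)
  have "distr ?P ?P ?s = ?P"
    using distr_PiM_reindex[of UNIV "\<lambda>_. m" Suc UNIV] m(1) by (simp add: restrict_UNIV)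
  then have "nu \<Otimes>\<^sub>M ?P = distr nu nu (\<lambda>e. e) \<Otimes>\<^sub>M distr ?P ?P ?s" by simp
  also have "\<dots> = distr (nu \<Otimes>\<^sub>M ?P) (nu \<Otimes>\<^sub>M ?P) (\<lambda>(e, x). (e, ?s x))"
    by (intro pair_measure_distr s prob_space_imp_sigma_finite P.prob_space_distr) auto
  finally have shift: "nu \<Otimes>\<^sub>M ?P = distr (nu \<Otimes>\<^sub>M ?P) (nu \<Otimes>\<^sub>M ?P) (\<lambda>(e, x). (e, ?s x))" .
  have sm: "(\<lambda>(e, x). (e, ?s x)) \<in> measurable (nu \<Otimes>\<^sub>M ?P) (nu \<Otimes>\<^sub>M ?P)" by measurable
  have mp: "sets m = sets (borel \<Otimes>\<^sub>M borel)" unfolding borel_prod by (rule m)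
  have e: "(\<lambda>p. fst p) \<in> measurable (nu \<Otimes>\<^sub>M ?P) nu" by measurable
  have y: "(\<lambda>p. snd p i) \<in> measurable (nu \<Otimes>\<^sub>M ?P) m" for i by measurable
  have "fst \<in> measurable m borel" "snd \<in> measurable m borel"
    by (simp_all add: measurable_cong_sets[OF mp refl])
  note y12 = this[THEN measurable_compose[OF y]]
  have \<Phi>: "?\<Phi> \<in> measurable (nu \<Otimes>\<^sub>M ?P) borel"
    unfolding borel_prod[symmetric] split_beta'
    by (intro measurable_Pair measurable_G e y12)
  have "pair_map nu (child_map g) m = distr (distr (nu \<Otimes>\<^sub>M ?P) (nu \<Otimes>\<^sub>M ?P) (\<lambda>(e, x). (e, ?s x))) borel ?\<Phi>"
    by (simp only: shift[symmetric] pair_map_def)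
  also have "\<dots> = distr (nu \<Otimes>\<^sub>M ?P) borel (?\<Phi> \<circ> (\<lambda>(e, x). (e, ?s x)))"
    by (rule distr_distr[OF \<Phi> sm])
  also have "?\<Phi> \<circ> (\<lambda>(e, x). (e, ?s x)) =
      (\<lambda>((th, N), x). (gstar g th N (\<lambda>i. fst (x i)), gstar g th N (\<lambda>i. snd (x i))))"
    using child_map_shift[of g] by (auto simp: fun_eq_iff)
  finally show ?thesis by (simp only: T2_def)
qed

lemma T2_iterate_eq_pair_map:
  fixes g :: "'t \<times> enat \<times> (nat \<Rightarrow> 'a::polish_space) \<Rightarrow> 'a"
  assumes R: "recursive_map nu (child_map g)" and m: "prob_space m" "sets m = sets borel"
  shows "(T2 nu g ^^ n) m = (pair_map nu (child_map g) ^^ n) m"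
proof (induction n)
  case (Suc n)
  then show ?case
    using T2_eq_pair_map[OF R recursive_map.prob_space_pair_map_iterate[OF R m]
        recursive_map.sets_pair_map_iterate[OF R m]] by simp
qed simp

lemma (in prob_space) distr_pair_indep_set:
  assumes U: "U \<in> measurable M S" and V: "V \<in> measurable M T" and ind: "indep_set A B"
    and A: "\<And>C. C \<in> sets S \<Longrightarrow> U -` C \<inter> space M \<in> A" and B: "\<And>C. C \<in> sets T \<Longrightarrow> V -` C \<inter> space M \<in> B"
  shows "distr M (S \<Otimes>\<^sub>M T) (\<lambda>\<omega>. (U \<omega>, V \<omega>)) = distr M S U \<Otimes>\<^sub>M distr M T V"
proof (rule pair_measure_eqI[symmetric])
  note [measurable] = U V
  show "sigma_finite_measure (distr M S U)" "sigma_finite_measure (distr M T V)"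
    by (intro prob_space_imp_sigma_finite prob_space_distr U V)+
  show "sets (distr M S U \<Otimes>\<^sub>M distr M T V) = sets (distr M (S \<Otimes>\<^sub>M T) (\<lambda>\<omega>. (U \<omega>, V \<omega>)))" by simp
  fix C D assume "C \<in> sets (distr M S U)" "D \<in> sets (distr M T V)"
  then have [measurable]: "C \<in> sets S" "D \<in> sets T" by auto
  have "(\<lambda>\<omega>. (U \<omega>, V \<omega>)) -` (C \<times> D) \<inter> space M = (U -` C \<inter> space M) \<inter> (V -` D \<inter> space M)" by auto
  then show "emeasure (distr M S U) C * emeasure (distr M T V) D = emeasure (distr M (S \<Otimes>\<^sub>M T) (\<lambda>\<omega>. (U \<omega>, V \<omega>))) (C \<times> D)"
    using indep_setD[OF ind A[OF \<open>C \<in> sets S\<close>] B[OF \<open>D \<in> sets T\<close>]]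
    by (simp add: emeasure_distr emeasure_eq_measure ennreal_mult)
qed

lemma map_Suc_TT: "map Suc w \<in> TT"
  by (auto simp: TT_def)

lemma TT_map_Suc: "i \<in> TT \<Longrightarrow> map Suc (map (\<lambda>j. j - 1) i) = i"
  by (auto simp: TT_def o_def intro!: map_idI)

text \<open>The map \<open>map Suc\<close> is a length-preserving bijection from all words onto
  \<open>TT\<close>, so laws and independence carry over by reindexing. The substance is
  \<open>joint_law\<close>, obtained by regrouping the independence within a generation into two
  blocks.\<close>

lemma invariant_RTP_tree_process:
  fixes Th :: "'t measure" and g :: "'t \<times> enat \<times> (nat \<Rightarrow> 'a::polish_space) \<Rightarrow> 'a"
  assumes g: "g \<in> measurable (Theta_star Th) borel"
    and nu: "prob_space nu" "sets nu = sets (Th \<Otimes>\<^sub>M count_space UNIV)"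
    and RTP: "invariant_RTP M Th nu g mu xi X" and c: "c \<in> space nu"
  shows "tree_process nu (child_map g) M mu (\<lambda>w. xi (map Suc w)) (\<lambda>w. X (map Suc w)) c"
proof -
  interpret M: prob_space M using RTP by (simp add: invariant_RTP_def)
  interpret recursive_map nu "child_map g" by (rule recursive_map_child_map[OF g nu])
  have xi_indep: "M.indep_vars (\<lambda>_. Th \<Otimes>\<^sub>M count_space UNIV) xi TT"
    and xi_law: "\<And>i. i \<in> TT \<Longrightarrow> distr M (Th \<Otimes>\<^sub>M count_space UNIV) (xi i) = nu"
    and X: "\<And>i. i \<in> TT \<Longrightarrow> X i \<in> measurable M borel" "\<And>i. i \<in> TT \<Longrightarrow> distr M borel (X i) = mu"
    and rec: "\<And>i. i \<in> TT \<Longrightarrow> AE w in M. X i w = gstar g (fst (xi i w)) (snd (xi i w)) (\<lambda>j. X (i @ [j]) w)"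
    and gen: "\<And>d. M.indep_sets (\<lambda>k. case k of None \<Rightarrow> innov_sigma M Th xi {i\<in>TT. length i < d}
             | Some i \<Rightarrow> {X i -` A \<inter> space M | A. A \<in> sets borel}) (insert None (Some ` {i\<in>TT. length i = d}))"
    using RTP unfolding invariant_RTP_def by blast+
  have nu_cong: "measurable M (Th \<Otimes>\<^sub>M count_space UNIV) = measurable M nu"
    using nu(2) by (intro measurable_cong_sets) auto
  have xi_meas: "xi i \<in> measurable M nu" if "i \<in> TT" for i
    using xi_indep that unfolding M.indep_vars_def2 nu_cong by blast
  have xi_law': "distr M nu (xi i) = nu" if "i \<in> TT" for i
    using xi_law[OF that] distr_cong[OF refl nu(2), of M "xi i" "xi i"] by simp
  have nil: "[] \<in> TT" by (simp add: TT_def)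
  have mu: "prob_space mu" "sets mu = sets borel"
    unfolding X(2)[OF nil, symmetric] using X(1)[OF nil] by (auto intro: M.prob_space_distr)
  let ?E = "\<lambda>\<omega> w. xi (map Suc w) \<omega>"
  have E_meas: "?E \<in> measurable M PN"
    by (rule measurable_PiM_single') (use xi_meas map_Suc_TT in \<open>auto simp: measurable_def\<close>)
  have E_law: "distr M PN ?E = PN"
  proof -
    have "M.indep_vars (\<lambda>_. nu) xi TT"
      using xi_indep unfolding M.indep_vars_def2 nu_cong nu(2) .
    then have "distr M (PiM TT (\<lambda>_. nu)) (\<lambda>\<omega>. \<lambda>i\<in>TT. xi i \<omega>) = PiM TT (\<lambda>i. distr M nu (xi i))"
      using nil xi_meas by (subst (asm) M.indep_vars_iff_distr_eq_PiM') auto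
    also have "\<dots> = PiM TT (\<lambda>_. nu)" by (intro PiM_cong refl xi_law')
    finally have law: "distr M (PiM TT (\<lambda>_. nu)) (\<lambda>\<omega>. \<lambda>i\<in>TT. xi i \<omega>) = PiM TT (\<lambda>_. nu)" .
    have m1: "(\<lambda>\<omega>. \<lambda>i\<in>TT. xi i \<omega>) \<in> measurable M (PiM TT (\<lambda>_. nu))"
      by (intro measurable_restrict xi_meas)
    have m2: "(\<lambda>e. \<lambda>w\<in>UNIV. e (map Suc w)) \<in> measurable (PiM TT (\<lambda>_. nu)) PN"
      by (intro measurable_restrict measurable_component_singleton map_Suc_TT)
    have "PN = distr (PiM TT (\<lambda>_. nu)) PN (\<lambda>e. \<lambda>w\<in>UNIV. e (map Suc w))"
      using distr_PiM_reindex[of TT "\<lambda>_. nu" "map Suc" UNIV] nu(1) map_Suc_TT by (simp add: inj_on_def)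
    also have "\<dots> = distr M PN ((\<lambda>e. \<lambda>w\<in>UNIV. e (map Suc w)) \<circ> (\<lambda>\<omega>. \<lambda>i\<in>TT. xi i \<omega>))"
      by (subst law[symmetric], rule distr_distr[OF m2 m1])
    also have "(\<lambda>e. \<lambda>w\<in>UNIV. e (map Suc w)) \<circ> (\<lambda>\<omega>. \<lambda>i\<in>TT. xi i \<omega>) = ?E"
      using map_Suc_TT by (auto simp: fun_eq_iff)
    finally show ?thesis ..
  qed
  show ?thesis
  proof (intro tree_process.intro tree_process_axioms.intro)
    show "distr M borel (X (map Suc [])) = mu" using X(2)[OF nil] by simp
    show "AE \<omega> in M. X (map Suc w) \<omega> = child_map g (xi (map Suc w) \<omega>) (\<lambda>j. X (map Suc (w @ [j])) \<omega>)" for w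
      using rec[OF map_Suc_TT[of w]]
    proof eventually_elim
      case (elim \<omega>)
      then show ?case
        using child_map_shift[of g "xi (map Suc w) \<omega>" "\<lambda>j. X (map Suc w @ [j]) \<omega>"] by simp
    qed
    fix n
    let ?K = "{w :: nat list. length w = n}" and ?K' = "{i \<in> TT. length i = n}"
    let ?U = "\<lambda>\<omega>. truncate_words c n (?E \<omega>)" and ?V = "\<lambda>\<omega>. \<lambda>w\<in>?K. X (map Suc w) \<omega>"
    let ?I = "innov_sigma M Th xi {i\<in>TT. length i < n}"
    let ?F = "\<lambda>i. {X i -` A \<inter> space M | A. A \<in> sets borel}"
    let ?H = "\<lambda>k. case k of None \<Rightarrow> ?I | Some i \<Rightarrow> ?F i"
    note tr = measurable_truncate_words[OF c, of n]
    have U: "?U \<in> measurable M PN" using measurable_compose[OF E_meas tr] .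
    have V: "?V \<in> measurable M (PiM ?K (\<lambda>_. borel))"
      by (intro measurable_restrict X map_Suc_TT)
    have I_sub: "(\<Union>i\<in>{i\<in>TT. length i < n}. {xi i -` A \<inter> space M | A. A \<in> sets (Th \<Otimes>\<^sub>M count_space UNIV)}) \<subseteq> Pow (space M)"
      by auto
    \<comment> \<open>The two blocks are the innovations above depth \<open>n\<close> (True) and the
      values at depth \<open>n\<close> (False). Independence of their generated sigma-algebras
      follows since the generators are stable under intersection.\<close>
    have "M.indep_sets (\<lambda>b. sigma_sets (space M) (\<Union>k\<in>case_bool {None} (Some ` ?K') b. ?H k)) UNIV"
    proof (rule M.indep_sets_collect_sigma)
      have "(\<Union>b. case_bool {None} (Some ` ?K') b) = insert None (Some ` ?K')"
        by (auto simp: UNIV_bool)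
      then show "M.indep_sets ?H (\<Union>b. case_bool {None} (Some ` ?K') b)" using gen[of n] by simp
      show "Int_stable (?H k)" for k
      proof (cases k)
        case None
        interpret S: sigma_algebra "space M" ?I
          unfolding innov_sigma_def by (rule sigma_algebra_sigma_sets[OF I_sub])
        show ?thesis
          unfolding None option.case by (intro Int_stableI S.Int)
      next
        case (Some i)
        show ?thesis
        proof (rule Int_stableI)
          fix a b assume "a \<in> ?H k" "b \<in> ?H k"
          then obtain A B where "a = X i -` A \<inter> space M" "b = X i -` B \<inter> space M" "A \<in> sets borel" "B \<in> sets borel"
            by (auto simp: Some)
          then show "a \<inter> b \<in> ?H k" by (auto simp: Some intro!: exI[of _ "A \<inter> B"])
        qed
      qed
      show "disjoint_family_on (case_bool {None} (Some ` ?K')) UNIV"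
        by (auto simp: disjoint_family_on_def split: bool.splits)
    qed
    then have ind: "M.indep_set (sigma_sets (space M) ?I) (sigma_sets (space M) (\<Union>i\<in>?K'. ?F i))"
      unfolding M.indep_set_def by (rule M.indep_sets_mono_sets) (auto split: bool.splits)
    have UV: "distr M (PN \<Otimes>\<^sub>M PiM ?K (\<lambda>_. borel)) (\<lambda>\<omega>. (?U \<omega>, ?V \<omega>)) = distr M PN ?U \<Otimes>\<^sub>M distr M (PiM ?K (\<lambda>_. borel)) ?V"
    proof (rule M.distr_pair_indep_set[OF U V ind])
      fix C assume C: "C \<in> sets PN"
      let ?S = "sigma (space M) ?I"
      have IP: "?I \<subseteq> Pow (space M)"
        unfolding innov_sigma_def using sigma_sets_into_sp[OF I_sub] by blast
      have xiS: "xi i \<in> measurable ?S nu" if "i \<in> TT" "length i < n" for i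
      proof (rule measurableI)
        show "xi i \<omega> \<in> space nu" if "\<omega> \<in> space ?S" for \<omega>
          using measurable_space[OF xi_meas[OF \<open>i \<in> TT\<close>]] that by (simp add: space_measure_of_conv)
        show "xi i -` A \<inter> space ?S \<in> sets ?S" if "A \<in> sets nu" for A
          using IP that \<open>i \<in> TT\<close> \<open>length i < n\<close>
          by (auto simp: space_measure_of_conv sets_measure_of innov_sigma_def nu(2) intro!: sigma_sets.Basic)
      qed
      have "?U \<in> measurable ?S PN"
      proof (rule measurable_PiM_single')
        show "(\<lambda>\<omega>. ?U \<omega> w) \<in> measurable ?S nu" for w
          using xiS[OF map_Suc_TT, of w] c by (cases "length w < n") (auto simp: truncate_words_def)
        show "?U \<in> space ?S \<rightarrow> UNIV \<rightarrow>\<^sub>E space nu"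
          using measurable_space[OF U] by (auto simp: space_measure_of_conv space_PiM)
      qed
      from measurable_sets[OF this C] show "?U -` C \<inter> space M \<in> sigma_sets (space M) ?I"
        using IP by (simp add: sets_measure_of space_measure_of_conv)
    next
      fix C assume C: "C \<in> sets (PiM ?K (\<lambda>_. borel :: 'a measure))"
      let ?S = "sigma (space M) (\<Union>i\<in>?K'. ?F i)"
      have IP: "(\<Union>i\<in>?K'. ?F i) \<subseteq> Pow (space M)" by auto
      have XS: "X i \<in> measurable ?S borel" if "i \<in> ?K'" for i
      proof (rule measurableI)
        show "X i -` A \<inter> space ?S \<in> sets ?S" if "A \<in> sets borel" for A
          using IP that \<open>i \<in> ?K'\<close>
          by (auto simp: space_measure_of_conv sets_measure_of intro!: sigma_sets.Basic)
      qed simp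
      have "?V \<in> measurable ?S (PiM ?K (\<lambda>_. borel))"
        by (intro measurable_restrict XS) (simp add: map_Suc_TT)
      from measurable_sets[OF this C] show "?V -` C \<inter> space M \<in> sigma_sets (space M) (\<Union>i\<in>?K'. ?F i)"
        using IP by (simp add: sets_measure_of space_measure_of_conv)
    qed
    have U_law: "distr M PN ?U = distr PN PN (truncate_words c n)"
      using distr_distr[OF tr E_meas] by (simp add: E_law comp_def)
    have V_law: "distr M (PiM ?K (\<lambda>_. borel)) ?V = PiM ?K (\<lambda>_. mu)"
    proof -
      have "M.indep_vars (\<lambda>_. borel) X ?K'"
        unfolding M.indep_vars_def2
      proof (intro conjI ballI)
        show "M.indep_sets ?F ?K'"
        proof (rule M.indep_setsI)
          show "?F i \<subseteq> M.events" if "i \<in> ?K'" for i using X(1) that by auto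
          fix A J assume J: "J \<noteq> {}" "J \<subseteq> ?K'" "finite J" and A: "\<forall>j\<in>J. A j \<in> ?F j"
          have "M.prob (\<Inter>k\<in>Some ` J. A (the k)) = (\<Prod>k\<in>Some ` J. M.prob (A (the k)))"
            using J A by (intro M.indep_setsD[OF gen[of n]]) auto
          then show "M.prob (\<Inter>j\<in>J. A j) = (\<Prod>j\<in>J. M.prob (A j))"
            by (simp add: prod.reindex)
        qed
      qed (use X(1) in auto)
      \<comment> \<open>A witness that the generation is not empty, as the characterization of
        independence by product laws requires.\<close>
      moreover have "replicate n 1 \<in> ?K'" by (auto simp: TT_def)
      then have ne: "?K' \<noteq> {}" by blast
      ultimately have "distr M (PiM ?K' (\<lambda>_. borel)) (\<lambda>\<omega>. \<lambda>i\<in>?K'. X i \<omega>) = PiM ?K' (\<lambda>i. distr M borel (X i))"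
        using X(1) by (subst (asm) M.indep_vars_iff_distr_eq_PiM') auto
      also have "\<dots> = PiM ?K' (\<lambda>_. mu)" using X(2) by (intro PiM_cong) auto
      finally have law: "distr M (PiM ?K' (\<lambda>_. borel)) (\<lambda>\<omega>. \<lambda>i\<in>?K'. X i \<omega>) = PiM ?K' (\<lambda>_. mu)" .
      let ?r = "\<lambda>x. \<lambda>w\<in>?K. x (map Suc w)"
      have m1: "(\<lambda>\<omega>. \<lambda>i\<in>?K'. X i \<omega>) \<in> measurable M (PiM ?K' (\<lambda>_. borel))"
        using X(1) by (intro measurable_restrict) auto
      have m2: "?r \<in> measurable (PiM ?K' (\<lambda>_. borel)) (PiM ?K (\<lambda>_. borel :: 'a measure))"
        by (intro measurable_restrict measurable_component_singleton) (simp add: map_Suc_TT)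
      have "PiM ?K (\<lambda>_. mu) = distr (PiM ?K' (\<lambda>_. mu)) (PiM ?K (\<lambda>_. mu)) ?r"
        using distr_PiM_reindex[of ?K' "\<lambda>_. mu" "map Suc" ?K] mu(1) map_Suc_TT by (simp add: inj_on_def)
      also have "\<dots> = distr (PiM ?K' (\<lambda>_. mu)) (PiM ?K (\<lambda>_. borel)) ?r"
        by (intro distr_cong refl sets_PiM_cong mu(2))
      also have "\<dots> = distr M (PiM ?K (\<lambda>_. borel)) (?r \<circ> (\<lambda>\<omega>. \<lambda>i\<in>?K'. X i \<omega>))"
        unfolding law[symmetric] by (rule distr_distr[OF m2 m1])
      also have "?r \<circ> (\<lambda>\<omega>. \<lambda>i\<in>?K'. X i \<omega>) = ?V"
        using map_Suc_TT by (auto simp: fun_eq_iff restrict_def)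
      finally show ?thesis ..
    qed
    show "distr M (PN \<Otimes>\<^sub>M PiM ?K (\<lambda>_. borel)) (\<lambda>\<omega>. (?U \<omega>, ?V \<omega>))
      = distr PN PN (truncate_words c n) \<Otimes>\<^sub>M PiM ?K (\<lambda>_. mu)"
      unfolding UV U_law V_law ..
  qed (rule mu c X(1) xi_meas map_Suc_TT recursive_map_axioms M.prob_space_axioms)+
qed

text \<open>Both notions use the same sigma-algebra: each innovation over \<open>TT\<close> is a
  coordinate of the renumbered family, by \<open>TT_map_Suc\<close>, and the family is measurable as
  soon as all its coordinates are.\<close>

lemma endogenous_iff_root_determined:
  assumes "tree_process nu G M mu (\<lambda>w. xi (map Suc w)) (\<lambda>w. X (map Suc w)) c"
    and nu: "sets nu = sets (Th \<Otimes>\<^sub>M count_space UNIV)"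
  shows "endogenous M Th xi X \<longleftrightarrow> tree_process.root_determined nu M (\<lambda>w. xi (map Suc w)) (\<lambda>w. X (map Suc w))"
proof -
  interpret tree_process nu G M mu "\<lambda>w. xi (map Suc w)" "\<lambda>w. X (map Suc w)" c by fact
  let ?I = "innov_sigma M Th xi TT"
  let ?S = "sigma (space M) ?I"
  have gen: "(\<Union>i\<in>TT. {xi i -` A \<inter> space M | A. A \<in> sets (Th \<Otimes>\<^sub>M count_space UNIV)}) \<subseteq> Pow (space M)" by auto
  have IP: "?I \<subseteq> Pow (space M)"
    unfolding innov_sigma_def using sigma_sets_into_sp[OF gen] by blast
  have sets_S: "sets ?S = ?I"
    using IP unfolding innov_sigma_def by (simp add: sets_measure_of sigma_sets_sigma_sets_eq gen)
  have sp: "space ?S = space M" by (simp add: space_measure_of_conv)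
  have "sets ?S = sets \<G>"
  proof (rule antisym)
    have "(\<Union>i\<in>TT. {xi i -` A \<inter> space M | A. A \<in> sets (Th \<Otimes>\<^sub>M count_space UNIV)}) \<subseteq> sets \<G>"
    proof (clarify)
      fix i A assume i: "i \<in> TT" and A: "A \<in> sets (Th \<Otimes>\<^sub>M count_space (UNIV :: enat set))"
      have "(\<lambda>\<omega>. EE \<omega> (map (\<lambda>j. j - 1) i)) \<in> measurable \<G> nu"
        by (rule measurable_compose[OF EE_measurable_G measurable_component_singleton]) simp
      then have "xi i \<in> measurable \<G> nu" by (simp only: TT_map_Suc[OF i])
      from measurable_sets[OF this] A show "xi i -` A \<inter> space M \<in> sets \<G>" by (simp add: nu)
    qed
    then have "?I \<subseteq> sets \<G>"
      unfolding innov_sigma_def using sets.sigma_sets_subset[of _ \<G>] by simp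
    then show "sets ?S \<subseteq> sets \<G>" by (simp add: sets_S)
    have "xi (map Suc w) \<in> measurable ?S nu" for w
    proof (rule measurableI)
      show "xi (map Suc w) \<omega> \<in> space nu" if "\<omega> \<in> space ?S" for \<omega>
        using measurable_space[OF E_measurable] that by (simp add: sp)
      show "xi (map Suc w) -` A \<inter> space ?S \<in> sets ?S" if "A \<in> sets nu" for A
      proof -
        have "xi (map Suc w) -` A \<inter> space M \<in> ?I"
          unfolding innov_sigma_def using that map_Suc_TT[of w] by (intro sigma_sets.Basic) (auto simp: nu)
        then show ?thesis by (simp only: sp sets_S)
      qed
    qed
    then have "EE \<in> measurable ?S PN"
      using measurable_space[OF EE_measurable]
      by (intro measurable_PiM_single') (auto simp: sp space_PiM)
    then show "sets \<G> \<subseteq> sets ?S"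
      unfolding sets_vimage_algebra2[OF EE_space] using sp by (auto dest: measurable_sets)
  qed
  then have "measurable ?S (borel :: 'b measure) = measurable \<G> borel" by (intro measurable_cong_sets) auto
  then show ?thesis by (simp add: endogenous_def root_determined_def)
qed

theorem theorem11:
  fixes Th :: "'t measure"
    and nu :: "('t \<times> enat) measure"
    and g :: "'t \<times> enat \<times> (nat \<Rightarrow> 'a::polish_space) \<Rightarrow> 'a"
    and mu :: "'a measure"
    and M :: "'w measure"
    and xi :: "nat list \<Rightarrow> 'w \<Rightarrow> 't \<times> enat"
    and X :: "nat list \<Rightarrow> 'w \<Rightarrow> 'a"
  assumes g_meas: "g \<in> measurable (Theta_star Th) borel"
    and nu_prob: "prob_space nu"
    and nu_sets: "sets nu = sets (Th \<Otimes>\<^sub>M count_space UNIV)"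
    and RTP: "invariant_RTP M Th nu g mu xi X"
  shows "(endogenous M Th xi X \<longrightarrow> bivariate_uniqueness nu g mu)
    \<and> (bivariate_uniqueness nu g mu \<and> weakly_continuous_on (biv_set mu) (T2 nu g)
         \<longrightarrow> endogenous M Th xi X)
    \<and> (endogenous M Th xi X \<longleftrightarrow>
         weak_conv_meas (\<lambda>n. (T2 nu g ^^ n) (mu \<Otimes>\<^sub>M mu)) (diag_law mu))"
proof -
  obtain c where c: "c \<in> space nu"
    using prob_space.not_empty[OF nu_prob] by blast
  have tree: "tree_process nu (child_map g) M mu (\<lambda>w. xi (map Suc w)) (\<lambda>w. X (map Suc w)) c"
    by (rule invariant_RTP_tree_process[OF g_meas nu_prob nu_sets RTP c])
  interpret tree_process nu "child_map g" M mu "\<lambda>w. xi (map Suc w)" "\<lambda>w. X (map Suc w)" c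
    by (rule tree)
  note R = recursive_map_axioms
  \<comment> \<open>\<open>T2\<close> and \<open>pair_map\<close> are identified on couplings of
    \<open>mu\<close> with itself. Uniqueness and continuity are stated on this set, and the
    iterates of the product law stay in it.\<close>
  have T2: "T2 nu g m = pair_map nu (child_map g) m" if "m \<in> biv_set mu" for m
    using T2_eq_pair_map[OF R] biv_set_prob[OF prob_mu sets_mu that] by blast
  have iter: "(\<lambda>n. (T2 nu g ^^ n) (mu \<Otimes>\<^sub>M mu)) = mn"
    using T2_iterate_eq_pair_map[OF R] biv_set_prob[OF prob_mu sets_mu product_biv_set] by blast
  have endo: "endogenous M Th xi X \<longleftrightarrow> root_determined"
    by (rule endogenous_iff_root_determined[OF tree nu_sets])
  have cont: "weakly_continuous_on (biv_set mu) (T2 nu g)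
      \<longleftrightarrow> weakly_continuous_on (biv_set mu) (pair_map nu (child_map g))"
    unfolding weakly_continuous_on_def by (simp add: T2 cong: conj_cong)
  have uniq: "bivariate_uniqueness nu g mu
      \<longleftrightarrow> (\<forall>m\<in>biv_set mu. pair_map nu (child_map g) m = m \<longrightarrow> m = diag_law mu)"
    unfolding bivariate_uniqueness_def by (simp add: T2)
  show ?thesis
    unfolding endo cont uniq iter
    using root_determined_imp_unique unique_imp_root_determined root_determined_imp_weak_conv
      weak_conv_imp_root_determined by blast
qed

end
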